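(* Let $p$ be a place of $\mathbb{Q}$ (a prime number or $\infty$), and let $L_p/\mathbb{Q}_p$ be a finite Galois extension (inside $\mathbb{C}_p$), with $L_p=\mathbb{R}$ if $p=\infty$. Then $$\liminf_{\substack{\alpha\in\mathbb{P}^1(\overline{\mathbb{Q}})\\ \alpha\text{ is totally }L_p}} h(\alpha)>0,$$ where $h$ is the absolute logarithmic Weil height.
   Context: $\mathbb{Q}_\infty=\mathbb{R}$, $\mathbb{C}_\infty=\mathbb{C}$, and for a prime $p$, $\mathbb{C}_p$ is the completion of an algebraic closure of $\mathbb{Q}_p$. An algebraic number $\alpha\in\overline{\mathbb{Q}}$ is totally $L_p$ if all of its Galois conjugates over $\mathbb{Q}$ lie in $L_p$ for each embedding $\overline{\mathbb{Q}}\hookrightarrow\mathbb{C}_p$. (Whether the single point $\infty\in\mathbb{P}^1(\overline{\mathbb{Q}})$ is counted as totally $L_p$ does not affect the statement.) Limit infimum: for an infinite set $X$ of algebraic points, $\liminf_{\alpha\in X}h(\alpha)$ is the supremum over finite subsets $F\subset X$ of $\inf_{\alpha\in X\setminus F}h(\alpha)$; thus it is positive if and only if there is $\epsilon>0$ such that $\{\alpha\in X: h(\alpha)<\epsilon\}$ is finite. *)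

theory Defs
  imports "HOL-Analysis.Analysis" "HOL-Computational_Algebra.Computational_Algebra"
begin

text \<open>
  All fields below are subfields, given by their underlying sets, of an ambient field type.
\<close>

definition is_subfield :: "'a::field set \<Rightarrow> bool" where
  "is_subfield K \<longleftrightarrow> 0 \<in> K \<and> 1 \<in> K \<and>
     (\<forall>x\<in>K. \<forall>y\<in>K. x + y \<in> K \<and> x * y \<in> K) \<and> (\<forall>x\<in>K. - x \<in> K \<and> inverse x \<in> K)"

definition field_embedding_on :: "'a::field set \<Rightarrow> ('a \<Rightarrow> 'b::field) \<Rightarrow> bool" where
  "field_embedding_on K \<sigma> \<longleftrightarrow> \<sigma> 1 = 1 \<and>
     (\<forall>x\<in>K. \<forall>y\<in>K. \<sigma> (x + y) = \<sigma> x + \<sigma> y \<and> \<sigma> (x * y) = \<sigma> x * \<sigma> y)"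

definition field_automorphism :: "'a::field set \<Rightarrow> ('a \<Rightarrow> 'a) \<Rightarrow> bool" where
  "field_automorphism K \<tau> \<longleftrightarrow> field_embedding_on K \<tau> \<and> \<tau> ` K = K"

definition spans_over :: "'a::field set \<Rightarrow> 'a set \<Rightarrow> 'a set \<Rightarrow> bool" where
  "spans_over F B E \<longleftrightarrow> (\<forall>x\<in>E. \<exists>c. (\<forall>b\<in>B. c b \<in> F) \<and> x = (\<Sum>b\<in>B. c b * b))"

definition finite_extension :: "'a::field set \<Rightarrow> 'a set \<Rightarrow> bool" where
  "finite_extension F E \<longleftrightarrow> is_subfield F \<and> is_subfield E \<and> F \<subseteq> E \<and>
     (\<exists>B. finite B \<and> B \<subseteq> E \<and> spans_over F B E)"

text \<open>The dimension, as the least cardinality of a finite spanning set; meaningful for finite extensions.\<close>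

definition extension_degree :: "'a::field set \<Rightarrow> 'a set \<Rightarrow> nat" where
  "extension_degree F E = (LEAST n. \<exists>B. finite B \<and> card B = n \<and> B \<subseteq> E \<and> spans_over F B E)"

definition finite_galois_extension :: "'a::field set \<Rightarrow> 'a set \<Rightarrow> bool" where
  "finite_galois_extension F E \<longleftrightarrow> finite_extension F E \<and>
     {x\<in>E. \<forall>\<tau>. field_automorphism E \<tau> \<and> (\<forall>y\<in>F. \<tau> y = y) \<longrightarrow> \<tau> x = x} = F"

definition algebraic_over :: "'a::field set \<Rightarrow> 'a \<Rightarrow> bool" where
  "algebraic_over F x \<longleftrightarrow> (\<exists>f. f \<noteq> 0 \<and> (\<forall>i. coeff f i \<in> F) \<and> poly f x = 0)"

definition is_algebraic_closure :: "'a::field set \<Rightarrow> 'a set \<Rightarrow> bool" where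
  "is_algebraic_closure F A \<longleftrightarrow> is_subfield F \<and> is_subfield A \<and> F \<subseteq> A \<and>
     (\<forall>x\<in>A. algebraic_over F x) \<and>
     (\<forall>f. degree f > 0 \<and> (\<forall>i. coeff f i \<in> A) \<longrightarrow> (\<exists>x\<in>A. poly f x = 0))"

definition abs_value_on :: "'a::field set \<Rightarrow> ('a \<Rightarrow> real) \<Rightarrow> bool" where
  "abs_value_on K v \<longleftrightarrow>
     (\<forall>x\<in>K. 0 \<le> v x \<and> (v x = 0 \<longleftrightarrow> x = 0)) \<and>
     (\<forall>x\<in>K. \<forall>y\<in>K. v (x * y) = v x * v y \<and> v (x + y) \<le> v x + v y)"

definition padic_val :: "nat \<Rightarrow> rat \<Rightarrow> int" where
  "padic_val p r = int (multiplicity (int p) (fst (quotient_of r)))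
                 - int (multiplicity (int p) (snd (quotient_of r)))"

definition padic_abs :: "nat \<Rightarrow> rat \<Rightarrow> real" where
  "padic_abs p r = (if r = 0 then 0 else real p powi (- padic_val p r))"

text \<open>
  In a complete valued field whose absolute value restricts to the \<open>p\<close>-adic one on the rationals,
  \<open>\<rat>\<^sub>p\<close> is the topological closure of the rationals.  The field \<open>\<complex>\<^sub>p\<close>, determined only up to
  isomorphism, is described by a predicate on types whose metric is that of the absolute value;
  completeness comes from the class \<open>complete_space\<close>.
\<close>

abbreviation padic_field :: "'k::{field_char_0,complete_space} set" where
  "padic_field \<equiv> closure \<rat>"

definition is_Cp :: "nat \<Rightarrow> 'k::{field_char_0,complete_space} itself \<Rightarrow> bool" where
  "is_Cp p TYPE('k) \<longleftrightarrow>
     (\<exists>v :: 'k \<Rightarrow> real. abs_value_on UNIV v \<and> (\<forall>x y. dist x y = v (x - y)) \<and>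
        (\<forall>r. v (of_rat r) = padic_abs p r)) \<and>
     (\<exists>A :: 'k set. is_algebraic_closure padic_field A \<and> closure A = UNIV)"

definition Qbar :: "complex set" where
  "Qbar = {\<alpha>. algebraic \<alpha>}"

definition galois_conjugate :: "complex \<Rightarrow> complex \<Rightarrow> bool" where
  "galois_conjugate \<alpha> \<beta> \<longleftrightarrow> (\<exists>\<tau>. field_automorphism Qbar \<tau> \<and> \<tau> \<alpha> = \<beta>)"

definition totally :: "'k::field set \<Rightarrow> complex \<Rightarrow> bool" where
  "totally L \<alpha> \<longleftrightarrow> \<alpha> \<in> Qbar \<and>
     (\<forall>\<beta>. galois_conjugate \<alpha> \<beta> \<longrightarrow>
        (\<forall>\<sigma> :: complex \<Rightarrow> 'k. field_embedding_on Qbar \<sigma> \<longrightarrow> \<sigma> \<beta> \<in> L))"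

text \<open>
  Each place of a number field \<open>K\<close> is represented by its unique absolute value restricting to the
  usual or to a \<open>p\<close>-adic absolute value of the rationals, made unique as a HOL function
  by \<open>extensional\<close>.
\<close>

definition places :: "complex set \<Rightarrow> (complex \<Rightarrow> real) set" where
  "places K = {v \<in> extensional K. abs_value_on K v \<and>
     ((\<forall>r. v (of_rat r) = \<bar>real_of_rat r\<bar>) \<or>
      (\<exists>p. prime p \<and> (\<forall>r. v (of_rat r) = padic_abs p r)))}"

text \<open>
  The completion \<open>K\<^sub>v\<close> is the ring of \<open>v\<close>-Cauchy sequences in \<open>K\<close> modulo the null sequences, and
  \<open>\<rat>\<^sub>v\<close> is its subfield of classes of rational sequences.  The local degree \<open>[K\<^sub>v : \<rat>\<^sub>v]\<close> is the
  least number of elements spanning \<open>K\<^sub>v\<close> over \<open>\<rat>\<^sub>v\<close>; classes are handled by representatives.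
\<close>

definition cauchy_seqs :: "'a::field set \<Rightarrow> ('a \<Rightarrow> real) \<Rightarrow> (nat \<Rightarrow> 'a) set" where
  "cauchy_seqs K v = {X. range X \<subseteq> K \<and> (\<forall>e>0. \<exists>M. \<forall>m\<ge>M. \<forall>n\<ge>M. v (X m - X n) < e)}"

definition local_degree :: "complex set \<Rightarrow> (complex \<Rightarrow> real) \<Rightarrow> nat" where
  "local_degree K v = (LEAST n. \<exists>b. (\<forall>i<n. b i \<in> cauchy_seqs K v) \<and>
     (\<forall>X \<in> cauchy_seqs K v. \<exists>c. (\<forall>i<n. c i \<in> cauchy_seqs \<rat> v) \<and>
        (\<lambda>k. v (X k - (\<Sum>i<n. c i k * b i k))) \<longlonglongrightarrow> 0))"

text \<open>
  The sum has finite support, and any number field containing \<open>\<alpha>\<close> in place of \<open>\<rat>(\<alpha>)\<close> gives the same value.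
\<close>

definition weil_height :: "complex \<Rightarrow> real" where
  "weil_height \<alpha> =
     (let K = is_subfield hull {\<alpha>}
      in (\<Sum>\<^sub>\<infinity>v\<in>places K. real (local_degree K v) / real (extension_degree \<rat> K) * ln (max 1 (v \<alpha>))))"

definition liminf_over :: "'a set \<Rightarrow> ('a \<Rightarrow> real) \<Rightarrow> ereal" where
  "liminf_over X h = (SUP F\<in>{F. finite F \<and> F \<subseteq> X}. INF \<alpha>\<in>X - F. ereal (h \<alpha>))"

end

(*
Put F(x) = x^M (x^N - 1) and D = 2 M + N.  Let m be the primitive integer minimal polynomial of
alpha, of degree d and with leading coefficient a, and let R be the set of its roots.  Unless alpha
is one of the finitely many zeros of F, the number a^D * (product of F(r) over R) is a nonzero
integer: it is fixed by all embeddings, and Gauss's lemma bounds all its p-adic absolute values by 1.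

If all roots are real, take M = 1, N = 2; then |F(r)| <= max(1, |r|)^4 / 2.  If all roots lie in L,
then for suitable M and N (depending on L only) F(r) is bounded p-adically by max(1, |r|)^D / 4,
because the unit ball of L is totally bounded, and one multiplies the real and the p-adic size of
the integer.  In both cases the D-th power of the Mahler measure of m is at least 2^d.

It remains to bound the height from below by (log Mahler measure) / d.  Each conjugate r of alpha,
together with the usual absolute value of C or a p-adic one of Qbar, induces a place of Q(alpha), and
the number of conjugates that induce a given place is at most the local degree.  The p-adic
contributions add up to log |a| by Gauss's lemma.
*)
theory Submission
  imports Defs
begin

section \<open>Linear systems and algebraic numbers\<close>

text \<open>The shape of F comes from the unit ball of L: the powers of its elements repeat up to a
  small error, so x^M (x^N - 1) is p-adically small there. Outside the ball, F(x) = - x^(2 M + N)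
  F(1/x) carries the bound over; this is why the exponent is D = 2 M + N and not the degree M + N of
  F. In the p-adic case nothing is known about the complex position of the conjugates, so |F(r)| may
  come close to 2 max(1, |r|)^D; a p-adic saving of 1/4 per conjugate turns this loss into a net
  factor 1/2, which the real case gives directly. Most of the labour lies in the height, a sum over
  absolute values weighted by local degrees that are defined as least numbers. To bound it from
  below, the p-adic absolute values must be extended to all of \<open>Qbar\<close>, the local
  degrees must be attained by finite spanning families, and the infinite sum must be shown to have
  finite support. Embeddings of \<open>Qbar\<close> into the complex numbers and into
  \<open>'k\<close> link the roots of one polynomial in the two fields.\<close>

lemma homogeneous_system_nontrivial:
  fixes A :: "'j \<Rightarrow> 'k \<Rightarrow> 'f::field"
  assumes "finite K" "finite J" "card K < card J"
  shows "\<exists>l. (\<exists>j\<in>J. l j \<noteq> 0) \<and> (\<forall>k\<in>K. (\<Sum>j\<in>J. l j * A j k) = 0)"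
  using assms
proof (induction K arbitrary: J A)
  case empty
  then have "J \<noteq> {}" by auto
  then show ?case by (intro exI[of _ "\<lambda>_. 1"]) auto
next
  case (insert n K)
  show ?case
  proof (cases "\<forall>j\<in>J. A j n = 0")
    case True
    obtain l where "\<exists>j\<in>J. l j \<noteq> 0" "\<forall>k\<in>K. (\<Sum>j\<in>J. l j * A j k) = 0"
      using insert.IH[of J A] insert.prems insert.hyps by auto
    then show ?thesis using True by (intro exI[of _ l]) auto
  next
    case False
    then obtain p where p: "p \<in> J" "A p n \<noteq> 0" by auto
    let ?J = "J - {p}"
    have "card K < card ?J" using insert.prems insert.hyps p by simp
    then obtain l where l: "\<exists>j\<in>?J. l j \<noteq> 0"
      "\<forall>k\<in>K. (\<Sum>j\<in>?J. l j * (A j k - A j n / A p n * A p k)) = 0"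
      using insert.IH[of ?J "\<lambda>j k. A j k - A j n / A p n * A p k"] insert.prems by auto
    \<comment> \<open>Elimination with the pivot \<open>A p n\<close>: this value at
      \<open>p\<close> makes equation \<open>n\<close> hold and turns the other equations into those
      of the reduced system.\<close>
    define l' where "l' = l(p := - (\<Sum>j\<in>?J. l j * (A j n / A p n)))"
    have *: "(\<Sum>j\<in>J. l' j * A j k) = (\<Sum>j\<in>?J. l j * (A j k - A j n / A p n * A p k))" for k
    proof -
      have "(\<Sum>j\<in>J. l' j * A j k) = l' p * A p k + (\<Sum>j\<in>?J. l' j * A j k)"
        using p insert.prems by (subst sum.remove[of J p]) auto
      also have "(\<Sum>j\<in>?J. l' j * A j k) = (\<Sum>j\<in>?J. l j * A j k)"
        by (intro sum.cong) (auto simp: l'_def)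
      also have "l' p * A p k = - (\<Sum>j\<in>?J. l j * (A j n / A p n * A p k))"
        by (simp add: l'_def sum_distrib_right mult.assoc)
      finally show ?thesis by (simp add: algebra_simps sum_subtractf)
    qed
    have "(\<Sum>j\<in>J. l' j * A j n) = 0" unfolding * using p by (intro sum.neutral) auto
    moreover have "\<exists>j\<in>J. l' j \<noteq> 0" using l(1) by (auto simp: l'_def)
    ultimately show ?thesis using l(2) by (intro exI[of _ l']) (auto simp: *)
  qed
qed

text \<open>Coefficients stay rational, so that one polynomial can be evaluated at \<alpha>, at its
  complex conjugates and at their images in \<open>'k\<close>, and every embedding commutes with the
  evaluation.\<close>

definition rpoly :: "rat poly \<Rightarrow> 'a::field_char_0 \<Rightarrow> 'a" where
  "rpoly g x = poly (map_poly of_rat g) x"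

lemma coeff_map_of_rat: "coeff (map_poly of_rat g) i = (of_rat (coeff g i) :: 'a::field_char_0)"
  by (simp add: coeff_map_poly)

lemma rpoly_0 [simp]: "rpoly 0 x = 0"
  by (simp add: rpoly_def)

lemma rpoly_pCons [simp]: "rpoly (pCons c g) x = of_rat c + x * rpoly g x"
proof -
  have "map_poly of_rat (pCons c g) = pCons (of_rat c) (map_poly of_rat g :: 'a poly)"
    by (intro poly_eqI) (simp add: coeff_map_poly coeff_pCons split: nat.split)
  then show ?thesis by (simp add: rpoly_def)
qed

lemma rpoly_add [simp]: "rpoly (f + g) x = rpoly f x + rpoly g x"
proof -
  have "map_poly of_rat (f + g) = (map_poly of_rat f + map_poly of_rat g :: 'a poly)"
    by (intro poly_eqI) (simp add: coeff_map_poly of_rat_add)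
  then show ?thesis by (simp add: rpoly_def)
qed

lemma rpoly_smult [simp]: "rpoly (smult c g) x = of_rat c * rpoly g x"
proof -
  have "map_poly of_rat (smult c g) = smult (of_rat c) (map_poly of_rat g :: 'a poly)"
    by (intro poly_eqI) (simp add: coeff_map_poly of_rat_mult)
  then show ?thesis by (simp add: rpoly_def)
qed

lemma rpoly_mult [simp]: "rpoly (f * g) x = rpoly f x * rpoly g x"
  by (induction f) (simp_all add: algebra_simps)

lemma rpoly_1 [simp]: "rpoly 1 x = 1"
  by (simp add: one_pCons)

lemma rpoly_minus [simp]: "rpoly (- g) x = - rpoly g x"
  using rpoly_smult[of "-1" g x] by (simp add: of_rat_minus)

lemma rpoly_diff [simp]: "rpoly (f - g) x = rpoly f x - rpoly g x"
  using rpoly_add[of f "- g" x] by simp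

lemma rpoly_sum: "rpoly (\<Sum>i\<in>I. f i) x = (\<Sum>i\<in>I. rpoly (f i) x)"
  by (induction I rule: infinite_finite_induct) auto

lemma rpoly_monom [simp]: "rpoly (monom c n) x = of_rat c * x ^ n"
proof -
  have "map_poly of_rat (monom c n) = monom (of_rat c :: 'a) n"
    by (intro poly_eqI) (simp add: coeff_map_poly)
  then show ?thesis by (simp add: rpoly_def poly_monom)
qed

lemma rpoly_altdef: "rpoly g x = (\<Sum>i\<le>degree g. of_rat (coeff g i) * x ^ i)"
proof -
  have "rpoly g x = rpoly (\<Sum>i\<le>degree g. monom (coeff g i) i) x"
    by (simp add: poly_as_sum_of_monoms)
  then show ?thesis by (simp add: rpoly_sum)
qed

lemma rpoly_of_int: "rpoly (map_poly of_int m) x = poly (map_poly of_int m) x"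
proof -
  have "map_poly of_rat (map_poly of_int m) = (map_poly of_int m :: 'a poly)"
    by (intro poly_eqI) (simp add: coeff_map_poly)
  then show ?thesis by (simp add: rpoly_def)
qed

lemma algebraic_iff_rpoly: "algebraic x \<longleftrightarrow> (\<exists>g. g \<noteq> 0 \<and> rpoly g x = 0)"
proof
  assume "algebraic x"
  then obtain p where p: "\<forall>i. coeff p i \<in> \<rat>" "p \<noteq> 0" "poly p x = 0"
    by (auto simp: algebraic_altdef)
  then obtain g where g: "p = map_poly of_rat g" using ratpolyE by blast
  with p have "g \<noteq> 0" by auto
  then show "\<exists>g. g \<noteq> 0 \<and> rpoly g x = 0" using p g by (auto simp: rpoly_def)
next
  assume "\<exists>g. g \<noteq> 0 \<and> rpoly g x = 0"
  then obtain g where g: "g \<noteq> 0" "rpoly g x = 0" by auto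
  show "algebraic x"
  proof (rule algebraicI')
    show "map_poly of_rat g \<noteq> (0 :: 'a poly)"
      using g(1) by (metis coeff_map_of_rat coeff_0 of_rat_eq_0_iff poly_eqI)
  qed (use g in \<open>auto simp: coeff_map_poly rpoly_def\<close>)
qed

section \<open>Finite-dimensional rational spaces and algebraic numbers\<close>

global_interpretation ratvs: vector_space "\<lambda>(q::rat) (x::'a::field_char_0). of_rat q * x"
  by unfold_locales (auto simp: algebra_simps of_rat_add of_rat_mult)

declare ratvs.scale_scale [simp del]

text \<open>Coordinates with respect to \<open>T\<close> turn a dependence into a homogeneous system
  with more unknowns than equations. An indexed family is used, so that a coincidence
  \<open>z i = z j\<close> also counts as a dependence.\<close>

lemma ratvs_span_dependent:
  fixes z :: "'j \<Rightarrow> 'a::field_char_0"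
  assumes "finite T" "finite J" "card T < card J" "\<And>j. j \<in> J \<Longrightarrow> z j \<in> ratvs.span T"
  shows "\<exists>l. (\<exists>j\<in>J. l j \<noteq> 0) \<and> (\<Sum>j\<in>J. of_rat (l j) * z j) = 0"
proof -
  have "\<forall>j\<in>J. \<exists>u. z j = (\<Sum>t\<in>T. of_rat (u t) * t)"
    using assms(4) unfolding ratvs.span_finite[OF assms(1)] by auto
  then obtain u where u: "\<And>j. j \<in> J \<Longrightarrow> z j = (\<Sum>t\<in>T. of_rat (u j t) * t)" by metis
  obtain l where l: "\<exists>j\<in>J. l j \<noteq> 0" "\<forall>t\<in>T. (\<Sum>j\<in>J. l j * u j t) = 0"
    using homogeneous_system_nontrivial[OF assms(1-3), of u] by auto
  have "(\<Sum>j\<in>J. of_rat (l j) * z j) = (\<Sum>j\<in>J. \<Sum>t\<in>T. of_rat (l j * u j t) * t)"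
  proof (intro sum.cong refl)
    fix j assume "j \<in> J"
    show "of_rat (l j) * z j = (\<Sum>t\<in>T. of_rat (l j * u j t) * t)"
      unfolding u[OF \<open>j \<in> J\<close>] by (simp add: sum_distrib_left of_rat_mult mult.assoc)
  qed
  also have "\<dots> = (\<Sum>t\<in>T. of_rat (\<Sum>j\<in>J. l j * u j t) * t)"
    by (subst sum.swap) (simp add: of_rat_sum sum_distrib_right)
  also have "\<dots> = 0" using l(2) by simp
  finally show ?thesis using l(1) by blast
qed

lemma algebraic_if_powers_in_span:
  assumes "finite T" "\<And>j. x ^ j \<in> ratvs.span T"
  shows "algebraic x"
proof -
  obtain l where l: "\<exists>j\<in>{..card T}. l j \<noteq> 0" "(\<Sum>j\<in>{..card T}. of_rat (l j) * x ^ j) = 0"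
    using ratvs_span_dependent[OF assms(1), of "{..card T}" "\<lambda>j. x ^ j"] assms(2) by auto
  let ?g = "\<Sum>j\<in>{..card T}. monom (l j) j"
  have "rpoly ?g x = 0" using l(2) by (simp add: rpoly_sum)
  moreover obtain j where "j \<le> card T" "l j \<noteq> 0" using l(1) by auto
  then have "coeff ?g j \<noteq> 0" by (simp add: coeff_sum)
  then have "?g \<noteq> 0" by (metis coeff_0)
  ultimately show ?thesis by (auto simp: algebraic_iff_rpoly)
qed

lemma algebraic_monic_relation:
  assumes "algebraic x"
  obtains d c where "d > 0" "x ^ d = (\<Sum>i<d. of_rat (c i) * x ^ i)"
proof -
  obtain g where g: "g \<noteq> 0" "rpoly g x = 0" using assms by (auto simp: algebraic_iff_rpoly)
  define d where "d = degree g"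
  define b where "b = coeff g d"
  have b: "b \<noteq> 0" using g by (simp add: b_def d_def)
  have eq: "of_rat b * x ^ d + (\<Sum>i<d. of_rat (coeff g i) * x ^ i) = 0"
    using g(2) unfolding rpoly_altdef d_def[symmetric] b_def
    by (simp add: lessThan_Suc_atMost[symmetric] add.commute)
  show ?thesis
  proof
    show "d > 0"
    proof (rule ccontr)
      assume "\<not> d > 0"
      then show False using eq b by simp
    qed
    have "x ^ d = - (\<Sum>i<d. of_rat (coeff g i) * x ^ i) / of_rat b"
      using eq b by (simp add: field_simps add_eq_0_iff)
    also have "\<dots> = (\<Sum>i<d. of_rat (- coeff g i / b) * x ^ i)"
      by (simp add: sum_negf[symmetric] sum_divide_distrib of_rat_divide of_rat_minus)
    finally show "x ^ d = (\<Sum>i<d. of_rat (- coeff g i / b) * x ^ i)" .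
  qed
qed

lemma ratvs_span_mult_image:
  assumes "\<And>t. t \<in> T \<Longrightarrow> x * t \<in> ratvs.span U" "y \<in> ratvs.span T"
  shows "x * y \<in> ratvs.span U"
  using assms(2)
proof (induction rule: ratvs.span_induct_alt)
  case base
  then show ?case by (simp add: ratvs.span_zero)
next
  case (step c t y)
  have "x * (of_rat c * t + y) = of_rat c * (x * t) + x * y" by (simp add: algebra_simps)
  then show ?case using step assms(1) by (metis ratvs.span_add ratvs.span_scale)
qed

lemma powers_in_finite_span:
  assumes "algebraic x"
  obtains T where "finite T" "\<And>i. x ^ i \<in> ratvs.span T"
proof -
  obtain d c where d: "d > 0" "x ^ d = (\<Sum>i<d. of_rat (c i) * x ^ i)"
    using algebraic_monic_relation[OF assms] .
  define T where "T = (\<lambda>i. x ^ i) ` {..<d}"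
  have T: "x ^ i \<in> ratvs.span T" if "i < d" for i
    using that by (intro ratvs.span_base) (auto simp: T_def)
  have "x * t \<in> ratvs.span T" if "t \<in> T" for t
  proof -
    obtain i where i: "i < d" "x * t = x ^ Suc i" using \<open>t \<in> T\<close> by (auto simp: T_def)
    show ?thesis
    proof (cases "Suc i = d")
      case True
      then have "x * t = (\<Sum>i<d. of_rat (c i) * x ^ i)" using i d(2) by simp
      then show ?thesis using T by (auto intro!: ratvs.span_sum ratvs.span_scale)
    next
      case False
      then show ?thesis unfolding i(2) using i(1) by (intro T) simp
    qed
  qed
  then have "x ^ i \<in> ratvs.span T" for i
    by (induction i) (use T[of 0] d in \<open>auto intro: ratvs_span_mult_image\<close>)
  then show ?thesis using that[of T] by (simp add: T_def)
qed

text \<open>Products of a spanning set for the powers of \<open>x\<close> with one for the powers of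
  \<open>y\<close> span all monomials. The powers of \<open>x + y\<close> and of
  \<open>x * y\<close> then stay in one finite span, which makes both algebraic.\<close>

lemma monomials_in_finite_span:
  fixes x y :: "'a::field_char_0"
  assumes "algebraic x" "algebraic y"
  obtains T where "finite T" "\<And>i j. x ^ i * y ^ j \<in> ratvs.span T"
proof -
  obtain S T where S: "finite S" "\<And>i. x ^ i \<in> ratvs.span S" and T: "finite T" "\<And>j. y ^ j \<in> ratvs.span T"
    using powers_in_finite_span[OF assms(1)] powers_in_finite_span[OF assms(2)] by metis
  let ?U = "(\<lambda>(s, t). s * t) ` (S \<times> T)"
  have "s * y ^ j \<in> ratvs.span ?U" if "s \<in> S" for s j
    by (rule ratvs_span_mult_image[OF _ T(2)]) (use that in \<open>auto intro: ratvs.span_base\<close>)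
  then have "y ^ j * x ^ i \<in> ratvs.span ?U" for i j
    by (intro ratvs_span_mult_image[OF _ S(2)]) (simp add: mult.commute)
  then show ?thesis using that[of ?U] S(1) T(1) by (simp add: mult.commute)
qed

lemma algebraic_add [intro]:
  fixes x y :: "'a::field_char_0"
  assumes "algebraic x" "algebraic y"
  shows "algebraic (x + y)"
proof -
  obtain T where T: "finite T" "\<And>i j. x ^ i * y ^ j \<in> ratvs.span T"
    using monomials_in_finite_span[OF assms] by metis
  have "(x + y) ^ n \<in> ratvs.span T" for n
  proof -
    have "(x + y) ^ n = (\<Sum>k\<le>n. of_rat (of_nat (n choose k)) * (x ^ k * y ^ (n - k)))"
      by (simp add: binomial_ring mult.assoc)
    also have "\<dots> \<in> ratvs.span T" by (intro ratvs.span_sum ratvs.span_scale T(2))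
    finally show ?thesis .
  qed
  then show ?thesis by (rule algebraic_if_powers_in_span[OF T(1)])
qed

lemma algebraic_mult [intro]:
  fixes x y :: "'a::field_char_0"
  assumes "algebraic x" "algebraic y"
  shows "algebraic (x * y)"
  using monomials_in_finite_span[OF assms]
  by (metis algebraic_if_powers_in_span power_mult_distrib)

lemma algebraic_of_rat [intro, simp]: "algebraic (of_rat q)"
  by (rule rat_imp_algebraic) auto

lemma is_subfield_Qbar: "is_subfield Qbar"
  by (auto simp: is_subfield_def Qbar_def)

section \<open>Primitive integer minimal polynomials\<close>

lemma clear_denominators:
  fixes g :: "rat poly"
  obtains c m where "c \<noteq> 0" "smult (of_int c) g = map_poly of_int m"
proof -
  define c where "c = (\<Prod>i\<le>degree g. snd (quotient_of (coeff g i)))"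
  have c: "c \<noteq> 0" unfolding c_def by (auto simp: quotient_of_denom_pos' less_imp_neq[symmetric])
  have "of_int c * coeff g i \<in> \<int>" for i
  proof (cases "i \<le> degree g")
    case True
    obtain a b where ab: "quotient_of (coeff g i) = (a, b)" by (cases "quotient_of (coeff g i)")
    then have b: "coeff g i = of_int a / of_int b" "b > 0"
      using quotient_of_div quotient_of_denom_pos by auto
    have "b dvd c" unfolding c_def using True ab by (metis atMost_iff dvd_prodI finite_atMost snd_conv)
    then obtain e where "c = b * e" by auto
    then have "of_int c * coeff g i = of_int (a * e)" using b by simp
    then show ?thesis by (metis Ints_of_int)
  qed (simp add: coeff_eq_0)
  then obtain m where "smult (of_int c) g = map_poly of_int m"
    using intpolyE[of "smult (of_int c) g"] by auto
  with c show ?thesis using that by blast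
qed

text \<open>A primitive integer multiple of the minimal polynomial.\<close>

definition is_minpoly :: "int poly \<Rightarrow> 'a::field_char_0 \<Rightarrow> bool" where
  "is_minpoly m x \<longleftrightarrow> irreducible (map_poly rat_of_int m) \<and> content m = 1 \<and>
     rpoly (map_poly of_int m) x = 0"

text \<open>A rational polynomial of least degree vanishing at \<open>x\<close> is irreducible,
  since one factor of a product already vanishes there. Clearing denominators and dividing by the
  content changes it only by a nonzero constant.\<close>

lemma exists_minpoly:
  assumes "algebraic x"
  obtains m where "is_minpoly m x"
proof -
  define P where "P = (\<lambda>g. g \<noteq> 0 \<and> rpoly g x = 0)"
  have "\<exists>g. P g" using assms by (auto simp: P_def algebraic_iff_rpoly)
  then obtain g where g: "P g" "\<And>h. P h \<Longrightarrow> degree g \<le> degree h"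
    using ex_has_least_nat[of P _ degree] by metis
  have "g \<noteq> 0" using g by (simp add: P_def)
  have irr: "irreducible g"
  proof (rule irreducibleI)
    show "g \<noteq> 0" by fact
    show "\<not> is_unit g"
    proof
      assume "is_unit g"
      then obtain c where "g = [:c:]" "c \<noteq> 0" using \<open>g \<noteq> 0\<close> by (auto simp: is_unit_poly_iff)
      then show False using g by (simp add: P_def)
    qed
    fix a b assume ab: "g = a * b"
    then have nz: "a \<noteq> 0" "b \<noteq> 0" using g by (auto simp: P_def)
    have "P a \<or> P b" using g(1) ab nz by (auto simp: P_def)
    then have "degree a = 0 \<or> degree b = 0"
      using g(2) ab nz by (fastforce simp: degree_mult_eq)
    then show "is_unit a \<or> is_unit b" using nz by (auto simp: is_unit_iff_degree)
  qed
  obtain c m where cm: "c \<noteq> 0" "smult (of_int c) g = map_poly of_int m" by (rule clear_denominators)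
  have nz: "m \<noteq> 0" using cm g by (auto simp: P_def)
  have eq: "map_poly rat_of_int m = smult (of_int (content m)) (map_poly of_int (primitive_part m))"
    (is "_ = smult _ ?p")
  proof (intro poly_eqI)
    fix i
    have "coeff m i = content m * coeff (primitive_part m) i"
      by (metis content_times_primitive_part coeff_smult)
    then show "coeff (map_poly rat_of_int m) i = coeff (smult (of_int (content m)) ?p) i"
      by (simp add: coeff_map_poly)
  qed
  have cz: "content m \<noteq> 0" using nz by simp
  have "?p = smult (of_int c / of_int (content m)) g"
    using cm(2) eq cz by (metis (no_types, lifting) of_int_eq_0_iff divide_inverse left_inverse mult.commute smult_1_left smult_smult)
  moreover have "of_int c / rat_of_int (content m) \<noteq> 0" using cm cz by simp
  ultimately obtain e where e: "e \<noteq> 0" "?p = smult e g" by blast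
  then have "?p = [:e:] * g" "is_unit [:e:]" by (auto simp: is_unit_const_poly_iff dvd_field_iff)
  then have "irreducible ?p" using irr irreducible_mult_unit_left by metis
  moreover have "rpoly ?p x = 0" using e g by (simp add: P_def)
  ultimately have "is_minpoly (primitive_part m) x" using nz by (auto simp: is_minpoly_def)
  then show ?thesis by (rule that)
qed

section \<open>Absolute values\<close>

locale subfld =
  fixes K :: "'a::field_char_0 set"
  assumes subfield: "is_subfield K"
begin

lemma K_closed [simp, intro]:
  "0 \<in> K" "1 \<in> K"
  "x \<in> K \<Longrightarrow> y \<in> K \<Longrightarrow> x + y \<in> K" "x \<in> K \<Longrightarrow> y \<in> K \<Longrightarrow> x * y \<in> K"
  "x \<in> K \<Longrightarrow> - x \<in> K" "x \<in> K \<Longrightarrow> inverse x \<in> K"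
  using subfield by (auto simp: is_subfield_def)

lemma K_diff [simp, intro]: "x \<in> K \<Longrightarrow> y \<in> K \<Longrightarrow> x - y \<in> K"
  using K_closed(3)[of x "- y"] by auto

lemma K_divide [simp, intro]: "x \<in> K \<Longrightarrow> y \<in> K \<Longrightarrow> x / y \<in> K"
  by (auto simp: divide_inverse)

lemma K_power [simp, intro]: "x \<in> K \<Longrightarrow> x ^ n \<in> K"
  by (induction n) auto

lemma K_sum [intro]: "(\<And>i. i \<in> I \<Longrightarrow> f i \<in> K) \<Longrightarrow> sum f I \<in> K"
  by (induction I rule: infinite_finite_induct) auto

lemma K_prod [intro]: "(\<And>i. i \<in> I \<Longrightarrow> f i \<in> K) \<Longrightarrow> prod f I \<in> K"
  by (induction I rule: infinite_finite_induct) auto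

lemma K_of_nat [simp, intro]: "of_nat n \<in> K"
  by (induction n) auto

lemma K_of_int [simp, intro]: "of_int n \<in> K"
  by (cases n) auto

lemma K_of_rat [simp, intro]: "of_rat r \<in> K"
  by (cases r) (auto simp: of_rat_rat)

lemma K_rpoly [intro]: "x \<in> K \<Longrightarrow> rpoly g x \<in> K"
  by (induction g) auto

end

text \<open>The carrier is a parameter because the same facts serve number fields,
  \<open>Qbar\<close> and, with carrier \<open>UNIV\<close>, the field \<open>'k\<close>.\<close>

locale absval = subfld K for K :: "'a::field_char_0 set" +
  fixes v :: "'a \<Rightarrow> real"
  assumes abs_value: "abs_value_on K v"
begin

lemma v_nonneg [simp]: "x \<in> K \<Longrightarrow> 0 \<le> v x"
  and v_eq_0 [simp]: "x \<in> K \<Longrightarrow> v x = 0 \<longleftrightarrow> x = 0"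
  and v_mult: "x \<in> K \<Longrightarrow> y \<in> K \<Longrightarrow> v (x * y) = v x * v y"
  and v_triangle: "x \<in> K \<Longrightarrow> y \<in> K \<Longrightarrow> v (x + y) \<le> v x + v y"
  using abs_value by (auto simp: abs_value_on_def)

lemma v_0 [simp]: "v 0 = 0"
  by simp

lemma v_pos: "x \<in> K \<Longrightarrow> x \<noteq> 0 \<Longrightarrow> 0 < v x"
  using v_nonneg v_eq_0 by (metis less_eq_real_def)

lemma v_1 [simp]: "v 1 = 1"
  using v_mult[of 1 1] v_eq_0[of 1] by auto

lemma v_minus [simp]: "x \<in> K \<Longrightarrow> v (- x) = v x"
proof -
  assume x: "x \<in> K"
  have "v (-1) ^ 2 = 1" using v_mult[of "-1" "-1"] by (simp add: power2_eq_square)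
  then have "v (-1) = 1" using v_nonneg[of "-1"] by (simp add: power2_eq_1_iff) (metis K_closed(2) K_closed(5) v_nonneg le_minus_one_simps(3))
  then show "v (- x) = v x" using v_mult[of "-1" x] x by simp
qed

lemma v_minus_commute: "x \<in> K \<Longrightarrow> y \<in> K \<Longrightarrow> v (x - y) = v (y - x)"
  using v_minus[of "x - y"] by simp

lemma v_diff: "x \<in> K \<Longrightarrow> y \<in> K \<Longrightarrow> v (x - y) \<le> v x + v y"
  using v_triangle[of x "- y"] by auto

lemma v_inverse: "x \<in> K \<Longrightarrow> v (inverse x) = inverse (v x)"
proof (cases "x = 0")
  case False
  assume x: "x \<in> K"
  have "v x * v (inverse x) = 1" using v_mult[of x "inverse x"] x False by auto
  then show ?thesis by (metis inverse_unique)
qed auto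

lemma v_divide: "x \<in> K \<Longrightarrow> y \<in> K \<Longrightarrow> v (x / y) = v x / v y"
  by (simp add: divide_inverse v_mult v_inverse)

lemma v_power: "x \<in> K \<Longrightarrow> v (x ^ n) = v x ^ n"
  by (induction n) (auto simp: v_mult)

lemma v_prod: "(\<And>i. i \<in> I \<Longrightarrow> f i \<in> K) \<Longrightarrow> v (prod f I) = (\<Prod>i\<in>I. v (f i))"
proof (induction I rule: infinite_finite_induct)
  case (insert i I)
  then have "prod f I \<in> K" by auto
  then show ?case using insert by (simp add: v_mult)
qed auto

lemma v_sum: "(\<And>i. i \<in> I \<Longrightarrow> f i \<in> K) \<Longrightarrow> v (sum f I) \<le> (\<Sum>i\<in>I. v (f i))"
proof (induction I rule: infinite_finite_induct)
  case (insert i I)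
  then have "v (f i + sum f I) \<le> v (f i) + v (sum f I)" by (intro v_triangle) auto
  then show ?case using insert by simp
qed auto

text \<open>Each of the n + 1 binomial terms of (x + y)^n has value at most c^n with c = max (v x)
  (v y). Hence v (x + y) is at most c times the n-th root of n + 1, for every n.\<close>

lemma ultrametric_if_bounded_on_nat:
  assumes bdd: "\<And>n. v (of_nat n) \<le> 1" and K: "x \<in> K" "y \<in> K"
  shows "v (x + y) \<le> max (v x) (v y)"
proof (rule ccontr)
  define c where "c = max (v x) (v y)"
  assume "\<not> ?thesis"
  then have lt: "c < v (x + y)" by (auto simp: c_def)
  have c0: "0 \<le> c" using K by (simp add: c_def le_max_iff_disj)
  have bound: "v (x + y) ^ n \<le> real (n + 1) * c ^ n" for n
  proof -
    have "v (x + y) ^ n = v (\<Sum>k\<le>n. of_nat (n choose k) * x ^ k * y ^ (n - k))"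
      using K by (simp add: v_power[symmetric] binomial_ring)
    also have "\<dots> \<le> (\<Sum>k\<le>n. v (of_nat (n choose k) * x ^ k * y ^ (n - k)))"
      using K by (intro v_sum) auto
    also have "\<dots> \<le> (\<Sum>k\<le>n. c ^ n)"
    proof (intro sum_mono)
      fix k assume k: "k \<in> {..n}"
      have "v (of_nat (n choose k) * x ^ k * y ^ (n - k))
          = v (of_nat (n choose k)) * (v x ^ k * v y ^ (n - k))"
        using K by (simp add: v_mult v_power)
      also have "\<dots> \<le> 1 * (c ^ k * c ^ (n - k))"
        using K bdd c0 by (intro mult_mono power_mono) (auto simp: c_def)
      also have "\<dots> = c ^ n" using k by (simp flip: power_add)
      finally show "v (of_nat (n choose k) * x ^ k * y ^ (n - k)) \<le> c ^ n" .
    qed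
    finally show ?thesis by simp
  qed
  show False
  proof (cases "c = 0")
    case True
    then show False using bound[of 1] lt by simp
  next
    case False
    then have c: "0 < c" using c0 by simp
    define t where "t = v (x + y) / c"
    have t: "1 < t" using lt c by (simp add: t_def)
    have "t ^ n \<le> real (n + 1)" for n
      using bound[of n] c by (simp add: t_def power_divide divide_le_eq)
    \<comment> \<open>The geometric decay of (1/t)^n beats the factor n + 1, so the lower bound 1
      would pass to a limit that is 0.\<close>
    then have "\<bar>inverse t\<bar> < 1" "\<And>n. 1 \<le> real (n + 1) * inverse t ^ n"
      using t by (auto simp: field_simps power_inverse)
    moreover have "(\<lambda>n. real n * inverse t ^ n + inverse t ^ n) \<longlonglongrightarrow> 0 + 0"
      using \<open>\<bar>inverse t\<bar> < 1\<close>
      by (intro tendsto_add powser_times_n_limit_0 LIMSEQ_power_zero) auto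
    ultimately have "1 \<le> (0::real)"
      by (intro LIMSEQ_le_const[of _ _ 1]) (auto simp: algebra_simps)
    then show False by simp
  qed
qed

section \<open>Density and independence of rational combinations\<close>

definition rcomb :: "'a set \<Rightarrow> ('a \<Rightarrow> rat) \<Rightarrow> 'a" where
  "rcomb S q = (\<Sum>s\<in>S. of_rat (q s) * s)"

lemma rcomb_in_K: "S \<subseteq> K \<Longrightarrow> rcomb S q \<in> K"
  by (auto simp: rcomb_def)

lemma rcomb_diff: "rcomb S q - rcomb S r = rcomb S (\<lambda>s. q s - r s)"
  by (simp add: rcomb_def sum_subtractf algebra_simps of_rat_diff)

lemma rcomb_add: "rcomb S q + rcomb S r = rcomb S (\<lambda>s. q s + r s)"
  by (simp add: rcomb_def sum.distrib algebra_simps of_rat_add)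

lemma rcomb_scale: "of_rat c * rcomb S q = rcomb S (\<lambda>s. c * q s)"
  by (simp add: rcomb_def sum_distrib_left algebra_simps of_rat_mult)

text \<open>A quantitative linear independence over the rationals: with a uniform \<open>c\<close>
  it survives limits, and the coefficients of a Cauchy sequence of combinations form Cauchy
  sequences themselves.\<close>

definition norm_indep :: "'a set \<Rightarrow> bool" where
  "norm_indep S \<longleftrightarrow> (\<exists>c>0. \<forall>q. \<forall>s\<in>S. c * v (of_rat (q s)) \<le> v (rcomb S q))"

definition approximable :: "'a set \<Rightarrow> 'a set" where
  "approximable S = {x\<in>K. \<forall>e>0. \<exists>q. v (x - rcomb S q) < e}"

lemma approximableD: "x \<in> approximable S \<Longrightarrow> e > 0 \<Longrightarrow> \<exists>q. v (x - rcomb S q) < e"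
  and approximable_in_K: "x \<in> approximable S \<Longrightarrow> x \<in> K"
  by (auto simp: approximable_def)

text \<open>\<open>S\<close> is a norm independent subset of largest cardinality. An element b of
  \<open>B\<close> that is not approximable keeps a distance e > 0 from all combinations of
  \<open>S\<close>, and this makes \<open>insert b S\<close> norm independent as well.
  \<open>S\<close> plays the role of a basis of the completion.\<close>

lemma exists_norm_indep_dense_subset:
  assumes "finite B" "B \<subseteq> K"
  obtains S where "S \<subseteq> B" "norm_indep S" "B \<subseteq> approximable S"
proof -
  let ?P = "\<lambda>S. S \<subseteq> B \<and> norm_indep S"
  have "?P {}" by (auto simp: norm_indep_def intro: exI[of _ 1])
  moreover have "\<forall>S. ?P S \<longrightarrow> card S \<le> card B" using assms by (auto intro: card_mono)
  ultimately obtain S where S: "?P S" "\<And>S'. ?P S' \<Longrightarrow> card S' \<le> card S"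
    using ex_has_greatest_nat[of ?P "{}" card "Suc (card B)"] by (metis less_Suc_eq_le)
  have fin: "finite S" using S assms by (meson finite_subset)
  have SK: "S \<subseteq> K" using S assms by auto
  have "b \<in> approximable S" if b: "b \<in> B" for b
  proof (rule ccontr)
    assume "b \<notin> approximable S"
    moreover have bK: "b \<in> K" using b assms by auto
    ultimately obtain e where e: "e > 0" "\<And>q. e \<le> v (b - rcomb S q)"
      by (force simp: approximable_def not_less)
    have "b \<notin> S"
    proof
      assume "b \<in> S"
      then have "rcomb S (\<lambda>s. if s = b then 1 else 0) = b"
        using fin by (simp add: rcomb_def if_distrib[of "of_rat"] if_distrib[of "\<lambda>x. x * _"] cong: if_cong)
      then show False using e(1) e(2)[of "\<lambda>s. if s = b then 1 else 0"] by simp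
    qed
    have ins: "rcomb (insert b S) q = of_rat (q b) * b + rcomb S q" for q
      using fin \<open>b \<notin> S\<close> by (simp add: rcomb_def)
    have ge: "v (of_rat (q b)) * e \<le> v (rcomb (insert b S) q)" for q
    proof (cases "q b = 0")
      case True
      then show ?thesis using SK bK by (simp add: rcomb_in_K)
    next
      case False
      have "rcomb (insert b S) q = of_rat (q b) * (b - rcomb S (\<lambda>s. - (q s / q b)))"
        unfolding ins right_diff_distrib rcomb_scale
        using False by (simp add: rcomb_def sum_negf of_rat_minus)
      then have "v (rcomb (insert b S) q) = v (of_rat (q b)) * v (b - rcomb S (\<lambda>s. - (q s / q b)))"
        using bK SK by (simp add: v_mult rcomb_in_K)
      then show ?thesis using e(2)[of "\<lambda>s. - (q s / q b)"] by (auto intro!: mult_left_mono)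
    qed
    obtain c where c: "c > 0" "\<And>q s. s \<in> S \<Longrightarrow> c * v (of_rat (q s)) \<le> v (rcomb S q)"
      using S(1) by (auto simp: norm_indep_def)
    \<comment> \<open>By \<open>ge\<close>, the b-part of a combination is at most v b / e times the
      whole; removing it therefore enlarges the value at most by the factor
      \<open>t\<close>.\<close>
    define t where "t = 1 + v b / e"
    have t: "t \<ge> 1" using bK e by (simp add: t_def)
    have le: "v (rcomb S q) \<le> t * v (rcomb (insert b S) q)" for q
    proof -
      have "v (rcomb S q) = v (rcomb (insert b S) q - of_rat (q b) * b)" by (simp add: ins)
      also have "\<dots> \<le> v (rcomb (insert b S) q) + v (of_rat (q b)) * v b"
        using v_diff[of "rcomb (insert b S) q" "of_rat (q b) * b"] bK SK
        by (simp add: v_mult rcomb_in_K)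
      also have "v (of_rat (q b)) * v b \<le> v b / e * v (rcomb (insert b S) q)"
        using ge[of q] e(1) mult_left_mono[OF ge[of q], of "v b / e"] bK by (simp add: field_simps)
      finally show ?thesis by (simp add: t_def algebra_simps)
    qed
    have "norm_indep (insert b S)"
      unfolding norm_indep_def
    proof (intro exI[of _ "min e (c / t)"] conjI allI ballI)
      show "0 < min e (c / t)" using e c t by simp
      fix q s assume "s \<in> insert b S"
      then consider "s = b" | "s \<in> S" by auto
      then show "min e (c / t) * v (of_rat (q s)) \<le> v (rcomb (insert b S) q)"
      proof cases
        case 1
        have "min e (c / t) * v (of_rat (q s)) \<le> e * v (of_rat (q s))" by (intro mult_right_mono) auto
        then show ?thesis using ge[of q] 1 by (simp add: mult.commute)
      next
        case 2
        have "min e (c / t) * v (of_rat (q s)) \<le> c / t * v (of_rat (q s))" by (intro mult_right_mono) auto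
        also have "\<dots> \<le> v (rcomb S q) / t" using c(2)[OF 2, of q] t by (simp add: divide_right_mono)
        also have "\<dots> \<le> v (rcomb (insert b S) q)" using le[of q] t by (simp add: field_simps)
        finally show ?thesis .
      qed
    qed
    then have "card (insert b S) \<le> card S" using S b by (intro S(2)) auto
    then show False using \<open>b \<notin> S\<close> fin by simp
  qed
  then show ?thesis using that[of S] S by auto
qed

lemma approximable_closed:
  assumes S: "S \<subseteq> K" and x: "x \<in> K"
    and lim: "\<And>e. e > 0 \<Longrightarrow> \<exists>y\<in>approximable S. v (x - y) < e"
  shows "x \<in> approximable S"
  unfolding approximable_def
proof (intro CollectI conjI x allI impI)
  fix e :: real assume "e > 0"
  then obtain y where y: "y \<in> approximable S" "v (x - y) < e / 2" using lim[of "e / 2"] by auto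
  then obtain q where q: "v (y - rcomb S q) < e / 2" "y \<in> K"
    using approximableD[OF y(1), of "e / 2"] approximable_in_K[OF y(1)] \<open>e > 0\<close> by auto
  have "v (x - rcomb S q) \<le> v (x - y) + v (y - rcomb S q)"
    using v_triangle[of "x - y" "y - rcomb S q"] x q(2) S by (simp add: rcomb_in_K)
  then show "\<exists>q. v (x - rcomb S q) < e" using y(2) q(1) by (intro exI[of _ q]) linarith
qed

lemma approximable_add_scale:
  assumes S: "S \<subseteq> K" and xy: "x \<in> approximable S" "y \<in> approximable S"
  shows "of_rat c * x + y \<in> approximable S"
  unfolding approximable_def
proof (intro CollectI conjI allI impI)
  have K: "x \<in> K" "y \<in> K" using xy by (auto simp: approximable_def)
  then show "of_rat c * x + y \<in> K" by auto
  fix e :: real assume e: "e > 0"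
  define d where "d = e / (v (of_rat c) + 1)"
  have pos: "0 < v (of_rat c) + 1" using v_nonneg[of "of_rat c"] by (simp add: add_nonneg_pos)
  then have "d > 0" using e by (simp add: d_def)
  then obtain q r where qr: "v (x - rcomb S q) < d" "v (y - rcomb S r) < d"
    using approximableD[OF xy(1)] approximableD[OF xy(2)] by metis
  have "of_rat c * x + y - rcomb S (\<lambda>s. c * q s + r s) = of_rat c * (x - rcomb S q) + (y - rcomb S r)"
    by (simp add: rcomb_add[symmetric] rcomb_scale[symmetric] right_diff_distrib)
  also have "v \<dots> \<le> v (of_rat c) * v (x - rcomb S q) + v (y - rcomb S r)"
    unfolding v_mult[OF K_of_rat K_diff[OF K(1) rcomb_in_K[OF S]], symmetric]
    using S K by (intro v_triangle) (auto simp: rcomb_in_K)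
  also have "\<dots> < v (of_rat c) * d + d" using qr by (intro add_le_less_mono mult_left_mono) auto
  also have "\<dots> = (v (of_rat c) + 1) * d" by (simp add: distrib_right)
  also have "\<dots> = e" using pos by (simp add: d_def)
  finally show "\<exists>q. v (of_rat c * x + y - rcomb S q) < e" by blast
qed

lemma approximable_0: "0 \<in> approximable S"
  by (auto simp: approximable_def rcomb_def intro!: exI[of _ "\<lambda>_. 0"])

lemma approximable_scale: "S \<subseteq> K \<Longrightarrow> x \<in> approximable S \<Longrightarrow> of_rat c * x \<in> approximable S"
  using approximable_add_scale[OF _ _ approximable_0] by fastforce

lemma approximable_sum:
  assumes "S \<subseteq> K" "\<And>i. i \<in> I \<Longrightarrow> f i \<in> approximable S"
  shows "sum f I \<in> approximable S"
  using assms(2)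
proof (induction I rule: infinite_finite_induct)
  case (insert i I)
  then show ?case using approximable_add_scale[OF assms(1), of "f i" "sum f I" 1] by simp
qed (auto simp: approximable_0)

end

section \<open>Attainment of the local degree\<close>

definition local_span :: "complex set \<Rightarrow> (complex \<Rightarrow> real) \<Rightarrow> nat \<Rightarrow> (nat \<Rightarrow> nat \<Rightarrow> complex) \<Rightarrow> bool" where
  "local_span K v n b \<longleftrightarrow> (\<forall>i<n. b i \<in> cauchy_seqs K v) \<and>
     (\<forall>X \<in> cauchy_seqs K v. \<exists>c. (\<forall>i<n. c i \<in> cauchy_seqs \<rat> v) \<and>
        (\<lambda>k. v (X k - (\<Sum>i<n. c i k * b i k))) \<longlonglongrightarrow> 0)"

text \<open>Without a finite spanning family the \<open>LEAST\<close> in the local degree would be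
  an unspecified number. The constant sequences from a norm independent \<open>S\<close> serve: the
  terms of a Cauchy sequence are approximated by rational combinations of \<open>S\<close>, and norm
  independence makes the coefficient sequences Cauchy.\<close>

lemma local_span_exists:
  assumes "absval K v" and B: "finite B" "B \<subseteq> K" "K \<subseteq> ratvs.span B"
  shows "\<exists>n b. local_span K v n b"
proof -
  interpret absval K v by fact
  obtain S where S: "S \<subseteq> B" "norm_indep S" "B \<subseteq> approximable S"
    using exists_norm_indep_dense_subset[OF B(1,2)] .
  have SK: "S \<subseteq> K" and fin: "finite S" using S B finite_subset by auto
  have appr: "x \<in> approximable S" if x: "x \<in> K" for x
  proof -
    obtain u where "x = (\<Sum>b\<in>B. of_rat (u b) * b)"
      using B(3) x unfolding ratvs.span_finite[OF B(1)] by blast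
    then show ?thesis using S(3) by (auto intro!: approximable_sum approximable_scale SK)
  qed
  obtain c where c: "c > 0" "\<And>q s. s \<in> S \<Longrightarrow> c * v (of_rat (q s)) \<le> v (rcomb S q)"
    using S(2) by (auto simp: norm_indep_def)
  define n where "n = card S"
  obtain f where f: "bij_betw f {..<n} S" using fin ex_bij_betw_nat_finite
    by (metis atLeast0LessThan n_def)
  have fS: "f i \<in> S" if "i < n" for i using f that by (auto dest: bij_betwE)
  define b where "b = (\<lambda>i (k::nat). f i)"
  have "local_span K v n b"
    unfolding local_span_def
  proof (intro conjI ballI allI impI)
    fix i assume "i < n"
    then show "b i \<in> cauchy_seqs K v" using fS SK by (auto simp: b_def cauchy_seqs_def)
  next
    fix X assume X: "X \<in> cauchy_seqs K v"
    then have XK: "X k \<in> K" for k by (auto simp: cauchy_seqs_def)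
    have "\<exists>q. v (X k - rcomb S q) < 1 / real (Suc k)" for k
      using approximableD[OF appr[OF XK[of k]]] by simp
    then obtain q where q: "\<And>k. v (X k - rcomb S (q k)) < 1 / real (Suc k)" by metis
    have K1: "X k - rcomb S (q k) \<in> K" for k using XK SK by (simp add: rcomb_in_K)
    have lim: "(\<lambda>k. v (X k - rcomb S (q k))) \<longlonglongrightarrow> 0"
    proof (rule tendsto_sandwich[of "\<lambda>_. 0" _ _ "\<lambda>k. 1 / real (Suc k)"])
      show "(\<lambda>k. 1 / real (Suc k)) \<longlonglongrightarrow> 0" using LIMSEQ_inverse_real_of_nat by (simp add: inverse_eq_divide)
    qed (use q K1 in \<open>auto intro!: always_eventually less_imp_le\<close>)
    have sums: "(\<Sum>i<n. of_rat (q k (f i)) * b i k) = rcomb S (q k)" for k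
      unfolding rcomb_def b_def using sum.reindex_bij_betw[OF f, of "\<lambda>s. of_rat (q k s) * s"] by simp
    have cau: "(\<lambda>k. of_rat (q k s)) \<in> cauchy_seqs \<rat> v" if s: "s \<in> S" for s
      unfolding cauchy_seqs_def
    proof (intro CollectI conjI allI impI)
      fix e :: real assume e: "e > 0"
      \<comment> \<open>One third for the Cauchy difference of \<open>X\<close> and one for each of
        the two approximation errors; the factor \<open>c\<close> is lost when passing from the
        combination to a single coefficient.\<close>
      then have ce: "c * e / 3 > 0" using c by simp
      have "\<forall>e>0. \<exists>M. \<forall>m\<ge>M. \<forall>n\<ge>M. v (X m - X n) < e" using X by (simp add: cauchy_seqs_def)
      from this[rule_format, OF ce]
      obtain M where M: "\<And>m n. m \<ge> M \<Longrightarrow> n \<ge> M \<Longrightarrow> v (X m - X n) < c * e / 3" by blast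
      obtain M' where M': "\<And>m. m \<ge> M' \<Longrightarrow> v (X m - rcomb S (q m)) < c * e / 3"
        using order_tendstoD(2)[OF lim ce] unfolding eventually_sequentially by blast
      show "\<exists>M. \<forall>m\<ge>M. \<forall>n\<ge>M. v (of_rat (q m s) - of_rat (q n s)) < e"
      proof (intro exI[of _ "max M M'"] allI impI)
        fix i j assume ij: "i \<ge> max M M'" "j \<ge> max M M'"
        have "c * v (of_rat (q i s) - of_rat (q j s)) \<le> v (rcomb S (q i) - rcomb S (q j))"
          using c(2)[OF s, of "\<lambda>s. q i s - q j s"] by (simp add: rcomb_diff of_rat_diff)
        also have "rcomb S (q i) - rcomb S (q j) =
            (X j - rcomb S (q j)) + ((X i - X j) - (X i - rcomb S (q i)))" by simp
        also have "v \<dots> \<le> v (X j - rcomb S (q j)) + v ((X i - X j) - (X i - rcomb S (q i)))"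
          by (intro v_triangle K_diff XK K1)
        also have "v ((X i - X j) - (X i - rcomb S (q i))) \<le> v (X i - X j) + v (X i - rcomb S (q i))"
          by (intro v_diff K_diff XK K1)
        also have "v (X j - rcomb S (q j)) + (v (X i - X j) + v (X i - rcomb S (q i))) < c * e"
          using M[of i j] M'[of i] M'[of j] ij by simp
        finally show "v (of_rat (q i s) - of_rat (q j s)) < e" using c by simp
      qed
    qed auto
    show "\<exists>c. (\<forall>i<n. c i \<in> cauchy_seqs \<rat> v) \<and> (\<lambda>k. v (X k - (\<Sum>i<n. c i k * b i k))) \<longlonglongrightarrow> 0"
      using lim cau fS by (intro exI[of _ "\<lambda>i k. of_rat (q k (f i))"]) (simp add: sums)
  qed
  then show ?thesis by blast
qed

lemma local_span_local_degree:
  assumes "absval K v" "finite B" "B \<subseteq> K" "K \<subseteq> ratvs.span B"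
  obtains b where "local_span K v (local_degree K v) b"
proof -
  have "\<exists>b. local_span K v (LEAST n. \<exists>b. local_span K v n b) b"
    using local_span_exists[OF assms] LeastI_ex[of "\<lambda>n. \<exists>b. local_span K v n b"] by blast
  then show ?thesis using that by (auto simp: local_degree_def local_span_def)
qed

section \<open>The \<open>p\<close>-adic absolute value and Gauss's lemma\<close>

lemma padic_abs_of_int:
  assumes "prime p" "n \<noteq> 0"
  shows "padic_abs p (of_int n) = 1 / real p ^ multiplicity (int p) n"
proof -
  have "quotient_of (of_int n) = (n, 1)" using quotient_of_int[of n] by (simp add: of_int_def)
  then have "padic_val p (of_int n) = int (multiplicity (int p) n)"
    using assms by (simp add: padic_val_def)
  then show ?thesis using assms by (simp add: padic_abs_def power_int_minus divide_inverse)
qed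

lemma padic_abs_0 [simp]: "padic_abs p 0 = 0"
  by (simp add: padic_abs_def)

lemma padic_abs_of_int_le_1:
  assumes "prime p"
  shows "padic_abs p (of_int n) \<le> 1"
proof (cases "n = 0")
  case False
  have "1 \<le> real p ^ multiplicity (int p) n"
    using prime_ge_1_nat[OF assms] by (intro one_le_power) auto
  then show ?thesis using padic_abs_of_int[OF assms False] by (simp only: divide_le_eq_1) auto
qed simp

lemma padic_abs_of_int_eq_1:
  assumes "prime p" "\<not> int p dvd n"
  shows "padic_abs p (of_int n) = 1"
proof -
  have "n \<noteq> 0" using assms by auto
  then show ?thesis using padic_abs_of_int[OF assms(1), of n] assms by (simp add: not_dvd_imp_multiplicity_0)
qed

lemma padic_abs_prime: "prime p \<Longrightarrow> padic_abs p (of_nat p) = 1 / real p"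
  using padic_abs_of_int[of p "int p"] by (auto simp: prime_gt_0_nat)

lemma padic_abs_quotient:
  assumes "prime p" "quotient_of r = (a, b)"
  shows "padic_abs p r = padic_abs p (of_int a) / padic_abs p (of_int b)"
proof (cases "r = 0")
  case True
  then show ?thesis using assms by simp
next
  case False
  have b: "b > 0" "r = of_int a / of_int b" using assms quotient_of_denom_pos quotient_of_div by auto
  then have "a \<noteq> 0" using False by auto
  have p0: "real p \<noteq> 0" using assms(1) by auto
  have "padic_abs p r = real p powi (int (multiplicity (int p) b) - int (multiplicity (int p) a))"
    using False assms by (simp add: padic_abs_def padic_val_def)
  also have "\<dots> = padic_abs p (of_int a) / padic_abs p (of_int b)"
    using p0 by (simp add: power_int_diff padic_abs_of_int[OF assms(1)] b \<open>a \<noteq> 0\<close> less_imp_neq[symmetric])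
  finally show ?thesis .
qed

text \<open>A prime dividing the reduced denominator does not divide the numerator, so the value at
  that prime would exceed 1.\<close>

lemma Ints_if_padic_abs_le_1:
  assumes "\<And>p. prime p \<Longrightarrow> padic_abs p r \<le> 1"
  shows "r \<in> \<int>"
proof -
  obtain a b where ab: "quotient_of r = (a, b)" by (cases "quotient_of r")
  have b: "b > 0" "r = of_int a / of_int b" "coprime a b"
    using ab quotient_of_denom_pos quotient_of_div quotient_of_coprime by auto
  have "b = 1"
  proof (rule ccontr)
    assume "b \<noteq> 1"
    then have "\<not> is_unit b" using b(1) by (auto simp: zdvd1_eq)
    then obtain q where q: "prime q" "q dvd b" using b(1) prime_divisor_exists[of b] by auto
    then obtain p where p: "q = int p" "prime p"
      by (metis prime_ge_0_int nonneg_int_cases prime_int_nat_transfer nat_int)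
    have na: "\<not> int p dvd a" using b(3) q p by (metis coprime_common_divisor not_prime_unit)
    have "1 \<le> multiplicity (int p) b"
      using q p b(1) by (metis multiplicity_geI not_prime_unit power_one_right less_imp_neq)
    then have "real p ^ 1 \<le> real p ^ multiplicity (int p) b"
      using prime_ge_1_nat[OF p(2)] by (intro power_increasing) auto
    also have "\<dots> = padic_abs p r"
      using b(1) by (simp add: padic_abs_quotient[OF p(2) ab] padic_abs_of_int_eq_1[OF p(2) na] padic_abs_of_int[OF p(2)])
    also have "\<dots> \<le> 1" using assms p by auto
    finally show False using prime_gt_1_nat[OF p(2)] by simp
  qed
  then show ?thesis using b by simp
qed

text \<open>The full power of p in \<open>n\<close> divides \<open>n\<close> and so is at most |n|.
  In this form the p-adic smallness of a nonzero integer becomes real largeness.\<close>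

lemma one_le_abs_times_padic_abs:
  assumes "prime p" "n \<noteq> 0"
  shows "1 \<le> \<bar>real_of_int n\<bar> * padic_abs p (of_int n)"
proof -
  have "int p ^ multiplicity (int p) n dvd n" by (rule multiplicity_dvd)
  then have "int p ^ multiplicity (int p) n \<le> \<bar>n\<bar>" using dvd_imp_le_int[OF assms(2)] by fastforce
  then have "real_of_int (int p ^ multiplicity (int p) n) \<le> real_of_int \<bar>n\<bar>" by (simp only: of_int_le_iff)
  moreover have "0 < real p ^ multiplicity (int p) n" using prime_gt_0_nat[OF assms(1)] by simp
  ultimately show ?thesis unfolding padic_abs_of_int[OF assms] by (simp add: le_divide_eq_1_pos)
qed

text \<open>The logarithm of the prime factorization, that is, the product formula for an integer.
  It will distribute the leading coefficient over the p-adic places.\<close>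

lemma ln_abs_int_eq_sum_padic:
  assumes "n \<noteq> 0"
  shows "ln \<bar>real_of_int n\<bar> = (\<Sum>p\<in>prime_factors (nat \<bar>n\<bar>). - ln (padic_abs p (of_int n)))"
proof -
  define N where "N = nat \<bar>n\<bar>"
  have N: "N > 0" using assms by (simp add: N_def)
  have mult: "multiplicity (int p) n = multiplicity p N" for p
  proof -
    have "multiplicity (int p) n = multiplicity (int p) \<bar>n\<bar>" by (simp add: abs_if)
    also have "\<dots> = multiplicity (int p) (int N)" by (simp add: N_def)
    also have "\<dots> = multiplicity p N"
      unfolding multiplicity_def by (simp flip: of_nat_power)
    finally show ?thesis .
  qed
  have "real N = (\<Prod>p\<in>prime_factors N. real p ^ multiplicity p N)"
    using prime_factorization_nat[OF N] by (metis (no_types, lifting) of_nat_power of_nat_prod prod.cong)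
  then have "ln (real N) = (\<Sum>p\<in>prime_factors N. ln (real p ^ multiplicity p N))"
    by (simp only:) (auto intro!: ln_prod simp: in_prime_factors_iff)
  also have "\<dots> = (\<Sum>p\<in>prime_factors N. - ln (padic_abs p (of_int n)))"
  proof (intro sum.cong refl)
    fix p assume "p \<in> prime_factors N"
    then have p: "prime p" by auto
    show "ln (real p ^ multiplicity p N) = - ln (padic_abs p (of_int n))"
      using prime_gt_0_nat[OF p] by (simp add: padic_abs_of_int[OF p assms] mult ln_div)
  qed
  finally show ?thesis using assms by (simp add: N_def)
qed

lemma (in absval) padic_abs_on_rat:
  assumes "prime p" "\<And>n. v (of_int n) = padic_abs p (of_int n)"
  shows "v (of_rat r) = padic_abs p r"
proof -
  obtain a b where ab: "quotient_of r = (a, b)" by (cases "quotient_of r")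
  then have "of_rat r = (of_int a / of_int b :: 'a)" using quotient_of_div[OF ab] by (simp add: of_rat_divide)
  then show ?thesis using padic_abs_quotient[OF assms(1) ab] assms(2) by (simp add: v_divide)
qed

section \<open>Ultrametric absolute values and the Gauss norm\<close>

locale nonarch = absval +
  assumes ultra: "x \<in> K \<Longrightarrow> y \<in> K \<Longrightarrow> v (x + y) \<le> max (v x) (v y)"
begin

lemma v_add_dominant:
  assumes "x \<in> K" "y \<in> K" "v x < v y"
  shows "v (x + y) = v y"
proof (rule antisym)
  show "v (x + y) \<le> v y" using ultra[of x y] assms by simp
  have "v y \<le> max (v (x + y)) (v x)" using ultra[of "x + y" "- x"] assms by simp
  then show "v y \<le> v (x + y)" using assms by auto
qed

lemma ultra_sum:
  assumes "\<And>i. i \<in> I \<Longrightarrow> f i \<in> K" "\<And>i. i \<in> I \<Longrightarrow> v (f i) \<le> c" "0 \<le> c"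
  shows "v (sum f I) \<le> c"
  using assms(1,2)
proof (induction I rule: infinite_finite_induct)
  case (insert i I)
  then have "v (f i + sum f I) \<le> max (v (f i)) (v (sum f I))" by (intro ultra) auto
  also have "\<dots> \<le> c" using insert by auto
  finally show ?case using insert by simp
qed (use assms(3) in auto)

definition has_gauss_norm :: "'a poly \<Rightarrow> real \<Rightarrow> bool" where
  "has_gauss_norm p c \<longleftrightarrow> (\<forall>i. coeff p i \<in> K \<and> v (coeff p i) \<le> c) \<and> (\<exists>i. v (coeff p i) = c)"

text \<open>The upper bound is the ultrametric inequality. It is attained because at a suitable
  index one of the two terms of the new coefficient strictly dominates the other.\<close>

lemma gauss_norm_linear_factor:
  assumes p: "has_gauss_norm p c" "p \<noteq> 0" and r: "r \<in> K"
  shows "has_gauss_norm ([:- r, 1:] * p) (max 1 (v r) * c)"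
proof -
  have K: "coeff p i \<in> K" and le: "v (coeff p i) \<le> c" for i using p by (auto simp: has_gauss_norm_def)
  obtain i0 where i0: "v (coeff p i0) = c" using p by (auto simp: has_gauss_norm_def)
  have "v (lead_coeff p) > 0" using p(2) K by (intro v_pos) auto
  then have c: "c > 0" using le[of "degree p"] by linarith
  have co: "coeff ([:- r, 1:] * p) i = - (r * coeff p i) + (if i = 0 then 0 else coeff p (i - 1))" for i
    by (cases i) auto
  define q where "q = [:- r, 1:] * p"
  have upper: "v (coeff q i) \<le> max 1 (v r) * c" for i
  proof -
    have "v (coeff q i) \<le> max (v (- (r * coeff p i))) (v (if i = 0 then 0 else coeff p (i - 1)))"
      unfolding q_def co using K r by (intro ultra) auto
    also have "\<dots> \<le> max 1 (v r) * c"
    proof (intro max.boundedI)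
      show "v (- (r * coeff p i)) \<le> max 1 (v r) * c"
        using K r le[of i] c by (auto simp: v_mult intro!: mult_mono)
      have "v (if i = 0 then 0 else coeff p (i - 1)) \<le> 1 * c" using le c by auto
      also have "\<dots> \<le> max 1 (v r) * c" using c by (intro mult_right_mono) auto
      finally show "v (if i = 0 then 0 else coeff p (i - 1)) \<le> max 1 (v r) * c" .
    qed
    finally show ?thesis .
  qed
  moreover have "\<exists>i. v (coeff q i) = max 1 (v r) * c"
  proof (cases "v r \<le> 1")
    case True
    \<comment> \<open>The last index of maximal value is taken: the next coefficient is strictly
      smaller, so at index i + 1 the term shifted by X dominates.\<close>
    have "\<forall>i. v (coeff p i) = c \<longrightarrow> i \<le> degree p"
      using c by (metis coeff_eq_0 less_irrefl not_le v_0)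
    then obtain i where i: "v (coeff p i) = c" "\<And>j. v (coeff p j) = c \<Longrightarrow> j \<le> i"
      using GreatestI_nat[of "\<lambda>i. v (coeff p i) = c" i0 "degree p"]
        Greatest_le_nat[of "\<lambda>i. v (coeff p i) = c" _ "degree p"] i0 by metis
    have "v (coeff p (Suc i)) \<noteq> c" using i(2)[of "Suc i"] by auto
    then have "v (coeff p (Suc i)) < c" using le[of "Suc i"] by simp
    moreover have "v (r * coeff p (Suc i)) \<le> 1 * v (coeff p (Suc i))"
      unfolding v_mult[OF r K] using True K by (intro mult_right_mono) auto
    ultimately have "v (- (r * coeff p (Suc i))) < v (coeff p i)" using i K r by simp
    then have "v (coeff q (Suc i)) = v (coeff p i)"
      unfolding q_def co using K r by (subst v_add_dominant) auto
    then show ?thesis using i True by (intro exI[of _ "Suc i"]) simp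
  next
    case False
    \<comment> \<open>For v r > 1 any maximal coefficient works, since the factor r lifts it above
      every coefficient without that factor.\<close>
    have "v (if i0 = 0 then 0 else coeff p (i0 - 1)) \<le> 1 * c" using le c by auto
    also have "\<dots> < v r * c" using False c by simp
    also have "\<dots> = v (- (r * coeff p i0))" using K r i0 by (simp add: v_mult)
    finally have "v (coeff q i0) = v (- (r * coeff p i0))"
      unfolding q_def co using K r by (subst add.commute, intro v_add_dominant) auto
    then show ?thesis using K r i0 False by (intro exI[of _ i0]) (simp add: v_mult)
  qed
  moreover have "coeff q i \<in> K" for i unfolding q_def co using K r by auto
  ultimately show ?thesis by (simp add: has_gauss_norm_def q_def)
qed

lemma gauss_norm_prod:
  assumes "finite R" "R \<subseteq> K" "a \<in> K" "a \<noteq> 0"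
  shows "has_gauss_norm (smult a (\<Prod>r\<in>R. [:- r, 1:])) (v a * (\<Prod>r\<in>R. max 1 (v r)))"
  using assms(1,2)
proof (induction R)
  case empty
  then show ?case using assms(3) by (auto simp: has_gauss_norm_def coeff_pCons split: nat.split intro!: exI[of _ 0])
next
  case (insert r R)
  have "smult a (\<Prod>r\<in>R. [:- r, 1:]) \<noteq> 0" using insert assms by (auto simp: smult_eq_0_iff)
  from gauss_norm_linear_factor[OF insert.IH this, of r] show ?case
    using insert by (simp add: mult_ac)
qed

text \<open>Primitivity gives Gauss norm 1: the coefficients are integers and one of them is prime
  to p. Multiplicativity computes the same norm from the roots.\<close>

lemma gauss_lemma_primitive:
  assumes p: "prime p" "\<And>n. v (of_int n) = padic_abs p (of_int n)"
    and m: "content m = 1" and R: "finite R" "R \<subseteq> K" "a \<noteq> 0"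
    and eq: "map_poly of_int m = smult (of_int a) (\<Prod>r\<in>R. [:- r, 1:])"
  shows "v (of_int a) * (\<Prod>r\<in>R. max 1 (v r)) = 1"
proof -
  define c where "c = v (of_int a) * (\<Prod>r\<in>R. max 1 (v r))"
  have g: "has_gauss_norm (map_poly of_int m) c"
    unfolding c_def eq using R by (intro gauss_norm_prod) auto
  have "\<exists>i. v (coeff (map_poly of_int m) i) = c" using g by (auto simp: has_gauss_norm_def)
  then have "c \<le> 1" using padic_abs_of_int_le_1[OF p(1)] p(2) by (auto simp: coeff_map_poly)
  moreover have "1 \<le> c"
  proof -
    have "\<not> int p dvd content m" unfolding m using prime_gt_1_nat[OF p(1)] by (simp only: zdvd1_eq)
    then obtain i where "\<not> int p dvd coeff m i" by (metis const_poly_dvd_iff const_poly_dvd_iff_dvd_content)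
    then have "v (coeff (map_poly of_int m) i) = 1"
      using padic_abs_of_int_eq_1[OF p(1)] p(2) by (simp add: coeff_map_poly)
    then show ?thesis using g unfolding has_gauss_norm_def by metis
  qed
  ultimately show ?thesis by (simp add: c_def)
qed

end

section \<open>Conjugates\<close>

text \<open>A nonzero polynomial \<open>h\<close> of least degree vanishing at \<open>x\<close>
  divides every other one, in particular the irreducible \<open>m\<close>, so the two agree up to a
  constant.\<close>

lemma rpoly_eq_0_iff_minpoly_dvd:
  assumes "is_minpoly m x"
  shows "rpoly g x = 0 \<longleftrightarrow> map_poly of_int m dvd g"
proof
  let ?m = "map_poly rat_of_int m"
  have m: "irreducible ?m" "rpoly ?m x = 0" using assms by (auto simp: is_minpoly_def)
  assume g: "rpoly g x = 0"
  obtain h where h: "h \<noteq> 0" "rpoly h x = 0" "\<And>f. f \<noteq> 0 \<Longrightarrow> rpoly f x = 0 \<Longrightarrow> degree h \<le> degree f"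
    using ex_has_least_nat[of "\<lambda>h. h \<noteq> 0 \<and> rpoly h x = 0" ?m degree] m by (auto simp: irreducible_def)
  have dvd: "h dvd f" if "rpoly f x = 0" for f
  proof -
    have "rpoly (f mod h) x = 0"
      using that h(2) by (simp add: minus_div_mult_eq_mod[symmetric])
    then have "f mod h = 0"
      using h(3)[of "f mod h"] degree_mod_less[OF h(1), of f] by linarith
    then show ?thesis by (simp add: dvd_eq_mod_eq_0)
  qed
  obtain k where k: "?m = h * k" using dvd[OF m(2)] by (auto elim: dvdE)
  have "\<not> is_unit h"
  proof
    assume "is_unit h"
    then obtain c where "h = [:c:]" using h(1) by (auto simp: is_unit_poly_iff)
    then show False using h by simp
  qed
  then have "is_unit k" using irreducibleD[OF m(1) k] by simp
  then have "?m dvd h" unfolding k by (simp add: mult_unit_dvd_iff)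
  then show "?m dvd g" using dvd[OF g] dvd_trans by blast
qed (use assms in \<open>auto simp: is_minpoly_def\<close>)

lemma is_minpoly_conjugate:
  "is_minpoly m x \<Longrightarrow> rpoly (map_poly of_int m) y = 0 \<Longrightarrow> is_minpoly m y"
  by (simp add: is_minpoly_def)

lemma is_minpoly_nonzero: "is_minpoly m x \<Longrightarrow> m \<noteq> 0"
  by (auto simp: is_minpoly_def)

lemma degree_minpoly_pos:
  assumes "is_minpoly m x"
  shows "degree m > 0"
proof (rule ccontr)
  assume "\<not> degree m > 0"
  then have "degree (map_poly rat_of_int m) = 0" by (simp add: degree_map_poly)
  moreover have "map_poly rat_of_int m \<noteq> 0" "\<not> is_unit (map_poly rat_of_int m)"
    using assms by (auto simp: is_minpoly_def irreducible_def)
  ultimately show False by (simp add: is_unit_iff_degree)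
qed

definition conjugates :: "int poly \<Rightarrow> complex set" where
  "conjugates m = {z. poly (map_poly of_int m) z = 0}"

lemma conjugates_iff: "r \<in> conjugates m \<longleftrightarrow> rpoly (map_poly of_int m) r = 0"
  by (simp add: conjugates_def rpoly_of_int)

text \<open>The roots are simple: a common root of \<open>m\<close> and its derivative also has
  \<open>m\<close> as minimal polynomial, so \<open>m\<close> would divide its own derivative, which
  fails in characteristic 0 for positive degree.\<close>

lemma minpoly_splits:
  assumes m: "is_minpoly m x"
  shows "finite (conjugates m)" "card (conjugates m) = degree m" "x \<in> conjugates m" "conjugates m \<subseteq> Qbar"
    "map_poly of_int m = smult (of_int (lead_coeff m)) (\<Prod>r\<in>conjugates m. [:- r, 1:])"
proof -
  define R where "R = conjugates m"
  let ?P = "map_poly of_int m :: complex poly" and ?m = "map_poly rat_of_int m"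
  have nz: "?P \<noteq> 0" using is_minpoly_nonzero[OF m] by (simp add: map_poly_eq_0_iff)
  have deg: "degree ?P = degree m" by (simp add: degree_map_poly)
  show "finite (conjugates m)" unfolding conjugates_def using nz by (rule poly_roots_finite)
  have "rsquarefree ?P"
    unfolding rsquarefree_roots
  proof (intro allI notI)
    fix z assume z: "poly ?P z = 0 \<and> poly (pderiv ?P) z = 0"
    then have mz: "is_minpoly m z" using m is_minpoly_conjugate[OF m, of z] by (simp add: rpoly_of_int)
    have "pderiv ?P = map_poly of_rat (pderiv ?m)"
      by (intro poly_eqI) (simp add: coeff_map_poly coeff_pderiv of_rat_mult of_rat_add)
    then have "rpoly (pderiv ?m) z = 0" using z by (simp add: rpoly_def)
    then have "?m dvd pderiv ?m" using rpoly_eq_0_iff_minpoly_dvd[OF mz] by simp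
    then have "degree ?m = 0" using not_dvd_pderiv by blast
    then show False using degree_minpoly_pos[OF m] by (simp add: degree_map_poly)
  qed
  then have "smult (lead_coeff ?P) (\<Prod>r\<in>R. [:- r, 1:]) = ?P"
    unfolding R_def conjugates_def by (rule complex_poly_decompose_rsquarefree)
  moreover have "lead_coeff ?P = of_int (lead_coeff m)" unfolding deg by (simp add: coeff_map_poly)
  ultimately have eq: "?P = smult (of_int (lead_coeff m)) (\<Prod>r\<in>R. [:- r, 1:])" by simp
  then show "?P = smult (of_int (lead_coeff m)) (\<Prod>r\<in>conjugates m. [:- r, 1:])" by (simp add: R_def)
  have "degree ?P = card R"
    unfolding eq using is_minpoly_nonzero[OF m] by (simp add: degree_prod_eq_sum_degree)
  then show "card (conjugates m) = degree m" using deg by (simp add: R_def)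
  show "x \<in> conjugates m" using m by (simp add: conjugates_iff is_minpoly_def)
  show "conjugates m \<subseteq> Qbar"
    unfolding conjugates_def Qbar_def using nz by (auto intro!: algebraicI simp: coeff_map_poly)
qed

lemma gauss_lemma_minpoly:
  assumes m: "is_minpoly m (x::complex)" and w: "nonarch Qbar w"
    and p: "prime p" "\<And>r. w (of_rat r) = padic_abs p r"
  shows "w (of_int (lead_coeff m)) * (\<Prod>r\<in>conjugates m. max 1 (w r)) = 1"
proof -
  have "w (of_int n) = padic_abs p (of_int n)" for n using p(2)[of "of_int n"] by simp
  then show ?thesis
    using minpoly_splits[OF m] is_minpoly_nonzero[OF m] m
    by (intro nonarch.gauss_lemma_primitive[OF w p(1)]) (auto simp: is_minpoly_def)
qed

section \<open>Extension of embeddings\<close>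

locale embedding = subfld K for K :: "'a::field_char_0 set" +
  fixes \<sigma> :: "'a \<Rightarrow> 'b::field_char_0"
  assumes emb: "field_embedding_on K \<sigma>"
begin

lemma \<sigma>_1 [simp]: "\<sigma> 1 = 1"
  and \<sigma>_add: "x \<in> K \<Longrightarrow> y \<in> K \<Longrightarrow> \<sigma> (x + y) = \<sigma> x + \<sigma> y"
  and \<sigma>_mult: "x \<in> K \<Longrightarrow> y \<in> K \<Longrightarrow> \<sigma> (x * y) = \<sigma> x * \<sigma> y"
  using emb by (auto simp: field_embedding_on_def)

lemma \<sigma>_0 [simp]: "\<sigma> 0 = 0"
  using \<sigma>_add[of 0 0] by auto

lemma \<sigma>_minus: "x \<in> K \<Longrightarrow> \<sigma> (- x) = - \<sigma> x"
  using \<sigma>_add[of x "- x"] by (simp add: eq_neg_iff_add_eq_0 add.commute)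

lemma \<sigma>_diff: "x \<in> K \<Longrightarrow> y \<in> K \<Longrightarrow> \<sigma> (x - y) = \<sigma> x - \<sigma> y"
  using \<sigma>_add[of x "- y"] by (simp add: \<sigma>_minus)

lemma \<sigma>_inverse: "x \<in> K \<Longrightarrow> \<sigma> (inverse x) = inverse (\<sigma> x)"
proof (cases "x = 0")
  case False
  assume x: "x \<in> K"
  then have "\<sigma> x * \<sigma> (inverse x) = 1" using \<sigma>_mult[of x "inverse x"] False by auto
  then show ?thesis by (metis inverse_unique)
qed auto

lemma \<sigma>_eq_0_iff [simp]: "x \<in> K \<Longrightarrow> \<sigma> x = 0 \<longleftrightarrow> x = 0"
proof
  assume x: "x \<in> K" "\<sigma> x = 0"
  then have "\<sigma> (x * inverse x) = 0" by (subst \<sigma>_mult) auto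
  then show "x = 0" by (cases "x = 0") auto
qed auto

lemma \<sigma>_inj: "inj_on \<sigma> K"
  by (rule inj_onI) (metis K_diff \<sigma>_diff \<sigma>_eq_0_iff eq_iff_diff_eq_0)

lemma \<sigma>_power: "x \<in> K \<Longrightarrow> \<sigma> (x ^ n) = \<sigma> x ^ n"
  by (induction n) (auto simp: \<sigma>_mult)

lemma \<sigma>_of_nat [simp]: "\<sigma> (of_nat n) = of_nat n"
  by (induction n) (auto simp: \<sigma>_add)

lemma \<sigma>_of_int [simp]: "\<sigma> (of_int n) = of_int n"
  by (cases n) (auto simp: \<sigma>_minus \<sigma>_diff)

lemma \<sigma>_of_rat [simp]: "\<sigma> (of_rat r) = of_rat r"
  by (cases r) (simp add: of_rat_rat divide_inverse \<sigma>_mult \<sigma>_inverse)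

lemma \<sigma>_rpoly: "x \<in> K \<Longrightarrow> \<sigma> (rpoly g x) = rpoly g (\<sigma> x)"
  by (induction g) (auto simp: \<sigma>_add \<sigma>_mult K_rpoly)

lemma \<sigma>_prod: "(\<And>i. i \<in> I \<Longrightarrow> f i \<in> K) \<Longrightarrow> \<sigma> (prod f I) = (\<Prod>i\<in>I. \<sigma> (f i))"
proof (induction I rule: infinite_finite_induct)
  case (insert i I)
  then have "prod f I \<in> K" by auto
  then show ?case using insert by (simp add: \<sigma>_mult)
qed auto

lemma \<sigma>_sum: "(\<And>i. i \<in> I \<Longrightarrow> f i \<in> K) \<Longrightarrow> \<sigma> (sum f I) = (\<Sum>i\<in>I. \<sigma> (f i))"
proof (induction I rule: infinite_finite_induct)
  case (insert i I)
  then have "sum f I \<in> K" by auto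
  then show ?case using insert by (simp add: \<sigma>_add)
qed auto

lemma absval_pullback:
  assumes "absval L w" "\<sigma> ` K \<subseteq> L"
  shows "absval K (\<lambda>x. w (\<sigma> x))"
proof
  interpret L: absval L w by fact
  have L: "\<sigma> x \<in> L" if "x \<in> K" for x using that assms by auto
  show "abs_value_on K (\<lambda>x. w (\<sigma> x))"
    unfolding abs_value_on_def using L by (auto simp: \<sigma>_add \<sigma>_mult L.v_mult L.v_triangle)
qed

end

section \<open>Graphs of partial embeddings and Zorn's lemma\<close>

lemma chain_Union_pair:
  assumes "subset.chain F C" "s \<in> \<Union>C" "t \<in> \<Union>C"
  shows "\<exists>G\<in>C. s \<in> G \<and> t \<in> G"
proof -
  obtain S T where ST: "S \<in> C" "s \<in> S" "T \<in> C" "t \<in> T" using assms by auto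
  then have "S \<subseteq> T \<or> T \<subseteq> S" using assms(1) by (auto simp: subset.chain_def)
  then show ?thesis using ST by blast
qed

text \<open>The graph of a ring homomorphism on a subring of \<open>Qbar\<close>. Graphs are ordered
  by inclusion, as Zorn's lemma requires, and the condition at 0 together with closure under
  differences makes them single-valued.\<close>

definition partial_embedding :: "(complex \<times> 'k::field_char_0) set \<Rightarrow> bool" where
  "partial_embedding G \<longleftrightarrow> (1, 1) \<in> G \<and> fst ` G \<subseteq> Qbar \<and> (\<forall>b. (0, b) \<in> G \<longrightarrow> b = 0) \<and>
     (\<forall>a b c d. (a, b) \<in> G \<longrightarrow> (c, d) \<in> G \<longrightarrow>
        (a - c, b - d) \<in> G \<and> (a * c, b * d) \<in> G)"

lemma partial_embeddingI:
  assumes "(1, 1) \<in> G" "\<And>a b. (a, b) \<in> G \<Longrightarrow> a \<in> Qbar" "\<And>b. (0, b) \<in> G \<Longrightarrow> b = 0"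
    "\<And>a b c d. (a, b) \<in> G \<Longrightarrow> (c, d) \<in> G \<Longrightarrow> (a - c, b - d) \<in> G"
    "\<And>a b c d. (a, b) \<in> G \<Longrightarrow> (c, d) \<in> G \<Longrightarrow> (a * c, b * d) \<in> G"
  shows "partial_embedding G"
  using assms unfolding partial_embedding_def by auto

context
  fixes G :: "(complex \<times> 'k::field_char_0) set"
  assumes G: "partial_embedding G"
begin

lemma pe_1: "(1, 1) \<in> G"
  and pe_diff: "(a, b) \<in> G \<Longrightarrow> (c, d) \<in> G \<Longrightarrow> (a - c, b - d) \<in> G"
  and pe_mult: "(a, b) \<in> G \<Longrightarrow> (c, d) \<in> G \<Longrightarrow> (a * c, b * d) \<in> G"
  and pe_zero: "(0, b) \<in> G \<Longrightarrow> b = 0"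
proof -
  have C: "\<forall>a b c d. (a, b) \<in> G \<longrightarrow> (c, d) \<in> G \<longrightarrow> (a - c, b - d) \<in> G \<and> (a * c, b * d) \<in> G"
    and Z: "(1, 1) \<in> G" "\<forall>b. (0, b) \<in> G \<longrightarrow> b = 0"
    using G by (auto simp only: partial_embedding_def)
  show "(a, b) \<in> G \<Longrightarrow> (c, d) \<in> G \<Longrightarrow> (a - c, b - d) \<in> G" using C by blast
  show "(a, b) \<in> G \<Longrightarrow> (c, d) \<in> G \<Longrightarrow> (a * c, b * d) \<in> G" using C by blast
qed (use G in \<open>auto simp only: partial_embedding_def\<close>)

lemma pe_Qbar: "(a, b) \<in> G \<Longrightarrow> a \<in> Qbar"
  using G by (force simp: partial_embedding_def)

lemma pe_0: "(0, 0) \<in> G"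
  using pe_diff[OF pe_1 pe_1] by simp

lemma pe_add: "(a, b) \<in> G \<Longrightarrow> (c, d) \<in> G \<Longrightarrow> (a + c, b + d) \<in> G"
  using pe_diff[of a b "0 - c" "0 - d"] pe_diff[OF pe_0] by simp

lemma pe_unique: "(a, b) \<in> G \<Longrightarrow> (a, c) \<in> G \<Longrightarrow> b = c"
  using pe_diff[of a b a c] pe_zero[of "b - c"] by simp

lemma pe_of_nat: "(of_nat n, of_nat n) \<in> G"
  by (induction n) (auto intro: pe_0 pe_add pe_1)

lemma pe_of_int: "(of_int n, of_int n) \<in> G"
  using pe_diff[OF pe_of_nat[of "nat n"] pe_of_nat[of "nat (- n)"]] by (cases "n \<ge> 0") auto

lemma pe_sum: "(\<And>i. i \<in> I \<Longrightarrow> (f i, h i) \<in> G) \<Longrightarrow> (sum f I, sum h I) \<in> G"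
  by (induction I rule: infinite_finite_induct) (auto intro: pe_0 pe_add)

lemma pe_poly:
  assumes "(x, y) \<in> G"
  shows "(poly (map_poly of_int g) x, poly (map_poly of_int g) y) \<in> G"
proof (induction g)
  case (pCons c g)
  show ?case
    using pe_add[OF pe_of_int pe_mult[OF assms pCons.IH], of c] by (simp add: map_poly_pCons)
qed (simp add: pe_0)

lemma pe_algebraic:
  assumes "(x, y) \<in> G"
  shows "algebraic y"
proof -
  obtain m where m: "is_minpoly m x" using exists_minpoly pe_Qbar[OF assms] by (auto simp: Qbar_def)
  then have "poly (map_poly of_int m) x = 0" by (simp add: is_minpoly_def rpoly_of_int)
  then have "poly (map_poly of_int m) y = 0" using pe_poly[OF assms, of m] pe_zero by simp
  then show ?thesis
    using is_minpoly_nonzero[OF m] by (intro algebraicI[of "map_poly of_int m"]) (auto simp: coeff_map_poly map_poly_eq_0_iff)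
qed

text \<open>A nonzero algebraic number satisfies an integer relation with nonzero constant
  coefficient, and the relation transfers to \<open>y\<close>. Injectivity thus holds before the
  domain is known to be a field.\<close>

lemma pe_nonzero:
  assumes "(x, y) \<in> G" "x \<noteq> 0"
  shows "y \<noteq> 0"
proof
  assume "y = 0"
  have "algebraic x" using pe_Qbar[OF assms(1)] by (simp add: Qbar_def)
  then obtain p where p: "coeff p 0 \<noteq> 0" "poly (map_poly of_int p) x = 0"
    using algebraicE'_nonzero[OF _ assms(2)] by blast
  then have "poly (map_poly of_int p) y = 0" using pe_poly[OF assms(1), of p] pe_zero by simp
  then show False using p \<open>y = 0\<close> by (simp add: poly_0_coeff_0 coeff_map_poly)
qed

lemma partial_embedding_localize:
  "partial_embedding {(a / c, b / d) |a b c d. (a, b) \<in> G \<and> (c, d) \<in> G \<and> c \<noteq> 0}" (is "partial_embedding ?L")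
proof -
  have I: "(a / c, b / d) \<in> ?L" if "(a, b) \<in> G" "(c, d) \<in> G" "c \<noteq> 0" for a b c d
    using that by blast
  show ?thesis
  proof (rule partial_embeddingI)
    show "(1, 1) \<in> ?L" using I[OF pe_1 pe_1] by simp
    show "a \<in> Qbar" if "(a, b) \<in> ?L" for a b
      using that pe_Qbar is_subfield_Qbar by (auto simp: is_subfield_def divide_inverse)
    show "b = 0" if "(0, b) \<in> ?L" for b
      using that pe_zero by auto
    fix a b c d assume ab: "(a, b) \<in> ?L" and cd: "(c, d) \<in> ?L"
    obtain a1 b1 a2 b2 where 1: "(a1, b1) \<in> G" "(a2, b2) \<in> G" "a2 \<noteq> 0" "a = a1 / a2" "b = b1 / b2"
      using ab by auto
    obtain c1 d1 c2 d2 where 2: "(c1, d1) \<in> G" "(c2, d2) \<in> G" "c2 \<noteq> 0" "c = c1 / c2" "d = d1 / d2"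
      using cd by auto
    have "b2 \<noteq> 0" "d2 \<noteq> 0" using 1 2 pe_nonzero by blast+
    then have "a - c = (a1 * c2 - c1 * a2) / (a2 * c2)" "b - d = (b1 * d2 - d1 * b2) / (b2 * d2)"
      using 1 2 by (simp_all add: field_simps)
    moreover have "((a1 * c2 - c1 * a2) / (a2 * c2), (b1 * d2 - d1 * b2) / (b2 * d2)) \<in> ?L"
      using 1 2 by (intro I pe_diff pe_mult) auto
    ultimately show "(a - c, b - d) \<in> ?L" by simp
    have "((a1 * c1) / (a2 * c2), (b1 * d1) / (b2 * d2)) \<in> ?L"
      using 1 2 by (intro I pe_mult) auto
    then show "(a * c, b * d) \<in> ?L" using 1 2 by simp
  qed
qed

text \<open>A polynomial over the domain together with its image under the homomorphism; pairs avoid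
  naming the homomorphism as a function.\<close>

definition poly_pairs :: "(complex poly \<times> 'k poly) set" where
  "poly_pairs = {(g, h). \<forall>i. (coeff g i, coeff h i) \<in> G}"

lemma poly_pairs_diff: "(g, h) \<in> poly_pairs \<Longrightarrow> (g', h') \<in> poly_pairs \<Longrightarrow> (g - g', h - h') \<in> poly_pairs"
  and poly_pairs_mult: "(g, h) \<in> poly_pairs \<Longrightarrow> (g', h') \<in> poly_pairs \<Longrightarrow> (g * g', h * h') \<in> poly_pairs"
  by (auto simp: poly_pairs_def coeff_mult intro: pe_diff pe_mult pe_sum)

lemma poly_pairs_monom: "(a, b) \<in> G \<Longrightarrow> (monom a n, monom b n) \<in> poly_pairs"
  by (auto simp: poly_pairs_def pe_0)

lemma partial_embedding_adjoin:
  assumes x: "x \<in> Qbar"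
    and vanish: "\<And>g h. (g, h) \<in> poly_pairs \<Longrightarrow> poly g x = 0 \<Longrightarrow> poly h y = 0"
  shows "partial_embedding {(poly g x, poly h y) |g h. (g, h) \<in> poly_pairs}" (is "partial_embedding ?L")
proof (rule partial_embeddingI)
  interpret subfld Qbar using is_subfield_Qbar by unfold_locales
  have "(poly (monom 1 0) x, poly (monom 1 0) y) \<in> ?L" using poly_pairs_monom[OF pe_1, of 0] by blast
  then show "(1, 1) \<in> ?L" by (simp add: monom_0)
  show "a \<in> Qbar" if ab: "(a, b) \<in> ?L" for a b
  proof -
    obtain g h where "(g, h) \<in> poly_pairs" "a = poly g x" using ab by blast
    then have "\<forall>i. coeff g i \<in> Qbar" "a = poly g x" using pe_Qbar by (auto simp: poly_pairs_def)
    then show ?thesis using x by (auto simp: poly_altdef intro!: K_sum)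
  qed
  show "b = 0" if "(0, b) \<in> ?L" for b
    using that vanish by auto
  fix a b c d assume ab: "(a, b) \<in> ?L" and cd: "(c, d) \<in> ?L"
  obtain g h g' h' where *: "(g, h) \<in> poly_pairs" "a = poly g x" "b = poly h y"
    "(g', h') \<in> poly_pairs" "c = poly g' x" "d = poly h' y" using ab cd by auto
  have "(poly (g - g') x, poly (h - h') y) \<in> ?L" using poly_pairs_diff[OF *(1,4)] by blast
  then show "(a - c, b - d) \<in> ?L" using * by simp
  have "(poly (g * g') x, poly (h * h') y) \<in> ?L" using poly_pairs_mult[OF *(1,4)] by blast
  then show "(a * c, b * d) \<in> ?L" using * by simp
qed

text \<open>Let \<open>f\<close> have least degree among the nonzero polynomials over the domain
  that vanish at \<open>x\<close>, and let \<open>y\<close> be a root of its image \<open>h\<close>.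
  Division by \<open>f\<close> is carried out on both components of a pair at once, and the
  remainder is 0 by minimality. The hypothesis \<open>inv\<close> permits division by the leading
  coefficient.\<close>

lemma exists_compatible_root:
  assumes inv: "\<And>a b. (a, b) \<in> G \<Longrightarrow> a \<noteq> 0 \<Longrightarrow> (inverse a, inverse b) \<in> G"
    and closed: "\<And>f::'k poly. degree f > 0 \<Longrightarrow> (\<And>i. algebraic (coeff f i)) \<Longrightarrow> \<exists>y. poly f y = 0"
    and x: "x \<in> Qbar"
  obtains y where "\<And>g h. (g, h) \<in> poly_pairs \<Longrightarrow> poly g x = 0 \<Longrightarrow> poly h y = 0"
proof -
  obtain m where m: "is_minpoly m x" using exists_minpoly x by (auto simp: Qbar_def)
  let ?P = "\<lambda>f. f \<noteq> 0 \<and> poly f x = 0 \<and> (\<exists>h. (f, h) \<in> poly_pairs)"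
  have "?P (map_poly of_int m)"
    using m is_minpoly_nonzero[OF m]
    by (auto simp: is_minpoly_def rpoly_of_int map_poly_eq_0_iff poly_pairs_def coeff_map_poly pe_of_int
        intro!: exI[of _ "map_poly of_int m"])
  then obtain f where f: "?P f" "\<And>f'. ?P f' \<Longrightarrow> degree f \<le> degree f'"
    using ex_has_least_nat[of ?P "map_poly of_int m" degree] by metis
  then obtain h where h: "(f, h) \<in> poly_pairs" by auto
  have deg: "degree f > 0"
  proof (rule ccontr)
    assume "\<not> degree f > 0"
    then obtain c where "f = [:c:]" using degree_eq_zeroE by blast
    then show False using f(1) by auto
  qed
  have lead: "(lead_coeff f, coeff h (degree f)) \<in> G" using h by (auto simp: poly_pairs_def)
  then have "coeff h (degree f) \<noteq> 0" using pe_nonzero f(1) by auto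
  then have "degree h > 0" using deg le_degree by (metis less_le_trans)
  moreover have "algebraic (coeff h i)" for i using h pe_algebraic by (auto simp: poly_pairs_def)
  ultimately obtain y where y: "poly h y = 0" using closed by blast
  \<comment> \<open>Long division by induction on a bound \<open>n\<close> for the number of
    coefficients of \<open>g\<close>; only the values at \<open>x\<close> and \<open>y\<close> are
    tracked, so no quotient has to be named.\<close>
  have "poly q y = 0" if "(g, q) \<in> poly_pairs" "poly g x = 0" "\<forall>i\<ge>n. coeff g i = 0" for n g q
    using that
  proof (induction n arbitrary: g q)
    case 0
    then have "q = 0" using pe_zero by (auto simp: poly_pairs_def poly_eq_iff)
    then show ?case by simp
  next
    case (Suc n)
    show ?case
    proof (cases "degree f \<le> n")
      case True
      \<comment> \<open>\<open>c\<close> cancels the coefficient of degree n in \<open>g\<close>,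
        and \<open>d\<close> is the image of \<open>c\<close>, so the new pair still
        corresponds.\<close>
      define c d where "c = coeff g n / lead_coeff f" and "d = coeff q n / coeff h (degree f)"
      have cd: "(c, d) \<in> G"
        using Suc.prems(1) inv[OF lead] f(1)
        by (auto simp: c_def d_def divide_inverse poly_pairs_def intro!: pe_mult)
      define g' q' where "g' = g - monom c (n - degree f) * f" and "q' = q - monom d (n - degree f) * h"
      have "(g', q') \<in> poly_pairs"
        unfolding g'_def q'_def by (intro poly_pairs_diff poly_pairs_mult poly_pairs_monom cd h Suc.prems)
      moreover have "poly g' x = 0" using Suc.prems f(1) by (simp add: g'_def)
      moreover have "coeff g' i = 0" if "i \<ge> n" for i
        using that Suc.prems(3) True f(1)
        by (cases "i = n") (auto simp: g'_def c_def coeff_monom_mult intro!: coeff_eq_0)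
      ultimately have "poly q' y = 0" using Suc.IH by blast
      then show ?thesis using y by (simp add: q'_def)
    next
      case False
      then have "degree g < degree f" using Suc.prems(3) degree_lessI[of g "degree f"] deg by auto
      then have "g = 0" using f(2)[of g] Suc.prems(1,2) by fastforce
      then have "q = 0" using Suc.prems(1) pe_zero by (auto simp: poly_pairs_def poly_eq_iff)
      then show ?thesis by simp
    qed
  qed
  then have "poly q y = 0" if "(g, q) \<in> poly_pairs" "poly g x = 0" for g q
    using that coeff_eq_0[of g] by (metis Suc_le_lessD)
  then show ?thesis by (rule that)
qed

end

text \<open>Zorn's lemma for the partial embeddings that extend Q[\<alpha>] -> Q[r]. A maximal one
  equals its localization, so its domain is a field, and then it extends to any further element of
  \<open>Qbar\<close>. Root closure is demanded for algebraic coefficients because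
  \<open>is_Cp\<close> asserts algebraic closedness only for a dense subfield.\<close>

theorem embedding_extension:
  fixes r :: "'k::field_char_0"
  assumes m: "is_minpoly m \<alpha>" and r: "rpoly (map_poly of_int m) r = 0"
    and closed: "\<And>f::'k poly. degree f > 0 \<Longrightarrow> (\<And>i. algebraic (coeff f i)) \<Longrightarrow> \<exists>y. poly f y = 0"
  obtains \<sigma> where "field_embedding_on Qbar \<sigma>" "\<sigma> \<alpha> = r"
proof -
  interpret subfld Qbar using is_subfield_Qbar by unfold_locales
  define G0 where "G0 = {(rpoly g \<alpha>, rpoly g r) |g. True}"
  have \<alpha>: "\<alpha> \<in> Qbar"
    using m is_minpoly_nonzero[OF m]
    by (auto simp: Qbar_def is_minpoly_def algebraic_iff_rpoly intro!: exI[of _ "map_poly of_int m"])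
  have G0I: "(rpoly g \<alpha>, rpoly g r) \<in> G0" for g by (auto simp: G0_def)
  have pe0: "partial_embedding G0"
  proof (rule partial_embeddingI)
    show "(1, 1) \<in> G0" using G0I[of 1] by simp
    show "a \<in> Qbar" if "(a, b) \<in> G0" for a b using that \<alpha> by (auto simp: G0_def)
    show "b = 0" if b: "(0, b) \<in> G0" for b
    proof -
      obtain g where g: "rpoly g \<alpha> = 0" "b = rpoly g r" using b by (auto simp: G0_def)
      then obtain k where "g = map_poly of_int m * k" using rpoly_eq_0_iff_minpoly_dvd[OF m] by (auto elim: dvdE)
      then show ?thesis using g r by simp
    qed
    fix a b c d assume "(a, b) \<in> G0" "(c, d) \<in> G0"
    then obtain g h where *: "a = rpoly g \<alpha>" "b = rpoly g r" "c = rpoly h \<alpha>" "d = rpoly h r"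
      by (auto simp: G0_def)
    show "(a - c, b - d) \<in> G0" using G0I[of "g - h"] * by simp
    show "(a * c, b * d) \<in> G0" using G0I[of "g * h"] * by simp
  qed
  define F where "F = {G. partial_embedding G \<and> G0 \<subseteq> G}"
  have "\<exists>G\<in>F. \<forall>X\<in>F. G \<subseteq> X \<longrightarrow> X = G"
  proof (rule subset_Zorn_nonempty)
    show "F \<noteq> {}" using pe0 by (auto simp: F_def)
    fix C assume C: "C \<noteq> {}" "subset.chain F C"
    have CF: "\<And>G. G \<in> C \<Longrightarrow> partial_embedding G \<and> G0 \<subseteq> G" using C(2) by (auto simp: subset.chain_def F_def)
    have "partial_embedding (\<Union>C)"
    proof (rule partial_embeddingI)
      show "(1, 1) \<in> \<Union>C" using C(1) CF pe_1 by blast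
      show "a \<in> Qbar" if "(a, b) \<in> \<Union>C" for a b using that CF pe_Qbar by blast
      show "b = 0" if "(0, b) \<in> \<Union>C" for b using that CF pe_zero by blast
      fix a b c d assume "(a, b) \<in> \<Union>C" "(c, d) \<in> \<Union>C"
      then obtain G where G: "G \<in> C" "(a, b) \<in> G" "(c, d) \<in> G" using chain_Union_pair[OF C(2)] by blast
      then have "partial_embedding G" using CF by auto
      then have "(a - c, b - d) \<in> G" "(a * c, b * d) \<in> G"
        using G by (auto intro: pe_diff pe_mult)
      then show "(a - c, b - d) \<in> \<Union>C" "(a * c, b * d) \<in> \<Union>C"
        using G(1) by auto
    qed
    then show "\<Union>C \<in> F" using C(1) CF by (auto simp: F_def)
  qed
  then obtain G where GF: "G \<in> F" and GX: "\<forall>X\<in>F. G \<subseteq> X \<longrightarrow> X = G" by (elim bexE)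
  have G: "partial_embedding G" "G0 \<subseteq> G" using GF by (auto simp: F_def)
  have max: "X = G" if "partial_embedding X" "G \<subseteq> X" for X
    using GX that G(2) by (auto simp: F_def)
  have inv: "(inverse a, inverse b) \<in> G" if ab: "(a, b) \<in> G" "a \<noteq> 0" for a b
  proof -
    let ?L = "{(a / c, b / d) |a b c d. (a, b) \<in> G \<and> (c, d) \<in> G \<and> c \<noteq> 0}"
    have "G \<subseteq> ?L"
    proof
      fix z assume z: "z \<in> G"
      have "(fst z / 1, snd z / 1) \<in> ?L" using z pe_1[OF G(1)]
        by (intro CollectI exI[of _ "fst z"] exI[of _ "snd z"] exI[of _ 1]) simp
      then show "z \<in> ?L" by simp
    qed
    then have "?L = G" by (rule max[OF partial_embedding_localize[OF G(1)]])
    moreover have "(1 / a, 1 / b) \<in> ?L" using ab pe_1[OF G(1)] by blast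
    ultimately show ?thesis by (simp add: inverse_eq_divide)
  qed
  have total: "\<exists>y. (x, y) \<in> G" if x: "x \<in> Qbar" for x
  proof -
    obtain y where y: "\<And>g h. (g, h) \<in> poly_pairs G \<Longrightarrow> poly g x = 0 \<Longrightarrow> poly h y = 0"
      using exists_compatible_root[OF G(1) inv closed x] by metis
    let ?L = "{(poly g x, poly h y) |g h. (g, h) \<in> poly_pairs G}"
    have "G \<subseteq> ?L"
    proof
      fix z assume "z \<in> G"
      then have "(monom (fst z) 0, monom (snd z) 0) \<in> poly_pairs G"
        by (intro poly_pairs_monom[OF G(1)]) simp
      then have "(poly (monom (fst z) 0) x, poly (monom (snd z) 0) y) \<in> ?L" by blast
      then show "z \<in> ?L" by (simp add: monom_0)
    qed
    moreover have "partial_embedding ?L"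
      by (rule partial_embedding_adjoin[OF G(1) x]) (rule y)
    ultimately have "?L = G" by (intro max)
    moreover have "(poly (monom 1 1) x, poly (monom 1 1) y) \<in> ?L"
      using poly_pairs_monom[OF G(1) pe_1[OF G(1)], of 1] by blast
    ultimately show ?thesis by (auto simp: poly_monom)
  qed
  define \<sigma> where "\<sigma> = (\<lambda>x. SOME y. (x, y) \<in> G)"
  have \<sigma>: "(x, \<sigma> x) \<in> G" if "x \<in> Qbar" for x
    unfolding \<sigma>_def using total[OF that] by (rule someI_ex)
  have eq: "\<sigma> x = y" if "(x, y) \<in> G" for x y
    using pe_unique[OF G(1) \<sigma>[OF pe_Qbar[OF G(1) that]] that] .
  show ?thesis
  proof
    show "field_embedding_on Qbar \<sigma>"
      unfolding field_embedding_on_def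
      using \<sigma> eq[OF pe_1[OF G(1)]] by (auto intro!: eq pe_add[OF G(1)] pe_mult[OF G(1)])
    have "(\<alpha>, r) \<in> G" using G(2) G0I[of "[:0, 1:]"] by auto
    then show "\<sigma> \<alpha> = r" by (rule eq)
  qed
qed

section \<open>Extension of the \<open>p\<close>-adic absolute value\<close>

text \<open>
  A subring of \<open>Qbar\<close> that is maximal among those not containing \<open>1/p\<close> is a valuation ring, and its
  value group is torsion over the powers of \<open>p\<close> because every element of \<open>Qbar\<close> is algebraic.
\<close>

definition subring_without_inverse :: "nat \<Rightarrow> complex set \<Rightarrow> bool" where
  "subring_without_inverse p V \<longleftrightarrow> 1 \<in> V \<and> V \<subseteq> Qbar \<and>
     (\<forall>x\<in>V. \<forall>y\<in>V. x - y \<in> V \<and> x * y \<in> V) \<and> inverse (of_nat p) \<notin> V"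

lemma subring_without_inverseI:
  assumes "1 \<in> V" "\<And>x. x \<in> V \<Longrightarrow> x \<in> Qbar"
    "\<And>x y. x \<in> V \<Longrightarrow> y \<in> V \<Longrightarrow> x - y \<in> V" "\<And>x y. x \<in> V \<Longrightarrow> y \<in> V \<Longrightarrow> x * y \<in> V"
    "inverse (of_nat p) \<notin> V"
  shows "subring_without_inverse p V"
  using assms unfolding subring_without_inverse_def by auto

locale max_subring =
  fixes p :: nat and V :: "complex set"
  assumes prime: "prime p" and V: "subring_without_inverse p V"
    and max: "\<And>W. subring_without_inverse p W \<Longrightarrow> V \<subseteq> W \<Longrightarrow> W = V"
begin

sublocale Q: subfld Qbar
  using is_subfield_Qbar by unfold_locales

abbreviation "\<pi> \<equiv> (of_nat p :: complex)"

lemma V_closed [simp, intro]: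
  "1 \<in> V" "x \<in> V \<Longrightarrow> y \<in> V \<Longrightarrow> x - y \<in> V" "x \<in> V \<Longrightarrow> y \<in> V \<Longrightarrow> x * y \<in> V"
  and V_Qbar: "x \<in> V \<Longrightarrow> x \<in> Qbar"
  and \<pi>_not_inv: "inverse \<pi> \<notin> V"
  using V by (auto simp: subring_without_inverse_def)

lemma V_0 [simp, intro]: "0 \<in> V"
  using V_closed(2)[of 1 1] by simp

lemma V_minus [simp, intro]: "x \<in> V \<Longrightarrow> - x \<in> V"
  using V_closed(2)[of 0 x] by simp

lemma V_add [simp, intro]: "x \<in> V \<Longrightarrow> y \<in> V \<Longrightarrow> x + y \<in> V"
  using V_closed(2)[of x "- y"] by simp

lemma V_power [simp, intro]: "x \<in> V \<Longrightarrow> x ^ n \<in> V"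
  by (induction n) auto

lemma V_sum [intro]: "(\<And>i. i \<in> I \<Longrightarrow> f i \<in> V) \<Longrightarrow> sum f I \<in> V"
  by (induction I rule: infinite_finite_induct) auto

lemma V_of_nat [simp, intro]: "of_nat n \<in> V"
  by (induction n) auto

lemma V_of_int [simp, intro]: "of_int n \<in> V"
  by (cases n) auto

lemma \<pi>_nz [simp]: "\<pi> \<noteq> 0"
  using prime by auto

lemma not_one_eq_\<pi>_mult: "x \<in> V \<Longrightarrow> \<pi> * x \<noteq> 1"
  using \<pi>_not_inv by (metis inverse_unique)

text \<open>The powers of s = 1 - \<pi> b are congruent to 1 modulo \<pi> V, so inverting s cannot
  produce 1/\<pi>. By maximality the localization at s is \<open>V\<close> itself.\<close>

lemma inverse_one_minus_in_V:
  assumes b: "b \<in> V"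
  shows "inverse (1 - \<pi> * b) \<in> V" "1 - \<pi> * b \<noteq> 0"
proof -
  define s where "s = 1 - \<pi> * b"
  have s: "s \<in> V" using b by (auto simp: s_def)
  have s0: "s \<noteq> 0" using not_one_eq_\<pi>_mult[OF b] by (auto simp: s_def)
  have pow: "\<exists>c\<in>V. s ^ k = 1 - \<pi> * c" for k
  proof (induction k)
    case (Suc k)
    then obtain c where c: "c \<in> V" "s ^ k = 1 - \<pi> * c" by auto
    then have "s ^ Suc k = (1 - \<pi> * b) * (1 - \<pi> * c)" by (simp only: power_Suc) (simp only: s_def)
    also have "\<dots> = 1 - \<pi> * (b + c - \<pi> * b * c)" by (simp add: algebra_simps)
    finally have "s ^ Suc k = 1 - \<pi> * (b + c - \<pi> * b * c)" .
    then show ?case using b c by (intro bexI[of _ "b + c - \<pi> * b * c"]) auto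
  qed (intro bexI[of _ 0], auto)
  define W where "W = {a / s ^ k |a k. a \<in> V}"
  have WI: "a / s ^ k \<in> W" if "a \<in> V" for a k using that by (auto simp: W_def)
  have "subring_without_inverse p W"
  proof (rule subring_without_inverseI)
    show "1 \<in> W" using WI[of 1 0] by simp
    show "x \<in> Qbar" if "x \<in> W" for x using that V_Qbar s by (auto simp: W_def)
    fix x y assume "x \<in> W" "y \<in> W"
    then obtain a k c l where *: "a \<in> V" "c \<in> V" "x = a / s ^ k" "y = c / s ^ l" by (auto simp: W_def)
    have "x - y = (a * s ^ l - c * s ^ k) / s ^ (k + l)"
      unfolding *(3,4) using s0 by (simp add: field_simps power_add)
    also have "\<dots> \<in> W" using * s by (intro WI) auto
    finally show "x - y \<in> W" .
    show "x * y \<in> W" using WI[of "a * c" "k + l"] * by (auto simp: power_add)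
  next
    show "inverse \<pi> \<notin> W"
    proof
      assume "inverse \<pi> \<in> W"
      then obtain a k where a: "a \<in> V" "inverse \<pi> = a / s ^ k" by (auto simp: W_def)
      then have "\<pi> * (a / s ^ k) = 1" by (metis \<pi>_nz right_inverse)
      then have "s ^ k = \<pi> * a" using s0 by (simp add: divide_eq_eq)
      moreover obtain c where "c \<in> V" "s ^ k = 1 - \<pi> * c" using pow by blast
      ultimately have "\<pi> * (a + c) = 1" "a + c \<in> V" using a by (auto simp: algebra_simps)
      then show False using not_one_eq_\<pi>_mult by blast
    qed
  qed
  moreover have "V \<subseteq> W" using WI[of _ 0] by auto
  ultimately have "W = V" by (rule max)
  moreover have "inverse s \<in> W" using WI[of 1 1] by (simp add: inverse_eq_divide)
  ultimately show "inverse (1 - \<pi> * b) \<in> V" "1 - \<pi> * b \<noteq> 0" using s0 by (auto simp: s_def)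
qed

text \<open>A certificate of degree at most \<open>n\<close> that 1/\<pi> lies in V[x]. Its least
  degree is the quantity lowered in the descent.\<close>

definition inv_rep :: "complex \<Rightarrow> nat \<Rightarrow> bool" where
  "inv_rep x n \<longleftrightarrow> (\<exists>c. (\<forall>i. c i \<in> V) \<and> \<pi> * (\<Sum>i\<le>n. c i * x ^ i) = 1)"

text \<open>V[x] is strictly larger than \<open>V\<close>, so by maximality it must contain
  1/\<pi>.\<close>

lemma inv_rep_if_notin:
  assumes x: "x \<in> Qbar" "x \<notin> V"
  shows "\<exists>n. inv_rep x n"
proof (rule ccontr)
  assume no: "\<nexists>n. inv_rep x n"
  define W where "W = {poly g x |g. \<forall>i. coeff g i \<in> V}"
  have WI: "poly g x \<in> W" if "\<And>i. coeff g i \<in> V" for g using that by (auto simp: W_def)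
  have "subring_without_inverse p W"
  proof (rule subring_without_inverseI)
    show "1 \<in> W" using WI[of 1] by (simp add: one_pCons coeff_pCons split: nat.split)
    show "y \<in> Qbar" if "y \<in> W" for y using that V_Qbar x(1) by (auto simp: W_def poly_altdef)
    show "inverse \<pi> \<notin> W"
    proof
      assume "inverse \<pi> \<in> W"
      then obtain g where g: "\<forall>i. coeff g i \<in> V" "inverse \<pi> = poly g x" by (auto simp: W_def)
      then have "\<pi> * poly g x = 1" by (metis \<pi>_nz right_inverse)
      then have "inv_rep x (degree g)" using g(1) by (auto simp: inv_rep_def poly_altdef)
      then show False using no by blast
    qed
    fix a b assume "a \<in> W" "b \<in> W"
    then obtain g h where *: "\<And>i. coeff g i \<in> V" "a = poly g x" "\<And>i. coeff h i \<in> V" "b = poly h x"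
      by (auto simp: W_def)
    show "a - b \<in> W" using WI[of "g - h"] * by simp
    show "a * b \<in> W" using WI[of "g * h"] * by (auto simp: coeff_mult)
  qed
  moreover have "V \<subseteq> W" using WI[of "[:_:]"] by (auto simp: coeff_pCons split: nat.splits)
  ultimately have "W = V" by (rule max)
  moreover have "x \<in> W" using WI[of "[:0, 1:]"] by (auto simp: coeff_pCons split: nat.splits)
  ultimately show False using x by simp
qed

lemma inv_rep_mono:
  assumes "inv_rep x k" "k \<le> n"
  shows "inv_rep x n"
proof -
  obtain c where c: "\<forall>i. c i \<in> V" "\<pi> * (\<Sum>i\<le>k. c i * x ^ i) = 1" using assms by (auto simp: inv_rep_def)
  have "(\<Sum>i\<le>n. (if i \<le> k then c i else 0) * x ^ i) = (\<Sum>i\<le>k. c i * x ^ i)"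
    using assms(2) by (intro sum.mono_neutral_cong_right) auto
  then show ?thesis using c unfolding inv_rep_def by (intro exI[of _ "\<lambda>i. if i \<le> k then c i else 0"]) auto
qed

lemma not_inv_rep_0: "\<not> inv_rep x 0"
  using not_one_eq_\<pi>_mult by (auto simp: inv_rep_def)

text \<open>Chevalley's descent. Multiplied by x^(n + 1), the relation for 1/x contains x^(n + 1)
  with total coefficient 1 - \<pi> b_0, a unit of \<open>V\<close>. Solving for x^(n + 1) and
  substituting into the relation for \<open>x\<close> lowers the degree.\<close>

lemma inv_rep_reduce:
  assumes x: "x \<noteq> 0" and r: "inv_rep x (Suc n)" "inv_rep (inverse x) (Suc n)"
  shows "inv_rep x n"
proof -
  obtain c where c: "\<And>i. c i \<in> V" "\<pi> * (\<Sum>i\<le>Suc n. c i * x ^ i) = 1" using r(1) by (auto simp: inv_rep_def)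
  obtain b where b: "\<And>i. b i \<in> V" "\<pi> * (\<Sum>i\<le>Suc n. b i * inverse x ^ i) = 1" using r(2) by (auto simp: inv_rep_def)
  define u where "u = inverse (1 - \<pi> * b 0)"
  have u: "u \<in> V" "u * (1 - \<pi> * b 0) = 1" using inverse_one_minus_in_V[OF b(1)[of 0]] by (auto simp: u_def)
  have "x ^ Suc n = x ^ Suc n * (\<pi> * (\<Sum>i\<le>Suc n. b i * inverse x ^ i))" by (simp only: b(2)) simp
  also have "\<dots> = \<pi> * (\<Sum>i\<le>Suc n. b i * (x ^ Suc n * inverse x ^ i))"
    by (simp only: sum_distrib_left mult_ac)
  also have "(\<Sum>i\<le>Suc n. b i * (x ^ Suc n * inverse x ^ i)) = (\<Sum>i\<le>Suc n. b i * x ^ (Suc n - i))"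
    using x by (intro sum.cong refl) (simp add: power_diff power_inverse divide_inverse del: power_Suc)
  also have "(\<Sum>i\<le>Suc n. b i * x ^ (Suc n - i)) = (\<Sum>i\<le>Suc n. b (Suc n - i) * x ^ i)"
    by (rule sum.reindex_bij_witness[of _ "\<lambda>i. Suc n - i" "\<lambda>i. Suc n - i"]) auto
  also have "\<dots> = (\<Sum>i\<le>n. b (Suc n - i) * x ^ i) + b 0 * x ^ Suc n" by simp
  finally have fin: "x ^ Suc n = \<pi> * ((\<Sum>i\<le>n. b (Suc n - i) * x ^ i) + b 0 * x ^ Suc n)" .
  have "(1 - \<pi> * b 0) * X = \<pi> * S" if "X = \<pi> * (S + b 0 * X)" for X S
    using that by algebra
  from this[OF fin] have "(1 - \<pi> * b 0) * x ^ Suc n = \<pi> * (\<Sum>i\<le>n. b (Suc n - i) * x ^ i)" .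
  then have "u * ((1 - \<pi> * b 0) * x ^ Suc n) = u * (\<pi> * (\<Sum>i\<le>n. b (Suc n - i) * x ^ i))" by simp
  then have xn: "x ^ Suc n = \<pi> * u * (\<Sum>i\<le>n. b (Suc n - i) * x ^ i)"
    using u(2) by (metis (no_types, lifting) mult.assoc mult.commute mult_1)
  define c' where "c' = (\<lambda>i. c i + c (Suc n) * \<pi> * u * b (Suc n - i))"
  have "(\<Sum>i\<le>n. c' i * x ^ i) = (\<Sum>i\<le>n. c i * x ^ i) + c (Suc n) * x ^ Suc n"
    unfolding xn by (simp add: c'_def algebra_simps sum.distrib sum_distrib_left)
  then have "\<pi> * (\<Sum>i\<le>n. c' i * x ^ i) = 1" using c(2) by simp
  moreover have "c' i \<in> V" for i using c b u by (auto simp: c'_def)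
  ultimately show ?thesis by (auto simp: inv_rep_def)
qed

text \<open>If neither lay in \<open>V\<close>, both would have certificates of least degree, and
  the larger of the two degrees could be lowered.\<close>

lemma valuation_ring:
  assumes x: "x \<in> Qbar" "x \<noteq> 0"
  shows "x \<in> V \<or> inverse x \<in> V"
proof (rule ccontr)
  assume "\<not> ?thesis"
  then have ex: "\<exists>n. inv_rep x n" "\<exists>n. inv_rep (inverse x) n"
    using inv_rep_if_notin x by auto
  have reduce: False
    if y: "y \<noteq> 0" "inv_rep y n" "\<And>i. i < n \<Longrightarrow> \<not> inv_rep y i" "inv_rep (inverse y) k" "k \<le> n" for y n k
  proof -
    obtain n' where n': "n = Suc n'" using not_inv_rep_0 y(2) by (cases n) auto
    have "inv_rep y n'" using inv_rep_reduce[OF y(1), of n'] y(2) inv_rep_mono[OF y(4,5)] n' by simp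
    then show False using y(3) n' by auto
  qed
  define n where "n = (LEAST n. inv_rep x n)"
  define k where "k = (LEAST n. inv_rep (inverse x) n)"
  have n: "inv_rep x n" "\<And>i. i < n \<Longrightarrow> \<not> inv_rep x i"
    using LeastI_ex[OF ex(1)] not_less_Least by (auto simp: n_def)
  have k: "inv_rep (inverse x) k" "\<And>i. i < k \<Longrightarrow> \<not> inv_rep (inverse x) i"
    using LeastI_ex[OF ex(2)] not_less_Least by (auto simp: k_def)
  show False
    using reduce[OF x(2) n k(1)] reduce[OF _ k, of n] n(1) x(2) by (cases "k \<le> n") auto
qed

section \<open>Units, the value group and the resulting absolute value\<close>

definition unit :: "complex \<Rightarrow> bool" where
  "unit u \<longleftrightarrow> u \<noteq> 0 \<and> u \<in> V \<and> inverse u \<in> V"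

lemma unit_mult: "unit u \<Longrightarrow> unit w \<Longrightarrow> unit (u * w)"
  and unit_inverse: "unit u \<Longrightarrow> unit (inverse u)"
  and unit_1 [simp]: "unit 1"
  by (auto simp: unit_def)

lemma unit_power: "unit u \<Longrightarrow> unit (u ^ n)"
  by (induction n) (auto intro: unit_mult)

lemma unit_divide: "unit u \<Longrightarrow> unit w \<Longrightarrow> unit (u / w)"
  by (auto simp: divide_inverse intro: unit_mult unit_inverse)

text \<open>By Bezout some multiple of \<open>n\<close> has the form 1 - p a, and such elements are
  units of \<open>V\<close>.\<close>

lemma unit_of_int:
  assumes "\<not> int p dvd n"
  shows "unit (of_int n)"
proof -
  have "coprime (int p) n" using assms prime by (simp add: prime_imp_coprime)
  then obtain a b where ab: "a * int p + b * n = 1"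
    by (metis bezout_int coprime_iff_gcd_eq_1)
  have "of_int (a * int p + b * n) = (1::complex)" unfolding ab by simp
  then have eq: "of_int b * of_int n = 1 - \<pi> * of_int a" by (simp add: algebra_simps)
  have n0: "n \<noteq> 0" using assms by auto
  have inv: "inverse (1 - \<pi> * of_int a) \<in> V" "1 - \<pi> * of_int a \<noteq> 0" using inverse_one_minus_in_V by auto
  have "inverse N = B * inverse (B * N)" if "B * N \<noteq> 0" for B N :: complex
    using that by (simp add: field_simps)
  then have "inverse (of_int n :: complex) = of_int b * inverse (of_int b * of_int n)"
    using inv(2) unfolding eq[symmetric] by blast
  also have "\<dots> \<in> V" using inv(1) unfolding eq by auto
  finally show ?thesis using n0 by (auto simp: unit_def)
qed

text \<open>One of a / b and b / a lies in \<open>V\<close>. If c / d does, then c + d = d (c / d +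
  1), and were c + d a unit, its divisor d would be one too.\<close>

lemma nonunit_add:
  assumes "a \<in> V" "b \<in> V" "\<not> unit a" "\<not> unit b"
  shows "\<not> unit (a + b)"
proof
  assume u: "unit (a + b)"
  have key: False if *: "c \<in> V" "d \<in> V" "\<not> unit d" "unit (c + d)" "d \<noteq> 0" "c / d \<in> V" for c d
  proof -
    have "inverse d = (c / d + 1) * inverse (c + d)"
      using *(4,5) by (auto simp: unit_def field_simps)
    also have "\<dots> \<in> V" using * by (auto simp: unit_def)
    finally show False using * by (auto simp: unit_def)
  qed
  show False
  proof (cases "a = 0 \<or> b = 0")
    case True
    then show False using u assms by auto
  next
    case False
    have "a / b \<in> V \<or> inverse (a / b) \<in> V" using assms V_Qbar False by (intro valuation_ring) auto
    then show False using key[of a b] key[of b a] assms u False by (auto simp: add.commute)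
  qed
qed

lemma nonunit_sum:
  assumes "finite I" "\<And>i. i \<in> I \<Longrightarrow> f i \<in> V" "\<And>i. i \<in> I \<Longrightarrow> \<not> unit (f i)"
  shows "\<not> unit (sum f I)"
  using assms
proof (induction I)
  case empty
  then show ?case by (simp add: unit_def)
next
  case (insert i I)
  then have "sum f I \<in> V" "\<not> unit (sum f I)" by auto
  then show ?case using insert nonunit_add[of "f i" "sum f I"] by simp
qed

lemma exists_dominant:
  assumes "finite I" "I \<noteq> {}" "\<And>i. i \<in> I \<Longrightarrow> t i \<in> Qbar \<and> t i \<noteq> 0"
  shows "\<exists>M\<in>I. \<forall>i\<in>I. t i / t M \<in> V"
  using assms
proof (induction I rule: finite_ne_induct)
  case (singleton i)
  then show ?case by simp
next
  case (insert j I)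
  then obtain M where M: "M \<in> I" "\<forall>i\<in>I. t i / t M \<in> V" by auto
  have nz: "t M \<noteq> 0" "t j \<noteq> 0" "t M \<in> Qbar" "t j \<in> Qbar" using insert M by auto
  then have "t j / t M \<in> V \<or> inverse (t j / t M) \<in> V" by (intro valuation_ring) auto
  then show ?case
  proof
    assume "t j / t M \<in> V"
    then show ?case using M by auto
  next
    assume *: "inverse (t j / t M) \<in> V"
    have "t i / t j \<in> V" if "i \<in> I" for i
    proof -
      have "t i / t j = (t i / t M) * inverse (t j / t M)" using nz by simp
      also have "\<dots> \<in> V" by (intro V_closed(3) bspec[OF M(2)] that *)
      finally show ?thesis .
    qed
    then show ?case using nz by (intro bexI[of _ j]) auto
  qed
qed

text \<open>Expresses that \<open>x\<close> has valuation j / n when p has valuation 1. A power of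
  \<open>x\<close> is compared because the value group may contain fractions.\<close>

definition val_rel :: "complex \<Rightarrow> nat \<Rightarrow> int \<Rightarrow> bool" where
  "val_rel x n j \<longleftrightarrow> n > 0 \<and> (\<exists>u. unit u \<and> x ^ n = \<pi> powi j * u)"

lemma int_eq_power_times_unit:
  assumes "n \<noteq> 0"
  shows "\<exists>u. unit u \<and> of_int n = \<pi> powi (int (multiplicity (int p) n)) * u"
proof -
  obtain y where y: "n = int p ^ multiplicity (int p) n * y" "\<not> int p dvd y"
    using multiplicity_decompose'[of n "int p"] assms prime by (metis not_prime_unit prime_int_iff prime_nat_int_transfer)
  have "of_int n = \<pi> ^ multiplicity (int p) n * of_int y"
    by (subst y(1)) simp
  then show ?thesis using unit_of_int[OF y(2)] by auto
qed

text \<open>In an integer relation for \<open>x\<close> a single term cannot strictly dominate all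
  others, so two terms differ by a unit. Their quotient expresses a power of \<open>x\<close>
  through a quotient of integers, whose valuation is known.\<close>

lemma exists_val_rel:
  assumes x: "x \<in> Qbar" "x \<noteq> 0"
  shows "\<exists>n j. val_rel x n j"
proof -
  obtain g where g: "g \<noteq> 0" "poly (map_poly of_int g) x = 0"
    using x(1) by (auto simp: Qbar_def elim: algebraicE')
  define I where "I = {i. i \<le> degree g \<and> coeff g i \<noteq> 0}"
  define t where "t = (\<lambda>i. of_int (coeff g i) * x ^ i)"
  have I: "finite I" "I \<noteq> {}" using g(1) by (auto simp: I_def)
  have t: "t i \<in> Qbar" "t i \<noteq> 0" if "i \<in> I" for i using that x by (auto simp: t_def I_def)
  have "(\<Sum>i\<in>I. t i) = (\<Sum>i\<le>degree g. t i)"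
    by (intro sum.mono_neutral_left) (auto simp: I_def t_def)
  also have "\<dots> = 0" using g(2) by (simp add: poly_altdef degree_map_poly coeff_map_poly t_def)
  finally have sum0: "(\<Sum>i\<in>I. t i) = 0" .
  obtain M where M: "M \<in> I" "\<forall>i\<in>I. t i / t M \<in> V" using exists_dominant[OF I, of t] t by auto
  \<comment> \<open>Divided by the dominant term, the remaining terms add up to -1, which is a unit;
    a sum of nonunits cannot be one.\<close>
  have "\<exists>i\<in>I - {M}. unit (t i / t M)"
  proof (rule ccontr)
    assume "\<not> ?thesis"
    then have "\<not> unit (\<Sum>i\<in>I - {M}. t i / t M)" using I M by (intro nonunit_sum) auto
    moreover have "(\<Sum>i\<in>I - {M}. t i / t M) = - 1"
    proof -
      have "(\<Sum>i\<in>I - {M}. t i / t M) = (\<Sum>i\<in>I - {M}. t i) / t M" by (simp add: sum_divide_distrib)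
      also have "(\<Sum>i\<in>I - {M}. t i) = - t M" using sum.remove[OF I(1) M(1), of t] sum0 by (simp add: eq_neg_iff_add_eq_0 add.commute)
      finally show ?thesis using t M by simp
    qed
    ultimately show False using unit_of_int[of "-1"] prime by (auto simp: unit_def)
  qed
  then obtain i where i: "i \<in> I" "i \<noteq> M" "unit (t i / t M)" by auto
  have rel: "\<exists>n j. val_rel x n j" if kl: "k \<in> I" "l \<in> I" "k < l" "unit (t k / t l)" for k l
  proof -
    have nz: "coeff g k \<noteq> 0" "coeff g l \<noteq> 0" using kl by (auto simp: I_def)
    obtain u where u: "unit u" "of_int (coeff g k) = \<pi> powi int (multiplicity (int p) (coeff g k)) * u"
      using int_eq_power_times_unit[OF nz(1)] by blast
    obtain w where w: "unit w" "of_int (coeff g l) = \<pi> powi int (multiplicity (int p) (coeff g l)) * w"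
      using int_eq_power_times_unit[OF nz(2)] by blast
    define e where "e = int (multiplicity (int p) (coeff g k)) - int (multiplicity (int p) (coeff g l))"
    have "x ^ l = x ^ k * x ^ (l - k)" using kl(3) by (simp flip: power_add)
    then have "x ^ (l - k) = (of_int (coeff g k) / of_int (coeff g l)) * inverse (t k / t l)"
      using x(2) kl(1,2) by (simp add: t_def I_def field_simps)
    also have "of_int (coeff g k) / of_int (coeff g l) = \<pi> powi e * (u / w)"
      unfolding u(2) w(2) e_def power_int_diff[OF disjI1[OF \<pi>_nz]] by simp
    finally have "x ^ (l - k) = \<pi> powi e * (u / w * inverse (t k / t l))" by (simp add: mult.assoc)
    moreover have "unit (u / w * inverse (t k / t l))"
      by (rule unit_mult[OF unit_divide[OF u(1) w(1)] unit_inverse[OF kl(4)]])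
    ultimately show ?thesis using kl(3) by (auto simp: val_rel_def intro!: exI[of _ "l - k"] exI[of _ e])
  qed
  show ?thesis
  proof (cases "i < M")
    case True
    then show ?thesis using rel i M by blast
  next
    case False
    moreover have "unit (t M / t i)" using unit_inverse[OF i(3)] by simp
    ultimately show ?thesis using rel[of M i] i M by auto
  qed
qed

lemma \<pi>_powi_in_V_iff: "\<pi> powi e \<in> V \<longleftrightarrow> e \<ge> 0"
proof
  show "\<pi> powi e \<in> V" if "e \<ge> 0" using that by (auto simp: power_int_def)
  show "e \<ge> 0" if *: "\<pi> powi e \<in> V"
  proof (rule ccontr)
    assume "\<not> e \<ge> 0"
    then have "\<pi> powi (- 1) = \<pi> powi e * \<pi> ^ nat (- e - 1)"
      using power_int_add[of \<pi> e "- e - 1"] by (simp add: power_int_def)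
    also have "\<dots> \<in> V" using * by auto
    finally show False using \<pi>_not_inv by (simp add: power_int_minus)
  qed
qed

lemma unit_\<pi>_powi: "unit (\<pi> powi e) \<Longrightarrow> e = 0"
  using \<pi>_powi_in_V_iff[of e] \<pi>_powi_in_V_iff[of "- e"] by (auto simp: unit_def power_int_minus)

lemma val_rel_unique:
  assumes "val_rel x n j" "val_rel x n' j'"
  shows "real_of_int j / real n = real_of_int j' / real n'"
proof -
  obtain u u' where u: "unit u" "x ^ n = \<pi> powi j * u" and u': "unit u'" "x ^ n' = \<pi> powi j' * u'"
    and n: "n > 0" "n' > 0"
    using assms by (auto simp: val_rel_def)
  have "(\<pi> powi j * u) ^ n' = (\<pi> powi j' * u') ^ n"
    unfolding u(2)[symmetric] u'(2)[symmetric] by (simp add: mult.commute flip: power_mult)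
  then have "\<pi> powi (j * int n') * u ^ n' = \<pi> powi (j' * int n) * u' ^ n"
    by (simp add: power_mult_distrib power_int_mult)
  then have "\<pi> powi (j * int n') / \<pi> powi (j' * int n) = u' ^ n / u ^ n'"
    using u u' prime_gt_0_nat[OF prime] by (simp add: unit_def field_simps)
  then have "\<pi> powi (j * int n' - j' * int n) = u' ^ n / u ^ n'"
    unfolding power_int_diff[OF disjI1[OF \<pi>_nz]] .
  then have "unit (\<pi> powi (j * int n' - j' * int n))"
    using u u' by (auto intro: unit_divide unit_power)
  then have "j * int n' = j' * int n" using unit_\<pi>_powi by fastforce
  then have "real_of_int j * real n' = real_of_int j' * real n" by (metis of_int_mult of_int_of_nat_eq)
  then show ?thesis using n by (simp add: field_simps)
qed

text \<open>Normalized by w p = 1/p; by \<open>val_rel_unique\<close> the chosen quotient does not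
  depend on the choice.\<close>

definition w :: "complex \<Rightarrow> real" where
  "w x = (if x = 0 then 0 else real p powr (- (SOME q. \<exists>n j. val_rel x n j \<and> q = real_of_int j / real n)))"

lemma w_eq:
  assumes "val_rel x n j" "x \<noteq> 0"
  shows "w x = real p powr (- (real_of_int j / real n))"
proof -
  have "(SOME q. \<exists>n j. val_rel x n j \<and> q = real_of_int j / real n) = real_of_int j / real n"
  proof (rule some_equality)
    show "\<exists>n' j'. val_rel x n' j' \<and> real_of_int j / real n = real_of_int j' / real n'"
      using assms(1) by blast
    show "q = real_of_int j / real n" if "\<exists>n j. val_rel x n j \<and> q = real_of_int j / real n" for q
      using that val_rel_unique[OF assms(1)] by metis
  qed
  then show ?thesis using assms(2) by (simp add: w_def)
qed

lemma p_gt_1: "real p > 1"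
  using prime_gt_1_nat[OF prime] by simp

lemma w_mult:
  assumes "x \<in> Qbar" "y \<in> Qbar"
  shows "w (x * y) = w x * w y"
proof (cases "x = 0 \<or> y = 0")
  case True
  then show ?thesis by (auto simp: w_def)
next
  case False
  obtain n j n' j' where v: "val_rel x n j" "val_rel y n' j'" using exists_val_rel assms False by metis
  obtain u u' where u: "unit u" "x ^ n = \<pi> powi j * u" and u': "unit u'" "y ^ n' = \<pi> powi j' * u'"
    and n: "n > 0" "n' > 0"
    using v by (auto simp: val_rel_def)
  have "(x * y) ^ (n * n') = (x ^ n) ^ n' * (y ^ n') ^ n"
    by (simp add: power_mult_distrib mult.commute flip: power_mult)
  also have "\<dots> = \<pi> powi (j * int n' + j' * int n) * (u ^ n' * u' ^ n)"
    unfolding u(2) u'(2) power_int_add[OF disjI1[OF \<pi>_nz]]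
    by (simp add: power_mult_distrib power_int_mult)
  finally have "val_rel (x * y) (n * n') (j * int n' + j' * int n)"
    using n u u' unfolding val_rel_def by (auto intro!: unit_mult unit_power)
  then have "w (x * y) = real p powr (- (real_of_int (j * int n' + j' * int n) / real (n * n')))"
    using False by (intro w_eq) auto
  also have "real_of_int (j * int n' + j' * int n) / real (n * n') = real_of_int j / real n + real_of_int j' / real n'"
    using n by (simp add: field_simps)
  also have "real p powr (- \<dots>) = w x * w y"
    using w_eq[OF v(1)] w_eq[OF v(2)] False by (simp add: powr_add powr_minus powr_diff divide_inverse)
  finally show ?thesis .
qed

lemma w_le_1_iff:
  assumes x: "x \<in> Qbar"
  shows "w x \<le> 1 \<longleftrightarrow> x \<in> V"
proof (cases "x = 0")
  case True
  then show ?thesis by (simp add: w_def)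
next
  case False
  obtain n j where v: "val_rel x n j" using exists_val_rel x False by metis
  obtain u where u: "unit u" "x ^ n = \<pi> powi j * u" and n: "n > 0"
    using v by (auto simp: val_rel_def)
  have "w x \<le> 1 \<longleftrightarrow> j \<ge> 0"
    unfolding w_eq[OF v False] using p_gt_1 n powr_le_cancel_iff[of "real p" "- (real_of_int j / real n)" 0]
    by (simp add: zero_le_divide_iff)
  also have "\<dots> \<longleftrightarrow> x \<in> V"
  proof
    assume "j \<ge> 0"
    then have xn: "x ^ n \<in> V" using u \<pi>_powi_in_V_iff by (auto simp: unit_def)
    \<comment> \<open>A root of an element of \<open>V\<close> lies in \<open>V\<close>: otherwise
      1/x would lie in \<open>V\<close>, and x = x^n (1/x)^(n - 1).\<close>
    show "x \<in> V"
    proof (rule ccontr)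
      assume "x \<notin> V"
      then have "inverse x \<in> V" using valuation_ring x False by blast
      then have "x ^ n * inverse x ^ (n - 1) \<in> V" using xn by auto
      moreover have "x ^ n = x * x ^ (n - 1)" using n by (simp flip: power_Suc)
      then have "x ^ n * inverse x ^ (n - 1) = x" using False by (simp add: power_inverse)
      ultimately show False using \<open>x \<notin> V\<close> by simp
    qed
  next
    assume "x \<in> V"
    then have "x ^ n \<in> V" by auto
    then have "x ^ n * inverse u \<in> V" using u(1) V_closed(3) unfolding unit_def by blast
    moreover have "x ^ n * inverse u = \<pi> powi j" using u by (simp add: unit_def)
    ultimately show "j \<ge> 0" using \<pi>_powi_in_V_iff by simp
  qed
  finally show ?thesis .
qed

lemma w_eq_0_iff [simp]: "w x = 0 \<longleftrightarrow> x = 0"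
  using p_gt_1 by (auto simp: w_def)

lemma w_nonneg [simp]: "0 \<le> w x"
  by (auto simp: w_def)

text \<open>\<open>V\<close> is the unit ball, so after division by the larger summand the claim is
  that \<open>V\<close> is closed under adding 1.\<close>

lemma w_ultra:
  assumes "x \<in> Qbar" "y \<in> Qbar"
  shows "w (x + y) \<le> max (w x) (w y)"
proof -
  have key: "w (a + b) \<le> w b" if ab: "a \<in> Qbar" "b \<in> Qbar" "w a \<le> w b" for a b
  proof (cases "b = 0")
    case True
    then show ?thesis using ab w_nonneg[of a] by (metis add_0_right)
  next
    case False
    have wb: "w b > 0" using False by (simp add: less_le)
    have "w a = w (a / b) * w b" using w_mult[of "a / b" b] ab False by simp
    then have "w (a / b) * w b \<le> 1 * w b" using ab by simp
    then have "w (a / b) \<le> 1" using wb by simp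
    then have "a / b \<in> V" using w_le_1_iff ab by auto
    then have "w (a / b + 1) \<le> 1" using w_le_1_iff ab by auto
    then have "w (a / b + 1) * w b \<le> 1 * w b" by (intro mult_right_mono) auto
    moreover have "w (a + b) = w (a / b + 1) * w b"
      using w_mult[of "a / b + 1" b] ab False by (simp add: distrib_right)
    ultimately show ?thesis by simp
  qed
  show ?thesis using key[of x y] key[of y x] assms by (cases "w x \<le> w y") (auto simp: add.commute)
qed

lemma nonarch_w: "nonarch Qbar w"
proof
  show "abs_value_on Qbar w"
    unfolding abs_value_on_def
  proof (intro conjI ballI)
    fix x y assume xy: "x \<in> Qbar" "y \<in> Qbar"
    show "w (x + y) \<le> w x + w y" using w_ultra[OF xy] w_nonneg[of x] w_nonneg[of y] by linarith
  qed (auto simp: w_mult)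
qed (rule w_ultra)

lemma w_of_int: "w (of_int n) = padic_abs p (of_int n)"
proof (cases "n = 0")
  case True
  then show ?thesis by (simp add: w_def)
next
  case False
  obtain u where "unit u" "of_int n = \<pi> powi (int (multiplicity (int p) n)) * u"
    using int_eq_power_times_unit[OF False] by blast
  then have "val_rel (of_int n) 1 (int (multiplicity (int p) n))" by (auto simp: val_rel_def)
  then have "w (of_int n) = real p powr (- real (multiplicity (int p) n))"
    using w_eq False by force
  also have "\<dots> = padic_abs p (of_int n)"
    using padic_abs_of_int[OF prime False] p_gt_1 by (simp add: powr_minus powr_realpow divide_inverse)
  finally show ?thesis .
qed

end

theorem exists_padic_extension:
  assumes p: "prime p"
  obtains w where "nonarch Qbar w" "\<And>r. w (of_rat r) = padic_abs p r"
proof -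
  define F where "F = {V. subring_without_inverse p V}"
  \<comment> \<open>Zorn's lemma starts from the ring of integers.\<close>
  have "subring_without_inverse p \<int>"
  proof (rule subring_without_inverseI)
    show "x \<in> Qbar" if "x \<in> \<int>" for x using that by (auto simp: Qbar_def elim: Ints_cases)
    show "inverse (of_nat p) \<notin> (\<int> :: complex set)"
    proof
      assume "inverse (of_nat p) \<in> (\<int> :: complex set)"
      then obtain k where "inverse (of_nat p) = (of_int k :: complex)" by (auto elim: Ints_cases)
      then have "of_int k * of_nat p = (1 :: complex)" using p by (metis left_inverse of_nat_eq_0_iff not_prime_0)
      then have "of_int (k * int p) = (of_int 1 :: complex)" by simp
      then have "k * int p = 1" by (simp only: of_int_eq_iff)
      then have "int p dvd 1" by (metis dvd_triv_right)
      then show False using prime_gt_1_nat[OF p] by simp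
    qed
  qed auto
  then have ne: "F \<noteq> {}" by (auto simp: F_def)
  have "\<exists>V\<in>F. \<forall>X\<in>F. V \<subseteq> X \<longrightarrow> X = V"
  proof (rule subset_Zorn_nonempty[OF ne])
    fix C assume C: "C \<noteq> {}" "subset.chain F C"
    have CF: "\<And>V. V \<in> C \<Longrightarrow> subring_without_inverse p V" using C(2) by (auto simp: subset.chain_def F_def)
    have "subring_without_inverse p (\<Union>C)"
    proof (rule subring_without_inverseI)
      fix x y assume xy: "x \<in> \<Union>C" "y \<in> \<Union>C"
      then obtain V where V: "V \<in> C" "x \<in> V" "y \<in> V" using chain_Union_pair[OF C(2)] by blast
      then have "x - y \<in> V" "x * y \<in> V" using CF by (auto simp: subring_without_inverse_def)
      then show "x - y \<in> \<Union>C" "x * y \<in> \<Union>C" using V(1) by auto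
    qed (use C(1) CF in \<open>auto simp: subring_without_inverse_def\<close>)
    then show "\<Union>C \<in> F" by (simp add: F_def)
  qed
  then obtain V where V: "subring_without_inverse p V" "\<And>X. subring_without_inverse p X \<Longrightarrow> V \<subseteq> X \<Longrightarrow> X = V"
    by (auto simp: F_def)
  interpret max_subring p V using p V by unfold_locales auto
  interpret W: nonarch Qbar w by (rule nonarch_w)
  show ?thesis
  proof
    show "nonarch Qbar w" by (rule nonarch_w)
    show "w (of_rat r) = padic_abs p r" for r by (rule W.padic_abs_on_rat[OF p w_of_int])
  qed
qed

section \<open>Number fields and their places\<close>

lemma rpoly_pcompose: "rpoly (pcompose f g) x = rpoly f (rpoly g x)"
  by (induction f) (simp_all add: pcompose_pCons)

text \<open>A relation with nonzero constant term c reads y q(y) = - c, so the inverse is a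
  polynomial in \<open>y\<close>. This is what makes Q[\<alpha>] a field.\<close>

lemma inverse_eq_rpoly:
  fixes y :: "'a::field_char_0"
  assumes "algebraic y" "y \<noteq> 0"
  shows "\<exists>f. inverse y = rpoly f y"
proof -
  obtain p where p: "coeff p 0 \<noteq> 0" "poly (map_poly of_int p) y = 0"
    using algebraicE'_nonzero[OF assms] by blast
  obtain c q where cq: "map_poly rat_of_int p = pCons c q" by (cases "map_poly rat_of_int p")
  have c: "c \<noteq> 0" using p(1) arg_cong[OF cq, of "\<lambda>f. coeff f 0"] by (auto simp: coeff_map_poly)
  have "of_rat c + y * rpoly q y = 0" using p(2) unfolding rpoly_of_int[symmetric] cq by simp
  then have "y * rpoly q y = - of_rat c" by (simp add: eq_neg_iff_add_eq_0 add.commute)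
  then have "inverse y = rpoly (smult (- (1 / c)) q) y"
    using c assms(2) by (simp add: of_rat_minus of_rat_divide field_simps)
  then show ?thesis by blast
qed

lemma is_subfield_hull: "is_subfield (is_subfield hull S)"
  by (rule hull_in) (auto simp: is_subfield_def)

lemma hull_eq_rpoly_range:
  assumes "\<alpha> \<in> Qbar"
  shows "is_subfield hull {\<alpha>} = range (\<lambda>g. rpoly g \<alpha>)"
proof
  interpret Q: subfld Qbar using is_subfield_Qbar by unfold_locales
  have "is_subfield (range (\<lambda>g. rpoly g \<alpha>))"
    unfolding is_subfield_def
  proof (intro conjI ballI)
    show "0 \<in> range (\<lambda>g. rpoly g \<alpha>)" by (rule range_eqI[of _ _ 0]) simp
    show "1 \<in> range (\<lambda>g. rpoly g \<alpha>)" by (rule range_eqI[of _ _ 1]) simp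
    fix x assume "x \<in> range (\<lambda>g. rpoly g \<alpha>)"
    then obtain f where f: "x = rpoly f \<alpha>" by auto
    show "- x \<in> range (\<lambda>g. rpoly g \<alpha>)" by (rule range_eqI[of _ _ "- f"]) (simp add: f)
    show "inverse x \<in> range (\<lambda>g. rpoly g \<alpha>)"
    proof (cases "x = 0")
      case True
      then show ?thesis by (intro range_eqI[of _ _ 0]) simp
    next
      case False
      have "x \<in> Qbar" unfolding f using assms by auto
      then obtain h where "inverse x = rpoly h x" using inverse_eq_rpoly[of x] False by (auto simp: Qbar_def)
      then show ?thesis by (intro range_eqI[of _ _ "pcompose h f"]) (simp add: rpoly_pcompose f)
    qed
    fix y assume "y \<in> range (\<lambda>g. rpoly g \<alpha>)"
    then obtain g where g: "y = rpoly g \<alpha>" by auto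
    show "x + y \<in> range (\<lambda>g. rpoly g \<alpha>)" by (rule range_eqI[of _ _ "f + g"]) (simp add: f g)
    show "x * y \<in> range (\<lambda>g. rpoly g \<alpha>)" by (rule range_eqI[of _ _ "f * g"]) (simp add: f g)
  qed
  moreover have "\<alpha> \<in> range (\<lambda>g. rpoly g \<alpha>)" by (rule range_eqI[of _ _ "[:0, 1:]"]) simp
  ultimately show "is_subfield hull {\<alpha>} \<subseteq> range (\<lambda>g. rpoly g \<alpha>)" by (intro hull_minimal) auto
  interpret subfld "is_subfield hull {\<alpha>}" using is_subfield_hull by unfold_locales
  have "\<alpha> \<in> is_subfield hull {\<alpha>}" using hull_subset[of "{\<alpha>}"] by auto
  then show "range (\<lambda>g. rpoly g \<alpha>) \<subseteq> is_subfield hull {\<alpha>}" by auto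
qed

lemma simple_extension_basis:
  assumes m: "is_minpoly m (\<alpha>::complex)"
  defines "K \<equiv> is_subfield hull {\<alpha>}"
  obtains B where "finite B" "B \<subseteq> K" "K \<subseteq> ratvs.span B" "card B \<le> degree m" "B \<noteq> {}"
proof -
  have \<alpha>: "\<alpha> \<in> Qbar" using minpoly_splits(3,4)[OF m] by blast
  define M where "M = map_poly rat_of_int m"
  have M: "M \<noteq> 0" "rpoly M \<alpha> = 0" "degree M = degree m"
    using m by (auto simp: M_def is_minpoly_def degree_map_poly)
  define B where "B = (\<lambda>i. \<alpha> ^ i) ` {..<degree m}"
  interpret subfld K unfolding K_def using is_subfield_hull by unfold_locales
  have \<alpha>K: "\<alpha> \<in> K" unfolding K_def using hull_subset[of "{\<alpha>}"] by auto
  show ?thesis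
  proof
    show "finite B" "card B \<le> degree m" using card_image_le[of "{..<degree m}"] by (auto simp: B_def)
    show "B \<subseteq> K" using \<alpha>K by (auto simp: B_def)
    show "B \<noteq> {}" using degree_minpoly_pos[OF m] by (auto simp: B_def)
    show "K \<subseteq> ratvs.span B"
    proof
      fix x assume "x \<in> K"
      then obtain g where g: "x = rpoly g \<alpha>" unfolding K_def hull_eq_rpoly_range[OF \<alpha>] by auto
      define r where "r = g mod M"
      have "g = g div M * M + r" by (simp add: r_def)
      then have "x = rpoly (g div M * M + r) \<alpha>" using g by simp
      then have x: "x = rpoly r \<alpha>" using M(2) by simp
      have "r = 0 \<or> degree r < degree m" using degree_mod_less[OF M(1), of g] M(3) by (auto simp: r_def)
      then have r: "degree r < degree m" using degree_minpoly_pos[OF m] by auto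
      show "x \<in> ratvs.span B"
        unfolding x rpoly_altdef
      proof (intro ratvs.span_sum ratvs.span_scale ratvs.span_base)
        fix i assume "i \<in> {..degree r}"
        then show "\<alpha> ^ i \<in> B" using r by (auto simp: B_def)
      qed
    qed
  qed
qed

text \<open>The height divides by this degree: positivity makes the quotient meaningful, and an
  upper bound of the degree is the direction that a lower bound of the height requires.\<close>

lemma extension_degree_bounds:
  assumes B: "finite B" "B \<subseteq> K" "K \<subseteq> ratvs.span B" and K: "(1::complex) \<in> K"
  shows "extension_degree \<rat> K \<le> card B" "extension_degree \<rat> K > 0"
proof -
  let ?P = "\<lambda>n. \<exists>B. finite B \<and> card B = n \<and> B \<subseteq> K \<and> spans_over \<rat> B K"
  have "spans_over \<rat> B K"
    unfolding spans_over_def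
  proof
    fix x assume "x \<in> K"
    then obtain u where "x = (\<Sum>b\<in>B. of_rat (u b) * b)" using B(3) unfolding ratvs.span_finite[OF B(1)] by blast
    then show "\<exists>c. (\<forall>b\<in>B. c b \<in> \<rat>) \<and> x = (\<Sum>b\<in>B. c b * b)" by (intro exI[of _ "\<lambda>b. of_rat (u b)"]) auto
  qed
  then have P: "?P (card B)" using B by auto
  then show "extension_degree \<rat> K \<le> card B" unfolding extension_degree_def by (rule Least_le)
  have "?P (extension_degree \<rat> K)" unfolding extension_degree_def using P by (rule LeastI)
  then obtain B' where B': "finite B'" "card B' = extension_degree \<rat> K" "spans_over \<rat> B' K" by blast
  show "extension_degree \<rat> K > 0"
  proof (rule ccontr)
    assume "\<not> extension_degree \<rat> K > 0"
    then have "B' = {}" using B' by simp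
    then show False using B'(3) K by (auto simp: spans_over_def)
  qed
qed

section \<open>Weak approximation and finiteness of the places over a given one\<close>

definition places_over :: "complex set \<Rightarrow> (rat \<Rightarrow> real) \<Rightarrow> (complex \<Rightarrow> real) set" where
  "places_over K u = {v \<in> extensional K. abs_value_on K v \<and> (\<forall>r. v (of_rat r) = u r)}"

lemma places_eq:
  "places K = places_over K (\<lambda>r. \<bar>real_of_rat r\<bar>) \<union> (\<Union>p\<in>{p. prime p}. places_over K (padic_abs p))"
  unfolding places_def places_over_def by blast

context absval
begin

lemma v_power_int: "x \<in> K \<Longrightarrow> x powi j \<in> K \<and> v (x powi j) = v x powi j"
  by (auto simp: power_int_def v_power v_inverse)

lemma v_abs_diff: "x \<in> K \<Longrightarrow> y \<in> K \<Longrightarrow> \<bar>v x - v y\<bar> \<le> v (x - y)"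
  using v_triangle[of "x - y" y] v_triangle[of "y - x" x] v_minus_commute[of x y] by auto

lemma v_one_plus_power_tendsto:
  assumes "x \<in> K" "v x < 1"
  shows "(\<lambda>r. v (1 + x ^ r)) \<longlonglongrightarrow> 1"
proof -
  have "(\<lambda>r. v (1 + x ^ r) - 1) \<longlonglongrightarrow> 0"
  proof (rule Lim_null_comparison)
    show "\<forall>\<^sub>F r in sequentially. norm (v (1 + x ^ r) - 1) \<le> v x ^ r"
      using v_abs_diff[of "1 + x ^ r" 1 for r] assms by (intro always_eventually) (auto simp: v_power)
    show "(\<lambda>r. v x ^ r) \<longlonglongrightarrow> 0" using assms by (intro LIMSEQ_power_zero) auto
  qed
  then show ?thesis by (simp add: LIM_zero_iff)
qed

text \<open>In value, x^r / (1 + x^r) tends to 0 where v x < 1 and to 1 where v x > 1. It replaces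
  x^r as a separating sequence when \<open>x\<close> is large at an unwanted place.\<close>

lemma v_approx_unit_tendsto_0:
  assumes "x \<in> K" "v x < 1"
  shows "(\<lambda>r. v (x ^ r / (1 + x ^ r))) \<longlonglongrightarrow> 0"
proof -
  have "(\<lambda>r. v x ^ r) \<longlonglongrightarrow> 0" using assms by (intro LIMSEQ_power_zero) auto
  from tendsto_divide[OF this v_one_plus_power_tendsto[OF assms]]
  show ?thesis using assms by (simp add: v_divide v_power)
qed

lemma v_approx_unit_tendsto_1:
  assumes "x \<in> K" "v x > 1"
  shows "(\<lambda>r. v (x ^ r / (1 + x ^ r))) \<longlonglongrightarrow> 1"
proof -
  have x: "x \<noteq> 0" using assms by auto
  have "v (inverse x) < 1" using assms by (simp add: v_inverse inverse_less_1_iff)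
  then have "(\<lambda>r. inverse (v (1 + inverse x ^ r))) \<longlonglongrightarrow> inverse 1"
    using assms by (intro tendsto_inverse v_one_plus_power_tendsto) auto
  moreover have "inverse (v (1 + inverse x ^ r)) = v (x ^ r / (1 + x ^ r))" for r
  proof -
    have "1 + inverse x ^ r = (1 + x ^ r) / x ^ r" using x by (simp add: field_simps power_inverse)
    then have "inverse (1 + inverse x ^ r) = x ^ r / (1 + x ^ r)" by simp
    then show ?thesis using assms by (simp flip: v_inverse)
  qed
  ultimately show ?thesis by simp
qed

end

text \<open>Two different absolute values differ at some y, and after inverting y the first is the
  larger there. A high power of y widens the gap beyond the factor c = u r0, so a power of the
  rational \<open>r0\<close>, which has the same value at both, fits in between.\<close>

lemma separate_two_places:
  assumes K: "is_subfield K" and u: "u r0 > 1"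
    and v: "v \<in> places_over K u" "v' \<in> places_over K u" "v \<noteq> v'"
  shows "\<exists>x\<in>K. v x > 1 \<and> v' x < 1"
proof -
  interpret V: absval K v using K v by unfold_locales (auto simp: places_over_def)
  interpret V': absval K v' using K v by unfold_locales (auto simp: places_over_def)
  have "\<exists>y\<in>K. v y \<noteq> v' y" using v by (metis (no_types, lifting) extensionalityI mem_Collect_eq places_over_def)
  then obtain y where y: "y \<in> K" "v y \<noteq> v' y" by auto
  then have "y \<noteq> 0" by auto
  have "\<exists>y\<in>K. y \<noteq> 0 \<and> v y > v' y"
  proof (cases "v y > v' y")
    case True
    then show ?thesis using y \<open>y \<noteq> 0\<close> by auto
  next
    case False
    then have "v y < v' y" using y by auto
    moreover have "v y > 0" using V.v_pos y \<open>y \<noteq> 0\<close> by auto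
    ultimately have "v (inverse y) > v' (inverse y)" using y by (simp add: V.v_inverse V'.v_inverse)
    then show ?thesis using y \<open>y \<noteq> 0\<close> by (intro bexI[of _ "inverse y"]) auto
  qed
  then obtain y where y: "y \<in> K" "y \<noteq> 0" "v y > v' y" by auto
  have pos: "v' y > 0" "v y > 0" using V.v_pos V'.v_pos y by auto
  define c where "c = u r0"
  have c: "c > 1" "v (of_rat r0) = c" "v' (of_rat r0) = c" using u v by (auto simp: c_def places_over_def)
  obtain k where k: "c < (v y / v' y) ^ k" using real_arch_pow[of "v y / v' y" c] y pos by auto
  define A where "A = v' y ^ k"
  have A: "A > 0" "c * A < v y ^ k" using pos k by (auto simp: A_def power_divide field_simps)
  \<comment> \<open>The first integer exponent with A < c^j; it satisfies c^j \<le> c A, which is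
    still below v y ^ k.\<close>
  define j where "j = \<lfloor>log c A\<rfloor> + 1"
  have "c powr log c A = A" using c A by simp
  moreover have "log c A < real_of_int j" "real_of_int j \<le> log c A + 1"
    unfolding j_def by linarith+
  ultimately have "A < c powr real_of_int j" "c powr real_of_int j \<le> A * c"
    using c powr_less_mono[of "log c A" j c] powr_mono[of "real_of_int j" "log c A + 1" c]
    by (auto simp: powr_add)
  moreover have "c powr real_of_int j = c powi j" using c by (simp add: powr_real_of_int')
  ultimately have cj: "A < c powi j" "c powi j < v y ^ k" using A(2) by (auto simp: mult.commute)
  have cpos: "c powi j > 0" using c by (simp add: zero_less_power_int)
  define x where "x = y ^ k / of_rat r0 powi j"
  have "x \<in> K" using y V.v_power_int[of "of_rat r0" j] by (auto simp: x_def)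
  moreover have "v x = v y ^ k / c powi j" "v' x = v' y ^ k / c powi j"
    using y V.v_power_int[of "of_rat r0" j] V'.v_power_int[of "of_rat r0" j] c
    by (auto simp: x_def V.v_divide V'.v_divide V.v_power V'.v_power)
  ultimately show ?thesis using cj cpos by (intro bexI[of _ x]) (auto simp: A_def)
qed

text \<open>Artin-Whaples induction. Let x separate v from T and y separate v from w. For large r
  the element t r * y separates v from all of them, where t r is x^r if w x \<le> 1, and otherwise
  x^r / (1 + x^r), whose values tend to 1 at v and w and to 0 on T.\<close>

lemma separate_places:
  assumes K: "is_subfield K" and u: "u r0 > 1"
    and T: "finite T" "T \<subseteq> places_over K u" "v \<in> places_over K u" "v \<notin> T"
  shows "\<exists>x\<in>K. v x > 1 \<and> (\<forall>v'\<in>T. v' x < 1)"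
  using T(1,2,4)
proof (induction T)
  case empty
  interpret V: absval K v using K T by unfold_locales (auto simp: places_over_def)
  show ?case using u T(3) by (intro bexI[of _ "of_rat r0"]) (auto simp: places_over_def)
next
  case (insert w T)
  interpret V: absval K v using K T by unfold_locales (auto simp: places_over_def)
  interpret W: absval K w using K insert by unfold_locales (auto simp: places_over_def)
  have abs: "absval K v'" if "v' \<in> T" for v' using that K insert by unfold_locales (auto simp: places_over_def)
  obtain x where x: "x \<in> K" "v x > 1" "\<forall>v'\<in>T. v' x < 1" using insert by auto
  obtain y where y: "y \<in> K" "v y > 1" "w y < 1"
    using separate_two_places[of K u r0 v w] K u T insert by auto
  obtain t where t: "\<And>r. t r \<in> K" "\<And>v'. v' \<in> T \<Longrightarrow> (\<lambda>r. v' (t r)) \<longlonglongrightarrow> 0"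
    "\<forall>\<^sub>F r in sequentially. v (t r) * v y > 1" "\<forall>\<^sub>F r in sequentially. w (t r) * w y < 1"
  proof (cases "w x \<le> 1")
    case True
    show ?thesis
    proof (rule that[of "\<lambda>r. x ^ r"])
      show "(\<lambda>r. v' (x ^ r)) \<longlonglongrightarrow> 0" if v': "v' \<in> T" for v'
      proof -
        interpret V': absval K v' by (rule abs[OF v'])
        show ?thesis using x v' by (simp add: V'.v_power LIMSEQ_power_zero)
      qed
      have "v x ^ r * v y \<ge> 1 * v y" for r using x y by (intro mult_right_mono one_le_power) auto
      then show "\<forall>\<^sub>F r in sequentially. v (x ^ r) * v y > 1"
        using x y by (intro always_eventually) (auto simp: V.v_power intro: less_le_trans)
      have "w x ^ r * w y \<le> 1 * w y" for r using True x y by (intro mult_right_mono power_le_one) auto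
      then show "\<forall>\<^sub>F r in sequentially. w (x ^ r) * w y < 1"
        using x y by (intro always_eventually) (auto simp: W.v_power intro: le_less_trans)
    qed (use x in auto)
  next
    case False
    show ?thesis
    proof (rule that[of "\<lambda>r. x ^ r / (1 + x ^ r)"])
      show "(\<lambda>r. v' (x ^ r / (1 + x ^ r))) \<longlonglongrightarrow> 0" if "v' \<in> T" for v'
        using x that by (intro absval.v_approx_unit_tendsto_0[OF abs]) auto
      have "(\<lambda>r. v (x ^ r / (1 + x ^ r)) * v y) \<longlonglongrightarrow> 1 * v y"
        using x by (intro tendsto_intros V.v_approx_unit_tendsto_1) auto
      then show "\<forall>\<^sub>F r in sequentially. v (x ^ r / (1 + x ^ r)) * v y > 1" using y by (intro order_tendstoD) auto
      have "(\<lambda>r. w (x ^ r / (1 + x ^ r)) * w y) \<longlonglongrightarrow> 1 * w y"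
        using x False by (intro tendsto_intros W.v_approx_unit_tendsto_1) auto
      then show "\<forall>\<^sub>F r in sequentially. w (x ^ r / (1 + x ^ r)) * w y < 1" using y by (intro order_tendstoD) auto
    qed (use x in auto)
  qed
  have "\<forall>\<^sub>F r in sequentially. \<forall>v'\<in>T. v' (t r) * v' y < 1"
  proof (intro eventually_ball_finite[OF insert.hyps(1)] ballI)
    fix v' assume "v' \<in> T"
    then have "(\<lambda>r. v' (t r) * v' y) \<longlonglongrightarrow> 0 * v' y" by (intro tendsto_intros t(2))
    then show "\<forall>\<^sub>F r in sequentially. v' (t r) * v' y < 1" by (intro order_tendstoD) auto
  qed
  then have "\<forall>\<^sub>F r in sequentially. (\<forall>v'\<in>T. v' (t r) * v' y < 1) \<and> v (t r) * v y > 1 \<and> w (t r) * w y < 1"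
    using t(3,4) by eventually_elim auto
  then obtain r where r: "\<forall>v'\<in>T. v' (t r) * v' y < 1" "v (t r) * v y > 1" "w (t r) * w y < 1"
    by (auto simp: eventually_sequentially)
  show ?case
    using r t(1) y absval.v_mult[OF abs, of _ "t r" y] V.v_mult[of "t r" y] W.v_mult[of "t r" y]
    by (intro bexI[of _ "t r * y"]) auto
qed

text \<open>
  Powers of separating elements give a matrix of values that is diagonally dominant, hence
  elements of \<open>K\<close> that are linearly independent over the rationals.
\<close>

lemma card_places_over_le:
  assumes K: "is_subfield K" and u: "u r0 > 1" and B: "finite B" "K \<subseteq> ratvs.span B"
    and T: "finite T" "T \<subseteq> places_over K u"
  shows "card T \<le> card B"
proof (rule ccontr)
  assume card: "\<not> card T \<le> card B"
  have abs: "absval K v" if "v \<in> T" for v using that K T by unfold_locales (auto simp: places_over_def)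
  have uv: "v (of_rat r) = u r" if "v \<in> T" for v r using that T by (auto simp: places_over_def)
  have "\<forall>v\<in>T. \<exists>x\<in>K. v x > 1 \<and> (\<forall>v'\<in>T - {v}. v' x < 1)"
  proof
    fix v assume "v \<in> T"
    then show "\<exists>x\<in>K. v x > 1 \<and> (\<forall>v'\<in>T - {v}. v' x < 1)"
      using T by (intro separate_places[where u = u and ?r0.0 = r0]) (auto intro: K u)
  qed
  then obtain x where x: "\<And>v. v \<in> T \<Longrightarrow> x v \<in> K" "\<And>v. v \<in> T \<Longrightarrow> v (x v) > 1"
    "\<And>v v'. v \<in> T \<Longrightarrow> v' \<in> T \<Longrightarrow> v' \<noteq> v \<Longrightarrow> v' (x v) < 1" by (metis Diff_iff empty_iff insert_iff)
  have "\<forall>\<^sub>F r in sequentially. \<forall>v\<in>T. (\<Sum>v'\<in>T - {v}. v (x v') ^ r) < 1"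
  proof (intro eventually_ball_finite[OF T(1)] ballI)
    fix v assume v: "v \<in> T"
    interpret V: absval K v by (rule abs[OF v])
    have "(\<lambda>r. \<Sum>v'\<in>T - {v}. v (x v') ^ r) \<longlonglongrightarrow> (\<Sum>v'\<in>T - {v}. 0)"
      using x v by (intro tendsto_sum LIMSEQ_power_zero) auto
    then show "\<forall>\<^sub>F r in sequentially. (\<Sum>v'\<in>T - {v}. v (x v') ^ r) < 1" by (intro order_tendstoD) auto
  qed
  then obtain r where r: "\<And>v. v \<in> T \<Longrightarrow> (\<Sum>v'\<in>T - {v}. v (x v') ^ r) < 1" by (auto simp: eventually_sequentially)
  have span: "x v ^ r \<in> ratvs.span B" if "v \<in> T" for v
    using x(1)[OF that] subfld.K_power[of K "x v" r] K B(2) by (auto simp: subfld_def)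
  obtain l where l: "\<exists>v\<in>T. l v \<noteq> 0" "(\<Sum>v\<in>T. of_rat (l v) * x v ^ r) = 0"
    using ratvs_span_dependent[OF B(1) T(1), of "\<lambda>v. x v ^ r"] span card by auto
  \<comment> \<open>At the place with the largest coefficient the diagonal term exceeds the sum of
    all others, so the relation cannot hold there.\<close>
  have "Max ((\<lambda>v. u (l v)) ` T) \<in> (\<lambda>v. u (l v)) ` T" using T(1) l(1) by (intro Max_in) auto
  then obtain v where v: "v \<in> T" "u (l v) = Max ((\<lambda>v. u (l v)) ` T)" by auto
  then have vmax: "u (l v') \<le> u (l v)" if "v' \<in> T" for v' using that T(1) by simp
  interpret V: absval K v by (rule abs[OF v(1)])
  obtain v1 where v1: "v1 \<in> T" "l v1 \<noteq> 0" using l(1) by auto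
  have "u (l v1) > 0" using V.v_pos[of "of_rat (l v1)"] v1 uv[OF v(1)] by auto
  then have pos: "u (l v) > 0" using vmax[OF v1(1)] by simp
  have "of_rat (l v) * x v ^ r = - (\<Sum>v'\<in>T - {v}. of_rat (l v') * x v' ^ r)"
    using l(2) sum.remove[OF T(1) v(1), of "\<lambda>v. of_rat (l v) * x v ^ r"] by (simp add: eq_neg_iff_add_eq_0)
  moreover have "(\<Sum>v'\<in>T - {v}. of_rat (l v') * x v' ^ r) \<in> K"
    using x(1) by (intro V.K_sum V.K_closed(4) V.K_power V.K_of_rat) auto
  ultimately have "v (of_rat (l v) * x v ^ r) = v (\<Sum>v'\<in>T - {v}. of_rat (l v') * x v' ^ r)" by simp
  also have "\<dots> \<le> (\<Sum>v'\<in>T - {v}. v (of_rat (l v') * x v' ^ r))" using x by (intro V.v_sum) auto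
  also have "\<dots> \<le> (\<Sum>v'\<in>T - {v}. u (l v) * v (x v') ^ r)"
    using x vmax by (intro sum_mono) (auto simp: V.v_mult V.v_power uv[OF v(1)] intro!: mult_right_mono)
  also have "\<dots> < u (l v) * 1" unfolding sum_distrib_left[symmetric] using r[OF v(1)] pos by (intro mult_strict_left_mono)
  also have "\<dots> \<le> u (l v) * v (x v) ^ r" using x(2)[OF v(1)] pos by (intro mult_left_mono one_le_power) auto
  also have "\<dots> = v (of_rat (l v) * x v ^ r)" using x v by (simp add: V.v_mult V.v_power uv[OF v(1)])
  finally show False by simp
qed

lemma finite_places_over:
  assumes "is_subfield K" "u r0 > 1" "finite B" "K \<subseteq> ratvs.span B"
  shows "finite (places_over K u)"
proof (rule ccontr)
  assume "infinite (places_over K u)"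
  then obtain T where "T \<subseteq> places_over K u" "finite T" "card T = Suc (card B)"
    using infinite_arbitrarily_large by metis
  then show False using card_places_over_le[where u = u and ?r0.0 = r0 and T = T, OF assms] by simp
qed

lemma padic_abs_inverse_prime:
  assumes "prime p"
  shows "padic_abs p (inverse (of_nat p)) > 1"
proof -
  have p: "p > 1" by (rule prime_gt_1_nat[OF assms])
  have "quotient_of (of_int (int p)) = (int p, 1)" using quotient_of_int[of "int p"] by (simp add: of_int_def)
  then have "quotient_of (inverse (of_nat p)) = (1, int p)" using p by (simp add: rat_inverse_code)
  from padic_abs_quotient[OF assms this] show ?thesis
    using p padic_abs_prime[OF assms] padic_abs_of_int_eq_1[OF assms, of 1] by simp
qed

lemma nonarch_places_over:
  assumes "is_subfield K" "prime p" "v \<in> places_over K (padic_abs p)"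
  shows "nonarch K v"
proof -
  interpret absval K v using assms by unfold_locales (auto simp: places_over_def)
  show ?thesis
  proof
    fix x y assume xy: "x \<in> K" "y \<in> K"
    show "v (x + y) \<le> max (v x) (v y)"
    proof (rule ultrametric_if_bounded_on_nat[OF _ xy])
      fix n
      have "v (of_nat n) = padic_abs p (of_nat n)" using assms(3) by (auto simp: places_over_def dest!: spec[of _ "of_nat n"])
      then show "v (of_nat n) \<le> 1" using padic_abs_of_int_le_1[OF assms(2), of "int n"] by simp
    qed
  qed
qed

text \<open>With a leading coefficient prime to p and v \<alpha> > 1, the leading term of
  m(\<alpha>) would have a strictly larger value than every other term and could not cancel.\<close>

lemma place_gt_1_imp_dvd_lead_coeff:
  assumes m: "is_minpoly m (\<alpha>::complex)" and p: "prime p" and K: "is_subfield K" "\<alpha> \<in> K"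
    and v: "v \<in> places_over K (padic_abs p)" "v \<alpha> > 1"
  shows "int p dvd lead_coeff m"
proof (rule ccontr)
  assume ndvd: "\<not> int p dvd lead_coeff m"
  interpret nonarch K v by (rule nonarch_places_over[OF K(1) p v(1)])
  have vi: "v (of_int n) = padic_abs p (of_int n)" for n
    using v(1) by (auto simp: places_over_def dest!: spec[of _ "of_int n"])
  define d where "d = degree m"
  have d: "d > 0" unfolding d_def by (rule degree_minpoly_pos[OF m])
  have "(\<Sum>i\<le>d. of_int (coeff m i) * \<alpha> ^ i) = 0"
    using m by (simp add: is_minpoly_def rpoly_of_int poly_altdef coeff_map_poly degree_map_poly d_def)
  then have "of_int (coeff m d) * \<alpha> ^ d = - (\<Sum>i<d. of_int (coeff m i) * \<alpha> ^ i)"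
    by (simp add: lessThan_Suc_atMost[symmetric] eq_neg_iff_add_eq_0 add.commute)
  moreover have "v (of_int (coeff m d) * \<alpha> ^ d) = v \<alpha> ^ d"
    using padic_abs_of_int_eq_1[OF p ndvd] vi K by (simp add: v_mult v_power d_def)
  ultimately have "v \<alpha> ^ d = v (\<Sum>i<d. of_int (coeff m i) * \<alpha> ^ i)" using K by (simp add: K_sum)
  also have "\<dots> \<le> v \<alpha> ^ (d - 1)"
  proof (rule ultra_sum)
    fix i assume i: "i \<in> {..<d}"
    have "v (of_int (coeff m i) * \<alpha> ^ i) \<le> 1 * v \<alpha> ^ (d - 1)"
      unfolding v_mult[OF K_of_int K_power[OF K(2)]] v_power[OF K(2)] vi using i v(2)
      by (intro mult_mono padic_abs_of_int_le_1[OF p] power_increasing) auto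
    then show "v (of_int (coeff m i) * \<alpha> ^ i) \<le> v \<alpha> ^ (d - 1)" by simp
  qed (use K v in auto)
  also have "\<dots> < v \<alpha> ^ d" using d v(2) by (intro power_strict_increasing) auto
  finally show False by simp
qed

text \<open>These places form the support of the sum in the height. They lie over the usual absolute
  value or over a prime dividing the leading coefficient, with finitely many over each.\<close>

lemma finite_places_gt_1:
  assumes m: "is_minpoly m (\<alpha>::complex)"
  defines "K \<equiv> is_subfield hull {\<alpha>}"
  shows "finite {v \<in> places K. v \<alpha> > 1}"
proof -
  obtain B where B: "finite B" "B \<subseteq> K" "K \<subseteq> ratvs.span B"
    using simple_extension_basis[OF m] unfolding K_def by metis
  have K: "is_subfield K" "\<alpha> \<in> K" unfolding K_def using is_subfield_hull hull_subset[of "{\<alpha>}"] by auto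
  let ?P = "{p. prime p \<and> int p dvd lead_coeff m}"
  have "?P \<subseteq> {..nat \<bar>lead_coeff m\<bar>}"
  proof
    fix p assume p: "p \<in> ?P"
    have "lead_coeff m \<noteq> 0" using is_minpoly_nonzero[OF m] by simp
    then have "\<bar>int p\<bar> \<le> \<bar>lead_coeff m\<bar>" using p by (intro dvd_imp_le_int) auto
    then show "p \<in> {..nat \<bar>lead_coeff m\<bar>}" by simp
  qed
  then have P: "finite ?P" by (rule finite_subset) simp
  have "{v \<in> places K. v \<alpha> > 1} \<subseteq>
      places_over K (\<lambda>r. \<bar>real_of_rat r\<bar>) \<union> (\<Union>p\<in>?P. places_over K (padic_abs p))"
    using place_gt_1_imp_dvd_lead_coeff[OF m _ K] by (auto simp: places_eq)
  moreover have "finite (places_over K (\<lambda>r. \<bar>real_of_rat r\<bar>))"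
    by (rule finite_places_over[where ?r0.0 = 2, OF K(1) _ B(1,3)]) simp
  moreover have "finite (places_over K (padic_abs p))" if "p \<in> ?P" for p
    by (rule finite_places_over[where ?r0.0 = "inverse (of_nat p)", OF K(1) _ B(1,3)])
      (use that padic_abs_inverse_prime in auto)
  ultimately show ?thesis using P by (meson finite_UN_I finite_UnI finite_subset)
qed

section \<open>Local degrees and the height\<close>

context subfld
begin

lemma K_coeff_prod_linear:
  assumes "finite I" "I \<subseteq> K"
  shows "coeff (\<Prod>r\<in>I. [:- r, 1:]) i \<in> K"
  using assms
proof (induction I arbitrary: i)
  case empty
  then show ?case by (cases i) (auto simp: one_pCons)
next
  case (insert r I)
  then have IH: "coeff (\<Prod>r\<in>I. [:- r, 1:]) i \<in> K" for i by auto
  have "r \<in> K" using insert by auto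
  then show ?case using insert.hyps IH by (cases i) (auto simp: coeff_pCons)
qed

text \<open>Serves to bound the coefficients of a polynomial by its values on \<open>I\<close>; the
  coefficients of \<open>L r\<close> stay in \<open>K\<close>, where the absolute values can be
  applied to them.\<close>

lemma lagrange_interpolation:
  assumes I: "finite I" "I \<subseteq> K"
  obtains L where "\<And>r j. r \<in> I \<Longrightarrow> coeff (L r) j \<in> K"
    "\<And>g. degree g < card I \<Longrightarrow> g = (\<Sum>r\<in>I. smult (poly g r) (L r))"
proof -
  define L where "L = (\<lambda>r. smult (inverse (\<Prod>s\<in>I - {r}. r - s)) (\<Prod>s\<in>I - {r}. [:- s, 1:]))"
  have Ls: "poly (L r) s = (if s = r then 1 else 0)" if rs: "r \<in> I" "s \<in> I" for r s
  proof (cases "s = r")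
    case True
    have "(\<Prod>s\<in>I - {r}. r - s) \<noteq> 0" using I by auto
    then show ?thesis using True by (simp add: L_def poly_prod)
  next
    case False
    then have "(\<Prod>t\<in>I - {r}. s - t) = 0" using rs I by auto
    then show ?thesis using False by (simp add: L_def poly_prod)
  qed
  have degL: "degree (L r) < card I" if "r \<in> I" for r
  proof -
    have "degree (L r) \<le> card (I - {r})"
      unfolding L_def by (rule order_trans[OF degree_smult_le])
        (use degree_prod_sum_le[of "I - {r}" "\<lambda>s. [:- s, 1:]"] I in auto)
    also have "\<dots> < card I" using that I by (intro psubset_card_mono) auto
    finally show ?thesis .
  qed
  show ?thesis
  proof
    show "coeff (L r) j \<in> K" if "r \<in> I" for r j
    proof -
      have "(\<Prod>s\<in>I - {r}. r - s) \<in> K" using that I by (intro K_prod) auto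
      moreover have "coeff (\<Prod>s\<in>I - {r}. [:- s, 1:]) j \<in> K" using I by (intro K_coeff_prod_linear) auto
      ultimately show ?thesis by (simp add: L_def)
    qed
    show "g = (\<Sum>r\<in>I. smult (poly g r) (L r))" if g: "degree g < card I" for g
    proof (rule poly_eqI_degree[of I])
      show "poly g x = poly (\<Sum>r\<in>I. smult (poly g r) (L r)) x" if x: "x \<in> I" for x
      proof -
        have "poly (\<Sum>r\<in>I. smult (poly g r) (L r)) x = (\<Sum>r\<in>I. if r = x then poly g r else 0)"
          unfolding poly_sum using x by (intro sum.cong) (auto simp: Ls)
        then show ?thesis using x I by simp
      qed
      have "card I > 0" using g by simp
      then show "degree (\<Sum>r\<in>I. smult (poly g r) (L r)) < card I"
        using degL by (intro degree_sum_less) (auto intro: le_less_trans[OF degree_smult_le])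
    qed (rule g)
  qed
qed

end

lemma (in embedding) algebraic_image:
  assumes "x \<in> K" "algebraic x"
  shows "algebraic (\<sigma> x)"
proof -
  obtain g where "g \<noteq> 0" "rpoly g x = 0" using assms by (auto simp: algebraic_iff_rpoly)
  then show ?thesis using \<sigma>_rpoly[OF assms(1), of g] by (auto simp: algebraic_iff_rpoly)
qed

text \<open>
  If \<open>n\<close> elements span the completion, the powers \<open>\<alpha>\<^sup>j\<close> with \<open>j < m\<close> satisfy, for \<open>n < m\<close>, rational
  relations up to arbitrarily small errors.  Conjugating these gives polynomials of degree less than
  \<open>m\<close> that are arbitrarily small, relative to their largest coefficient, at all \<open>m\<close> points of \<open>I\<close>.
\<close>

theorem card_embeddings_le_local_degree:
  assumes K: "absval K v" "finite B" "B \<subseteq> K" "K \<subseteq> ratvs.span B" "\<alpha> \<in> K" "K \<subseteq> Qbar"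
    and w: "absval Qbar w" and I: "finite I" "I \<subseteq> Qbar"
    and \<sigma>: "\<And>r. r \<in> I \<Longrightarrow> field_embedding_on Qbar (\<sigma> r) \<and> \<sigma> r \<alpha> = r"
    and wv: "\<And>r x. r \<in> I \<Longrightarrow> x \<in> K \<Longrightarrow> w (\<sigma> r x) = v x"
  shows "card I \<le> local_degree K v"
proof (rule ccontr)
  define n m where "n = local_degree K v" and "m = card I"
  assume "\<not> card I \<le> local_degree K v"
  then have nm: "n < m" by (simp add: n_def m_def)
  interpret V: absval K v by fact
  interpret W: absval Qbar w by fact
  have emb: "embedding Qbar (\<sigma> r)" if "r \<in> I" for r
    using \<sigma>[OF that] is_subfield_Qbar by unfold_locales auto
  obtain b where b: "local_span K v n b"
    using local_span_local_degree[OF K(1-4)] by (auto simp: n_def)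
  then have bK: "b i k \<in> K" if "i < n" for i k using that by (auto simp: local_span_def cauchy_seqs_def)
  have X: "(\<lambda>k::nat. \<alpha> ^ j) \<in> cauchy_seqs K v" for j using K(5) by (auto simp: cauchy_seqs_def)
  have "\<forall>X\<in>cauchy_seqs K v. \<exists>c. (\<forall>i<n. c i \<in> cauchy_seqs \<rat> v) \<and>
      (\<lambda>k. v (X k - (\<Sum>i<n. c i k * b i k))) \<longlonglongrightarrow> 0"
    using b by (simp add: local_span_def)
  from bspec[OF this X] have "\<forall>j. \<exists>c. (\<forall>i<n. c i \<in> cauchy_seqs \<rat> v) \<and>
      (\<lambda>k. v (\<alpha> ^ j - (\<Sum>i<n. c i k * b i k))) \<longlonglongrightarrow> 0"
    by (rule allI)
  from choice[OF this] obtain c where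
    "\<forall>j. (\<forall>i<n. c j i \<in> cauchy_seqs \<rat> v) \<and> (\<lambda>k. v (\<alpha> ^ j - (\<Sum>i<n. c j i k * b i k))) \<longlonglongrightarrow> 0" ..
  then have c: "\<And>j i. i < n \<Longrightarrow> c j i \<in> cauchy_seqs \<rat> v"
    "\<And>j. (\<lambda>k. v (\<alpha> ^ j - (\<Sum>i<n. c j i k * b i k))) \<longlonglongrightarrow> 0" by auto
  have "\<exists>q. c j i k = of_rat q" if "i < n" for j i k
  proof -
    have "c j i k \<in> \<rat>" using c(1)[OF that, of j] by (auto simp: cauchy_seqs_def)
    then show ?thesis by (rule Rats_cases) blast
  qed
  then have q: "\<And>j i k. i < n \<Longrightarrow> c j i k = of_rat (SOME q. c j i k = of_rat q)" by (rule someI_ex)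
  define q where "q = (\<lambda>j i k. SOME q. c j i k = of_rat q)"
  have q: "\<And>j i k. i < n \<Longrightarrow> c j i k = of_rat (q j i k)" using q by (simp add: q_def)
  define E where "E = (\<lambda>j k. \<alpha> ^ j - (\<Sum>i<n. c j i k * b i k))"
  have EK: "E j k \<in> K" for j k
    unfolding E_def using K(5) bK q by (auto intro!: V.K_diff V.K_sum V.K_closed(4))
  define e where "e = (\<lambda>k. \<Sum>j<m. v (E j k))"
  have e: "e \<longlonglongrightarrow> 0"
    unfolding e_def E_def using tendsto_sum[of "{..<m}" "\<lambda>j k. v (\<alpha> ^ j - (\<Sum>i<n. c j i k * b i k))" "\<lambda>_. 0"] c(2) by simp
  obtain r0 where r0: "r0 \<in> I" using nm by (fastforce simp: m_def)
  have wr: "w (of_rat x) = v (of_rat x)" for x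
    using wv[OF r0, of "of_rat x"] embedding.\<sigma>_of_rat[OF emb[OF r0]] by simp
  obtain L where L: "\<And>r j. r \<in> I \<Longrightarrow> coeff (L r) j \<in> Qbar"
    "\<And>g. degree g < card I \<Longrightarrow> g = (\<Sum>r\<in>I. smult (poly g r) (L r))"
    using W.lagrange_interpolation[OF I] by blast
  \<comment> \<open>The interpolation constant of \<open>I\<close>. It does not depend on
    \<open>k\<close>, whereas the error \<open>e k\<close> tends to 0.\<close>
  define C where "C = (\<Sum>j<m. \<Sum>r\<in>I. w (coeff (L r) j))"
  have "1 \<le> e k * C" for k
  proof -
    \<comment> \<open>Since n < m, a nontrivial rational combination cancels all coefficients along
      the spanning sequences, so only the errors \<open>E j k\<close> remain in
      \<open>z\<close>.\<close>
    obtain l where l: "\<exists>j\<in>{..<m}. l j \<noteq> 0" "\<forall>i\<in>{..<n}. (\<Sum>j\<in>{..<m}. l j * q j i k) = 0"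
      using homogeneous_system_nontrivial[of "{..<n}" "{..<m}" "\<lambda>j i. q j i k"] nm by auto
    let ?M = "(\<lambda>j. v (of_rat (l j))) ` {..<m}"
    have "Max ?M \<in> ?M" using nm by (intro Max_in) auto
    then obtain j0 where j0: "j0 < m" "v (of_rat (l j0)) = Max ?M" by auto
    define \<mu> where "\<mu> = v (of_rat (l j0))"
    have max: "v (of_rat (l j)) \<le> \<mu>" if "j < m" for j using that j0 by (simp add: \<mu>_def)
    obtain j1 where "j1 < m" "l j1 \<noteq> 0" using l(1) by auto
    then have \<mu>: "\<mu> > 0" using V.v_pos[of "of_rat (l j1)"] max[of j1] by simp
    define z where "z = (\<Sum>j<m. of_rat (l j) * \<alpha> ^ j)"
    have "(\<Sum>j<m. of_rat (l j) * (\<Sum>i<n. c j i k * b i k)) = (\<Sum>j<m. \<Sum>i<n. of_rat (l j * q j i k) * b i k)"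
      by (intro sum.cong refl) (simp add: q sum_distrib_left of_rat_mult mult.assoc)
    also have "\<dots> = (\<Sum>i<n. of_rat (\<Sum>j<m. l j * q j i k) * b i k)"
      by (subst sum.swap) (simp add: of_rat_sum sum_distrib_right)
    also have "\<dots> = 0" using l(2) by simp
    finally have z: "z = (\<Sum>j<m. of_rat (l j) * E j k)"
      by (simp add: z_def E_def right_diff_distrib sum_subtractf)
    have zK: "z \<in> K" unfolding z_def using K(5) by (auto intro!: V.K_sum)
    have "v z \<le> (\<Sum>j<m. v (of_rat (l j) * E j k))" unfolding z using EK by (intro V.v_sum) auto
    also have "\<dots> \<le> (\<Sum>j<m. \<mu> * v (E j k))"
      using EK max by (intro sum_mono) (auto simp: V.v_mult intro!: mult_right_mono)
    finally have vz: "v z \<le> \<mu> * e k" by (simp add: e_def sum_distrib_left)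
    define g where "g = (\<Sum>j<m. monom (of_rat (l j) :: complex) j)"
    have gr: "poly g r = \<sigma> r z" if r: "r \<in> I" for r
    proof -
      interpret S: embedding Qbar "\<sigma> r" by (rule emb[OF r])
      have "\<alpha> \<in> Qbar" using K by auto
      then have "\<sigma> r z = (\<Sum>j<m. of_rat (l j) * \<sigma> r \<alpha> ^ j)"
        unfolding z_def by (subst S.\<sigma>_sum) (auto simp: S.\<sigma>_mult S.\<sigma>_power)
      then show ?thesis using \<sigma>[OF r] by (simp add: g_def poly_sum poly_monom)
    qed
    have dg: "degree g < card I"
      unfolding g_def using nm degree_monom_le by (intro degree_sum_less) (auto simp: m_def intro: le_less_trans)
    have zQ: "\<sigma> r z \<in> Qbar" if "r \<in> I" for r
      using embedding.algebraic_image[OF emb[OF that], of z] zK K(6) by (auto simp: Qbar_def)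
    \<comment> \<open>The largest coefficient of \<open>g\<close> is interpolated from its values on
      \<open>I\<close>, each of which has absolute value v z; dividing by \<mu> leaves 1 \<le> e k *
      C.\<close>
    have "\<mu> = w (coeff g j0)" using j0(1) by (simp add: \<mu>_def g_def coeff_sum wr)
    also have "coeff g j0 = (\<Sum>r\<in>I. \<sigma> r z * coeff (L r) j0)"
      by (subst L(2)[OF dg]) (simp add: coeff_sum gr)
    also have "w \<dots> \<le> (\<Sum>r\<in>I. w (\<sigma> r z * coeff (L r) j0))"
      using L(1) zQ by (intro W.v_sum) auto
    also have "\<dots> \<le> (\<Sum>r\<in>I. \<mu> * e k * w (coeff (L r) j0))"
      using L(1) zQ vz wv zK by (intro sum_mono) (auto simp: W.v_mult intro!: mult_right_mono)
    also have "\<dots> = \<mu> * e k * (\<Sum>r\<in>I. w (coeff (L r) j0))" by (simp add: sum_distrib_left)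
    also have "\<dots> \<le> \<mu> * e k * C"
    proof (rule mult_left_mono)
      show "(\<Sum>r\<in>I. w (coeff (L r) j0)) \<le> C"
        unfolding C_def using j0(1) L(1) by (intro member_le_sum) (auto intro!: sum_nonneg)
      show "0 \<le> \<mu> * e k" using EK \<mu> by (auto simp: e_def intro!: sum_nonneg mult_nonneg_nonneg)
    qed
    finally show ?thesis using \<mu> by simp
  qed
  moreover have "(\<lambda>k. e k * C) \<longlonglongrightarrow> 0 * C" by (intro tendsto_intros e)
  ultimately have "1 \<le> 0 * C" by (intro LIMSEQ_le_const) auto
  then show False by simp
qed

section \<open>Comparison of the height with the Mahler measure\<close>

lemma complex_root_closed: "degree f > 0 \<Longrightarrow> \<exists>y::complex. poly f y = 0"
  using fundamental_theorem_of_algebra[of f] by (auto simp: constant_degree)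

lemma absval_cmod: "absval Qbar (cmod :: complex \<Rightarrow> real)"
  using is_subfield_Qbar by unfold_locales (auto simp: abs_value_on_def norm_mult norm_triangle_ineq)

lemma cmod_of_rat: "cmod (of_rat r) = \<bar>real_of_rat r\<bar>"
  by (cases r) (simp add: of_rat_rat norm_divide)

lemma sum_conjugates_le_sum_places:
  assumes m: "is_minpoly m (\<alpha>::complex)"
  defines "K \<equiv> is_subfield hull {\<alpha>}" and "R \<equiv> conjugates m"
  assumes w: "absval Qbar w" "\<And>r. w (of_rat r) = u r"
  shows "\<exists>P. finite P \<and> P \<subseteq> places_over K u \<and>
    (\<Sum>r\<in>R. ln (max 1 (w r))) \<le> (\<Sum>v\<in>P. real (local_degree K v) * ln (max 1 (v \<alpha>)))"
proof -
  interpret W: absval Qbar w by fact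
  have R: "finite R" "\<alpha> \<in> R" "R \<subseteq> Qbar" using minpoly_splits[OF m] by (auto simp: R_def)
  then have \<alpha>: "\<alpha> \<in> Qbar" by auto
  obtain B where B: "finite B" "B \<subseteq> K" "K \<subseteq> ratvs.span B"
    using simple_extension_basis[OF m] unfolding K_def by metis
  have K: "is_subfield K" "\<alpha> \<in> K" unfolding K_def using is_subfield_hull hull_subset[of "{\<alpha>}"] by auto
  have KQ: "K \<subseteq> Qbar" unfolding K_def using \<alpha> is_subfield_Qbar by (intro hull_minimal) auto
  have "\<exists>\<sigma>. field_embedding_on Qbar \<sigma> \<and> \<sigma> \<alpha> = r" if "r \<in> R" for r
    using embedding_extension[OF m, of r] complex_root_closed that by (auto simp: R_def conjugates_iff)
  then obtain \<sigma> where \<sigma>: "\<And>r. r \<in> R \<Longrightarrow> field_embedding_on Qbar (\<sigma> r) \<and> \<sigma> r \<alpha> = r" by metis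
  \<comment> \<open>The restriction to \<open>K\<close> makes conjugates that induce the same place
    give equal functions, so the fibres of \<open>V\<close> are the classes to be counted.\<close>
  define V where "V = (\<lambda>r. restrict (\<lambda>x. w (\<sigma> r x)) K)"
  have VP: "V r \<in> places_over K u" if r: "r \<in> R" for r
  proof -
    interpret S: embedding Qbar "\<sigma> r" using \<sigma>[OF r] is_subfield_Qbar by unfold_locales auto
    have "\<sigma> r ` Qbar \<subseteq> Qbar" using S.algebraic_image by (auto simp: Qbar_def)
    then interpret A: absval Qbar "\<lambda>x. w (\<sigma> r x)" using S.absval_pullback[OF w(1)] by simp
    interpret subfld K using K by unfold_locales
    have "abs_value_on K (\<lambda>x. w (\<sigma> r x))" using A.abs_value KQ by (auto simp: abs_value_on_def)
    then have "abs_value_on K (V r)" by (auto simp: abs_value_on_def V_def)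
    then show ?thesis using w(2) by (auto simp: places_over_def V_def)
  qed
  have Va: "V r \<alpha> = w r" if "r \<in> R" for r using \<sigma>[OF that] K by (simp add: V_def)
  have deg: "card {r\<in>R. V r = v} \<le> local_degree K v" if "v \<in> V ` R" for v
  proof (rule card_embeddings_le_local_degree[OF _ B K(2) KQ w(1), where \<sigma> = \<sigma>])
    show "absval K v" using that VP K(1) by unfold_locales (auto simp: places_over_def)
    show "w (\<sigma> r x) = v x" if "r \<in> {r\<in>R. V r = v}" "x \<in> K" for r x
      using that by (auto simp: V_def)
  qed (use R \<sigma> in auto)
  have "(\<Sum>r\<in>R. ln (max 1 (w r))) = (\<Sum>v\<in>V ` R. \<Sum>r\<in>{r\<in>R. V r = v}. ln (max 1 (w r)))"
    by (rule sum.image_gen[OF R(1)])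
  also have "\<dots> = (\<Sum>v\<in>V ` R. real (card {r\<in>R. V r = v}) * ln (max 1 (v \<alpha>)))"
    by (intro sum.cong refl) (auto simp flip: Va)
  also have "\<dots> \<le> (\<Sum>v\<in>V ` R. real (local_degree K v) * ln (max 1 (v \<alpha>)))"
    using deg by (intro sum_mono mult_right_mono) auto
  finally show ?thesis using R VP by (intro exI[of _ "V ` R"]) auto
qed

text \<open>Terms with v \<alpha> \<le> 1 vanish, so the infinite sum is a finite one. Its terms are
  nonnegative, so any finite set of places gives a lower bound, and the degree of \<open>K\<close>
  is at most that of \<open>m\<close>.\<close>

lemma sum_places_le_weil_height:
  assumes m: "is_minpoly m (\<alpha>::complex)"
  defines "K \<equiv> is_subfield hull {\<alpha>}"
  assumes P: "finite P" "P \<subseteq> places K"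
  shows "(\<Sum>v\<in>P. real (local_degree K v) * ln (max 1 (v \<alpha>))) \<le> real (degree m) * weil_height \<alpha>"
proof -
  obtain B where B: "finite B" "B \<subseteq> K" "K \<subseteq> ratvs.span B" "card B \<le> degree m"
    using simple_extension_basis[OF m] unfolding K_def by metis
  have K: "is_subfield K" unfolding K_def by (rule is_subfield_hull)
  have e: "extension_degree \<rat> K > 0" "extension_degree \<rat> K \<le> degree m"
    using extension_degree_bounds[OF B(1-3)] B(4) K by (auto simp: is_subfield_def)
  define e where "e = real (extension_degree \<rat> K)"
  define f where "f = (\<lambda>v. real (local_degree K v) / e * ln (max 1 (v \<alpha>)))"
  define S where "S = {v \<in> places K. v \<alpha> > 1}"
  have S: "finite S" unfolding S_def K_def by (rule finite_places_gt_1[OF m])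
  have f0: "f v \<ge> 0" for v using e by (simp add: f_def e_def)
  have "weil_height \<alpha> = infsum f (places K)" by (simp add: weil_height_def K_def f_def e_def Let_def)
  also have "\<dots> = infsum f S" by (rule infsum_cong_neutral) (auto simp: S_def f_def max_def not_less)
  also have "\<dots> = sum f S" using S by simp
  finally have h: "weil_height \<alpha> = sum f S" .
  have "sum f P = sum f (P \<inter> S)"
    using P by (intro sum.mono_neutral_right) (auto simp: S_def f_def max_def not_less)
  also have "\<dots> \<le> sum f S" using S f0 by (intro sum_mono2) auto
  finally have fP: "sum f P \<le> weil_height \<alpha>" using h by simp
  have "(\<Sum>v\<in>P. real (local_degree K v) * ln (max 1 (v \<alpha>))) = e * sum f P"
    using e by (simp add: f_def e_def sum_distrib_left)
  also have "\<dots> \<le> real (degree m) * weil_height \<alpha>"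
    using e fP f0 by (intro mult_mono) (auto simp: e_def intro!: sum_nonneg)
  finally show ?thesis .
qed

text \<open>The left-hand side is the logarithm of the Mahler measure of \<open>m\<close>.\<close>

theorem weil_height_ge_mahler:
  assumes m: "is_minpoly m (\<alpha>::complex)"
  defines "R \<equiv> conjugates m"
  shows "ln \<bar>real_of_int (lead_coeff m)\<bar> + (\<Sum>r\<in>R. ln (max 1 (cmod r))) \<le> real (degree m) * weil_height \<alpha>"
proof -
  define K where "K = is_subfield hull {\<alpha>}"
  define a where "a = lead_coeff m"
  have a0: "a \<noteq> 0" using is_minpoly_nonzero[OF m] by (simp add: a_def)
  have R: "finite R" using minpoly_splits[OF m] by (simp add: R_def)
  have K: "is_subfield K" unfolding K_def by (rule is_subfield_hull)
  let ?F = "\<lambda>v. real (local_degree K v) * ln (max 1 (v \<alpha>))"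
  define PF where "PF = prime_factors (nat \<bar>a\<bar>)"
  \<comment> \<open>The index 0, which is not a prime, stands for the usual absolute value, so that
    all contributions are indexed by one finite set.\<close>
  define u where "u = (\<lambda>p. if p = 0 then (\<lambda>r. \<bar>real_of_rat r\<bar>) else padic_abs p)"
  define c where "c = (\<lambda>p. if p = 0 then \<Sum>r\<in>R. ln (max 1 (cmod r)) else - ln (padic_abs p (of_int a)))"
  have prime: "prime p" if "p \<in> PF" for p using that by (auto simp: PF_def)
  then have nz: "0 \<notin> PF" by force
  have "\<exists>P. finite P \<and> P \<subseteq> places_over K (u p) \<and> c p \<le> sum ?F P" if p: "p \<in> insert 0 PF" for p
  proof (cases "p = 0")
    case True
    then show ?thesis
      using sum_conjugates_le_sum_places[OF m absval_cmod, of "\<lambda>r. \<bar>real_of_rat r\<bar>"]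
      by (simp add: u_def c_def K_def R_def cmod_of_rat)
  next
    case False
    then have pr: "prime p" using p prime by auto
    obtain w where w: "nonarch Qbar w" "\<And>r. w (of_rat r) = padic_abs p r"
      using exists_padic_extension[OF pr] by metis
    interpret W: nonarch Qbar w by fact
    have wa: "w (of_int a) > 0" using a0 by (intro W.v_pos) auto
    have pr0: "(\<Prod>r\<in>R. max 1 (w r)) > 0" by (intro prod_pos) (auto simp: less_max_iff_disj)
    have "w (of_int a) * (\<Prod>r\<in>R. max 1 (w r)) = 1"
      unfolding a_def R_def by (rule gauss_lemma_minpoly[OF m w(1) pr w(2)])
    then have "ln (w (of_int a)) + ln (\<Prod>r\<in>R. max 1 (w r)) = 0"
      using a0 wa pr0 ln_mult[of "w (of_int a)" "\<Prod>r\<in>R. max 1 (w r)"] by simp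
    also have "ln (\<Prod>r\<in>R. max 1 (w r)) = (\<Sum>r\<in>R. ln (max 1 (w r)))"
      using R by (intro ln_prod) (auto simp: max_def)
    finally have "c p = (\<Sum>r\<in>R. ln (max 1 (w r)))" using w(2)[of "of_int a"] False by (simp add: c_def)
    then show ?thesis
      using sum_conjugates_le_sum_places[OF m W.absval_axioms, of "padic_abs p"] w(2) False
      by (simp add: u_def K_def R_def)
  qed
  then have "\<forall>p\<in>insert 0 PF. \<exists>P. finite P \<and> P \<subseteq> places_over K (u p) \<and> c p \<le> sum ?F P"
    by (rule ballI)
  from bchoice[OF this] obtain P where
    "\<forall>p\<in>insert 0 PF. finite (P p) \<and> P p \<subseteq> places_over K (u p) \<and> c p \<le> sum ?F (P p)" ..
  then have P: "\<And>p. p \<in> insert 0 PF \<Longrightarrow> finite (P p)"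
    "\<And>p. p \<in> insert 0 PF \<Longrightarrow> P p \<subseteq> places_over K (u p)"
    "\<And>p. p \<in> insert 0 PF \<Longrightarrow> c p \<le> sum ?F (P p)" by auto
  \<comment> \<open>The rational number p tells the families apart: its value is below 1 at the
    places over p and at least 1 at those over any other index.\<close>
  have dis: "P p \<inter> P q = {}" if p: "p \<in> PF" and q: "q \<in> insert 0 PF" "p \<noteq> q" for p q
  proof -
    have "u p (of_nat p) < 1"
      using padic_abs_prime[OF prime[OF p]] prime_gt_1_nat[OF prime[OF p]] nz p by (auto simp: u_def)
    moreover have "u q (of_nat p) \<ge> 1"
    proof (cases "q = 0")
      case True
      then show ?thesis using prime_gt_1_nat[OF prime[OF p]] by (simp add: u_def)
    next
      case False
      then have "prime q" using q prime by auto
      moreover from this have "\<not> int q dvd int p" using prime[OF p] q by (auto dest: primes_dvd_imp_eq)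
      ultimately show ?thesis using padic_abs_of_int_eq_1[of q "int p"] False by (simp add: u_def)
    qed
    ultimately have "places_over K (u p) \<inter> places_over K (u q) = {}"
      unfolding places_over_def by fastforce
    then show ?thesis using Int_mono[OF P(2) P(2), of p q] p q by auto
  qed
  have fin: "finite (insert 0 PF)" by (simp add: PF_def)
  have "ln \<bar>real_of_int a\<bar> = (\<Sum>p\<in>PF. c p)"
    unfolding PF_def ln_abs_int_eq_sum_padic[OF a0] using nz
    by (intro sum.cong refl) (auto simp: c_def PF_def)
  then have "ln \<bar>real_of_int a\<bar> + (\<Sum>r\<in>R. ln (max 1 (cmod r))) = (\<Sum>p\<in>insert 0 PF. c p)"
    using nz fin by (simp add: c_def)
  also have "\<dots> \<le> (\<Sum>p\<in>insert 0 PF. sum ?F (P p))" by (intro sum_mono P(3))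
  also have "\<dots> = sum ?F (\<Union>p\<in>insert 0 PF. P p)"
  proof (rule sum.UNION_disjoint[symmetric, OF fin])
    show "\<forall>p\<in>insert 0 PF. \<forall>q\<in>insert 0 PF. p \<noteq> q \<longrightarrow> P p \<inter> P q = {}"
      using dis by (metis Int_commute insert_iff)
  qed (use P in blast)
  also have "\<dots> \<le> real (degree m) * weil_height \<alpha>"
    unfolding K_def
  proof (rule sum_places_le_weil_height[OF m])
    have "places_over K (u p) \<subseteq> places K" if "p \<in> insert 0 PF" for p
      using that prime unfolding places_eq u_def by auto
    then show "(\<Union>p\<in>insert 0 PF. P p) \<subseteq> places (is_subfield hull {\<alpha>})"
      unfolding K_def[symmetric] using P(2) by (intro UN_least) (metis order_trans)
  qed (use fin P in blast)
  finally show ?thesis by (simp add: a_def)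
qed

section \<open>Powers in finite extensions of the \<open>p\<close>-adic numbers\<close>

locale padic_absval = nonarch UNIV v for v :: "'k::{field_char_0,complete_space} \<Rightarrow> real" +
  fixes p :: nat
  assumes prime: "prime p" and v_rat: "v (of_rat r) = padic_abs p r" and dist_v: "dist x y = v (x - y)"
begin

lemma v_int: "v (of_int n) = padic_abs p (of_int n)"
  using v_rat[of "of_int n"] by simp

lemma p_gt_1: "real p > 1"
  using prime_gt_1_nat[OF prime] by simp

lemma v_p_power: "v (of_nat p ^ N) = 1 / real p ^ N"
  using v_rat[of "of_nat p"] padic_abs_prime[OF prime] by (simp add: v_power power_divide)

lemma v_le_if_dvd:
  assumes "int p ^ N dvd n"
  shows "v (of_int n) \<le> 1 / real p ^ N"
proof -
  obtain k where "n = int p ^ N * k" using assms by auto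
  then have "v (of_int n) = (1 / real p ^ N) * v (of_int k)" by (simp add: v_mult v_p_power)
  also have "\<dots> \<le> (1 / real p ^ N) * 1"
    using padic_abs_of_int_le_1[OF prime, of k] p_gt_1 by (intro mult_left_mono) (auto simp: v_int)
  finally show ?thesis by simp
qed

text \<open>The reduced denominator is prime to p, hence invertible modulo p^N, and \<open>n\<close>
  is the residue of the fraction modulo p^N.\<close>

lemma rat_approx_by_nat:
  assumes "v (of_rat r) \<le> 1"
  obtains n where "n < p ^ N" "v (of_rat r - of_nat n) \<le> 1 / real p ^ N"
proof -
  obtain a b where ab: "quotient_of r = (a, b)" by (cases "quotient_of r")
  have b: "b > 0" "r = of_int a / of_int b" "coprime a b"
    using ab quotient_of_denom_pos quotient_of_div quotient_of_coprime by auto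
  have pb: "\<not> int p dvd b"
  proof
    assume dvd: "int p dvd b"
    have "\<not> is_unit (int p)" using prime_gt_1_nat[OF prime] by simp
    then have "\<not> int p dvd a" using b(3) dvd by (meson coprime_common_divisor)
    then have "v (of_int a) = 1" using padic_abs_of_int_eq_1[OF prime] by (simp add: v_int)
    moreover have "v (of_rat r) = v (of_int a) / v (of_int b)" using b by (simp add: of_rat_divide v_divide)
    moreover have "v (of_int b) > 0" using b by (intro v_pos) auto
    ultimately have "1 \<le> v (of_int b)" using assms by (simp add: divide_le_eq)
    also have "\<dots> \<le> 1 / real p" using v_le_if_dvd[of 1 b] dvd by simp
    also have "\<dots> < 1" using p_gt_1 by simp
    finally show False by simp
  qed
  have vb: "v (of_int b) = 1" using padic_abs_of_int_eq_1[OF prime pb] by (simp add: v_int)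
  have "coprime (int p ^ N) b" using pb prime by (simp add: prime_imp_coprime)
  then obtain s t where st: "s * int p ^ N + t * b = 1" by (metis bezout_int coprime_iff_gcd_eq_1)
  define n where "n = nat ((a * t) mod (int p ^ N))"
  have pN: "int p ^ N > 0" using prime_gt_0_nat[OF prime] by simp
  have n: "int n = (a * t) mod (int p ^ N)" using pN by (simp add: n_def)
  show ?thesis
  proof
    have "int n < int p ^ N" unfolding n using pN by simp
    then show "n < p ^ N" by (metis of_nat_less_iff of_nat_power)
    have "int p ^ N dvd a * t - int n" unfolding n by (simp add: mod_eq_dvd_iff[symmetric])
    then have "int p ^ N dvd (a * t - int n) * b + a * s * int p ^ N" by (intro dvd_add) auto
    also have "(a * t - int n) * b + a * s * int p ^ N = a * (s * int p ^ N + t * b) - int n * b"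
      by (simp add: algebra_simps)
    finally have "int p ^ N dvd a - int n * b" unfolding st by simp
    then have "v (of_int (a - int n * b)) \<le> 1 / real p ^ N" by (rule v_le_if_dvd)
    moreover have "of_rat r = (of_int a / of_int b :: 'k)" using b(2) by (simp add: of_rat_divide)
    then have "of_int (a - int n * b) = (of_rat r - of_nat n) * (of_int b :: 'k)"
      using b(1) by (simp add: field_simps)
    ultimately show "v (of_rat r - of_nat n) \<le> 1 / real p ^ N" by (simp add: v_mult vb)
  qed
qed

section \<open>Total boundedness of the unit ball and small values of x^M (x^N - 1)\<close>

lemma finite_extension_approximable:
  assumes "finite_extension padic_field L"
  obtains S where "finite S" "norm_indep S" "L \<subseteq> approximable S"
proof -
  obtain B where B: "finite B" "spans_over padic_field B L"
    using assms by (auto simp: finite_extension_def)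
  obtain S where S: "S \<subseteq> B" "norm_indep S" "B \<subseteq> approximable S"
    using exists_norm_indep_dense_subset[OF B(1)] by auto
  have mult: "c * b \<in> approximable S" if c: "c \<in> padic_field" and b: "b \<in> approximable S" for b c
  proof (rule approximable_closed)
    fix e :: real assume e: "e > 0"
    have pos: "v b + 1 > 0" using v_nonneg[OF UNIV_I, of b] by linarith
    then have "e / (v b + 1) > 0" using e by simp
    then obtain y where y: "y \<in> \<rat>" "dist y c < e / (v b + 1)" using c unfolding closure_approachable by blast
    then obtain r where r: "y = of_rat r" by (auto elim: Rats_cases)
    have "v (c * b - of_rat r * b) = dist y c * v b"
      using v_mult[of "c - y" b] v_minus_commute[of c y] by (simp add: r dist_v left_diff_distrib)
    also have "\<dots> \<le> e / (v b + 1) * v b" using y by (intro mult_right_mono) auto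
    also have "\<dots> < e" using e pos by (simp add: field_simps)
    finally show "\<exists>y\<in>approximable S. v (c * b - y) < e" using b by (intro bexI[of _ "of_rat r * b"] approximable_scale) auto
  qed auto
  have "L \<subseteq> approximable S"
  proof
    fix x assume "x \<in> L"
    then obtain c where "\<forall>b\<in>B. c b \<in> padic_field" "x = (\<Sum>b\<in>B. c b * b)"
      using B(2) by (auto simp: spans_over_def)
    then show "x \<in> approximable S" using S(3) by (auto intro!: approximable_sum mult)
  qed
  then show ?thesis using that S B finite_subset by blast
qed

text \<open>Norm independence bounds the rational coefficients of approximations to points of the
  unit ball by 1/c, hence by p^k. Multiplied by p^k they are p-integral and close to one of finitely
  many natural numbers.\<close>

lemma finite_net:
  assumes L: "finite_extension padic_field L" and \<delta>: "0 < \<delta>" "\<delta> \<le> 1"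
  obtains Y where "finite Y" "\<And>x. x \<in> L \<Longrightarrow> v x \<le> 1 \<Longrightarrow> \<exists>y\<in>Y. v (x - y) \<le> \<delta>"
proof -
  obtain S where S: "finite S" "norm_indep S" "L \<subseteq> approximable S"
    using finite_extension_approximable[OF L] .
  obtain c where c: "c > 0" "\<And>q s. s \<in> S \<Longrightarrow> c * v (of_rat (q s)) \<le> v (rcomb S q)"
    using S(2) by (auto simp: norm_indep_def)
  obtain k where k: "1 / c < real p ^ k" using real_arch_pow[OF p_gt_1] by blast
  define D where "D = (\<Sum>s\<in>S. v s)"
  have D: "v s \<le> D" if "s \<in> S" for s unfolding D_def using that S(1) by (intro member_le_sum) auto
  have D0: "D \<ge> 0" unfolding D_def by (intro sum_nonneg) auto
  obtain J where J: "D / \<delta> < real p ^ J" using real_arch_pow[OF p_gt_1] by blast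
  \<comment> \<open>\<open>J\<close> makes the spanning elements, of size at most \<open>D\<close>,
    harmless relative to \<delta>; \<open>k\<close> compensates the division by p^k.\<close>
  define N where "N = J + k"
  define Y where "Y = (\<lambda>n. \<Sum>s\<in>S. of_nat (n s) / of_nat p ^ k * s) ` (S \<rightarrow>\<^sub>E {..<p ^ N})"
  show ?thesis
  proof
    show "finite Y" unfolding Y_def using S(1) by (intro finite_imageI finite_PiE) auto
    fix x assume x: "x \<in> L" "v x \<le> 1"
    then obtain q where q: "v (x - rcomb S q) < \<delta>" using S(3) \<delta> approximableD by blast
    have "v (rcomb S q) \<le> max (v x) (v (x - rcomb S q))"
      using ultra[of x "- (x - rcomb S q)"] by (simp add: v_minus_commute[of "rcomb S q" x])
    then have vr: "v (rcomb S q) \<le> 1" using x q \<delta> by linarith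
    have le1: "v (of_rat (q s * of_nat p ^ k)) \<le> 1" if s: "s \<in> S" for s
    proof -
      have "v (of_rat (q s)) \<le> 1 / c" using order_trans[OF c(2)[OF s] vr] c(1) by (simp add: field_simps)
      also have "\<dots> \<le> real p ^ k" using k by simp
      finally have "v (of_rat (q s)) \<le> real p ^ k" .
      then show ?thesis using p_gt_1 by (simp add: of_rat_mult of_rat_power v_mult v_p_power)
    qed
    have "\<forall>s\<in>S. \<exists>n. n < p ^ N \<and> v (of_rat (q s * of_nat p ^ k) - of_nat n) \<le> 1 / real p ^ N"
      using rat_approx_by_nat[OF le1] by metis
    then obtain n where n: "\<And>s. s \<in> S \<Longrightarrow> n s < p ^ N"
      "\<And>s. s \<in> S \<Longrightarrow> v (of_rat (q s * of_nat p ^ k) - of_nat (n s)) \<le> 1 / real p ^ N" by metis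
    define y where "y = (\<Sum>s\<in>S. of_nat (restrict n S s) / of_nat p ^ k * s)"
    have "restrict n S \<in> S \<rightarrow>\<^sub>E {..<p ^ N}" using n(1) by (simp add: restrict_PiE_iff)
    then have y: "y \<in> Y" unfolding y_def Y_def by (rule image_eqI[OF refl])
    have p0: "(of_nat p :: 'k) ^ k \<noteq> 0" using prime by auto
    have "rcomb S q - y = (\<Sum>s\<in>S. (of_rat (q s * of_nat p ^ k) - of_nat (n s)) / of_nat p ^ k * s)"
      unfolding y_def rcomb_def sum_subtractf[symmetric]
      using p0 by (intro sum.cong refl) (simp add: field_simps of_rat_mult of_rat_power)
    also have "v \<dots> \<le> \<delta>"
    proof (rule ultra_sum)
      fix s assume s: "s \<in> S"
      have "v ((of_rat (q s * of_nat p ^ k) - of_nat (n s)) / of_nat p ^ k * s)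
          = v (of_rat (q s * of_nat p ^ k) - of_nat (n s)) * real p ^ k * v s"
        by (simp add: v_mult v_divide v_p_power)
      also have "\<dots> \<le> 1 / real p ^ N * real p ^ k * D"
        using n(2)[OF s] D[OF s] D0 by (intro mult_mono) auto
      also have "\<dots> = D / real p ^ J" using p_gt_1 by (simp add: N_def power_add)
      also have "\<dots> \<le> \<delta>" using J \<delta> p_gt_1 by (simp add: field_simps)
      finally show "v ((of_rat (q s * of_nat p ^ k) - of_nat (n s)) / of_nat p ^ k * s) \<le> \<delta>" .
    qed (use \<delta> in auto)
    finally have "v (rcomb S q - y) \<le> \<delta>" .
    then have "v ((x - rcomb S q) + (rcomb S q - y)) \<le> \<delta>"
      using ultra[of "x - rcomb S q" "rcomb S q - y"] q by (simp del: add_diff_eq diff_add_cancel)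
    then show "\<exists>y\<in>Y. v (x - y) \<le> \<delta>" using y by auto
  qed
qed

text \<open>
  Among the first powers of \<open>x\<close> two are \<open>\<delta>\<close>-close by the pigeonhole principle; the exponents
  \<open>M\<close> and \<open>N\<close> serve all \<open>x\<close> at once.
\<close>

lemma power_times_power_minus_1_small:
  assumes L: "finite_extension padic_field L" and \<delta>: "0 < \<delta>" "\<delta> \<le> 1"
  obtains M N where "M > 0" "N > 0"
    "\<And>x. x \<in> L \<Longrightarrow> v (x ^ M * (x ^ N - 1)) \<le> \<delta> * max 1 (v x) ^ (2 * M + N)"
proof -
  have sub: "is_subfield L" using L by (auto simp: finite_extension_def)
  interpret L: subfld L using sub by unfold_locales
  obtain Y where Y: "finite Y" "\<And>x. x \<in> L \<Longrightarrow> v x \<le> 1 \<Longrightarrow> \<exists>y\<in>Y. v (x - y) \<le> \<delta>"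
    using finite_net[OF L \<delta>] by metis
  \<comment> \<open>There are more exponents 0, ..., M than points of \<open>Y\<close>, so two
    powers share a net point. The factorial is divisible by every difference of two distinct such
    exponents, so one \<open>N\<close> serves whichever pair collides.\<close>
  define M where "M = Suc (card Y)"
  define N where "N = (fact M :: nat)"
  have small: "v (x ^ M * (x ^ N - 1)) \<le> \<delta>" if x: "x \<in> L" "v x \<le> 1" for x
  proof -
    have "\<forall>i. \<exists>y\<in>Y. v (x ^ i - y) \<le> \<delta>"
      using x by (intro allI Y(2)) (auto simp: v_power power_le_one)
    then obtain y where y: "\<And>i. y i \<in> Y" "\<And>i. v (x ^ i - y i) \<le> \<delta>" by metis
    have "\<not> inj_on y {..M}"
    proof
      assume "inj_on y {..M}"
      then have "card {..M} \<le> card Y" using y(1) Y(1) by (intro card_inj_on_le[of y]) auto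
      then show False by (simp add: M_def)
    qed
    then obtain i j where ij: "i < j" "j \<le> M" "y i = y j"
      unfolding inj_on_def by (metis atMost_iff linorder_neqE_nat)
    have "v ((x ^ j - y j) + - (x ^ i - y i)) \<le> max (v (x ^ j - y j)) (v (- (x ^ i - y i)))"
      by (intro ultra) auto
    then have vij: "v (x ^ j - x ^ i) \<le> \<delta>" using y(2)[of i] y(2)[of j] ij(3) by (simp add: v_minus_commute)
    define t where "t = j - i"
    have "t dvd N" unfolding N_def t_def using ij by (intro dvd_fact) auto
    then obtain e where e: "N = t * e" by auto
    have "x ^ N - 1 = (x ^ t - 1) * (\<Sum>l<e. (x ^ t) ^ l)"
      unfolding e power_mult by (rule power_diff_1_eq)
    then have "x ^ M * (x ^ N - 1) = x ^ (M - i) * (x ^ i * (x ^ t - 1)) * (\<Sum>l<e. (x ^ t) ^ l)"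
      using ij by (simp add: mult.assoc[symmetric] flip: power_add)
    also have "x ^ i * (x ^ t - 1) = x ^ j - x ^ i"
      using ij by (simp add: t_def right_diff_distrib flip: power_add)
    also have "v (x ^ (M - i) * (x ^ j - x ^ i) * (\<Sum>l<e. (x ^ t) ^ l)) \<le> 1 * \<delta> * 1"
    proof -
      have "v (\<Sum>l<e. (x ^ t) ^ l) \<le> 1" using x by (intro ultra_sum) (auto simp: v_power power_le_one)
      then show ?thesis unfolding v_mult[OF UNIV_I UNIV_I] v_power[OF UNIV_I]
        using vij x \<delta> by (intro mult_mono power_le_one) auto
    qed
    finally show ?thesis by simp
  qed
  show ?thesis
  proof
    show "M > 0" "N > 0" by (auto simp: M_def N_def)
    fix x assume x: "x \<in> L"
    show "v (x ^ M * (x ^ N - 1)) \<le> \<delta> * max 1 (v x) ^ (2 * M + N)"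
    proof (cases "v x \<le> 1")
      case True
      then show ?thesis using small[OF x] by simp
    next
      case False
      then have x0: "x \<noteq> 0" by auto
      define z where "z = inverse x"
      \<comment> \<open>The reflection x -> 1/x moves x into the unit ball and produces the exponent
        2 M + N.\<close>
      have "x ^ M * (x ^ N - 1) = - (x ^ (2 * M + N) * (z ^ M * (z ^ N - 1)))"
      proof -
        have "X * (W - 1) = - (X * X * W * (inverse X * (inverse W - 1)))" if "X \<noteq> 0" "W \<noteq> 0" for X W :: 'k
          using that by (simp add: field_simps)
        from this[of "x ^ M" "x ^ N"] show ?thesis
          using x0 by (simp add: z_def power_add power_inverse mult_2)
      qed
      then have "v (x ^ M * (x ^ N - 1)) = v x ^ (2 * M + N) * v (z ^ M * (z ^ N - 1))"
        by (simp add: v_mult v_power)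
      also have "\<dots> \<le> v x ^ (2 * M + N) * \<delta>"
        using x False by (intro mult_left_mono small) (auto simp: z_def v_inverse inverse_le_1_iff)
      finally show ?thesis using False by (simp add: mult.commute max_def)
    qed
  qed
qed

end

section \<open>Roots of polynomials with algebraic coefficients in the p-adic complex
  numbers\<close>

lemma is_CpE:
  assumes "prime p" "is_Cp p TYPE('k::{field_char_0,complete_space})"
  obtains v :: "'k::{field_char_0,complete_space} \<Rightarrow> real" where "padic_absval v p"
proof -
  obtain v :: "'k \<Rightarrow> real" where v: "abs_value_on UNIV v" "\<forall>x y. dist x y = v (x - y)"
    "\<forall>r. v (of_rat r) = padic_abs p r"
    using assms(2) by (auto simp: is_Cp_def)
  interpret absval UNIV v using v by unfold_locales (auto simp: is_subfield_def)
  have "v (of_nat n) \<le> 1" for n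
    using v(3)[rule_format, of "of_nat n"] padic_abs_of_int_le_1[OF assms(1), of "int n"] by simp
  then have "padic_absval v p"
    using ultrametric_if_bounded_on_nat v assms(1) by unfold_locales auto
  then show ?thesis by (rule that)
qed

text \<open>Roots in \<open>A\<close> are split off one at a time. The quotient keeps its
  coefficients in \<open>A\<close>, by recursion from the leading coefficient downwards.\<close>

lemma root_in_algebraically_closed:
  fixes A :: "'k::field_char_0 set"
  assumes A: "is_subfield A" and closed: "\<And>f. degree f > 0 \<Longrightarrow> (\<And>i. coeff f i \<in> A) \<Longrightarrow> \<exists>x\<in>A. poly f x = 0"
    and f: "f \<noteq> 0" "\<And>i. coeff f i \<in> A" "poly f y = 0"
  shows "y \<in> A"
  using f
proof (induction "degree f" arbitrary: f rule: less_induct)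
  case less
  interpret subfld A using A by unfold_locales
  have "degree f > 0"
  proof (rule ccontr)
    assume "\<not> degree f > 0"
    then obtain c where "f = [:c:]" using degree_eq_zeroE by blast
    then show False using less.prems by auto
  qed
  then obtain x where x: "x \<in> A" "poly f x = 0" using closed less.prems by blast
  then obtain g where g: "f = [:- x, 1:] * g" by (auto simp: poly_eq_0_iff_dvd)
  have g0: "g \<noteq> 0" using g less.prems by auto
  have deg: "degree g < degree f" unfolding g using g0 by (subst degree_mult_eq) auto
  have "coeff g i \<in> A" for i
  proof (induction "Suc (degree g) - i" arbitrary: i rule: less_induct)
    case (less i)
    show ?case
    proof (cases "i \<le> degree g")
      case True
      have "coeff g i = coeff f (Suc i) + x * coeff g (Suc i)" by (simp add: g)
      moreover have "coeff g (Suc i) \<in> A" using less True by auto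
      ultimately show ?thesis using \<open>\<And>i. coeff f i \<in> A\<close> x by auto
    qed (simp add: coeff_eq_0)
  qed
  moreover have "y = x \<or> poly g y = 0" using less.prems(3) unfolding g by auto
  ultimately show ?case using less.hyps[OF deg g0] x by auto
qed

text \<open>Algebraic closedness is given for a dense subfield \<open>A\<close> of
  \<open>'k\<close>. Everything algebraic over the rationals lies in \<open>A\<close>, which settles
  polynomials with such coefficients.\<close>

lemma is_Cp_root_closed:
  fixes f :: "'k::{field_char_0,complete_space} poly"
  assumes Cp: "is_Cp p TYPE('k)" and f: "degree f > 0" "\<And>i. algebraic (coeff f i)"
  shows "\<exists>y. poly f y = 0"
proof -
  obtain A :: "'k set" where A: "is_subfield A"
    "\<And>f. degree f > 0 \<Longrightarrow> (\<And>i. coeff f i \<in> A) \<Longrightarrow> \<exists>x\<in>A. poly f x = 0"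
    using Cp unfolding is_Cp_def is_algebraic_closure_def by blast
  interpret subfld A using A by unfold_locales
  have "x \<in> A" if x: "algebraic x" for x
  proof -
    obtain m where m: "m \<noteq> 0" "poly (map_poly of_int m) x = 0" using x by (auto elim: algebraicE')
    show ?thesis
    proof (rule root_in_algebraically_closed[OF A(1)])
      show "\<exists>x\<in>A. poly f x = 0" if "degree f > 0" "\<And>i. coeff f i \<in> A" for f
        using that by (rule A(2))
      show "map_poly of_int m \<noteq> (0 :: 'k poly)" using m(1) by (simp add: map_poly_eq_0_iff)
      show "coeff (map_poly of_int m) i \<in> A" for i by (simp add: coeff_map_poly)
      show "poly (map_poly of_int m) x = 0" by (rule m(2))
    qed
  qed
  then show ?thesis using A(2)[OF f(1)] f(2) by blast
qed

section \<open>The auxiliary norm\<close>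

text \<open>Every conjugate of \<open>x\<close> is its image under some embedding, so
  \<open>x\<close> is the only one and its minimal polynomial is linear.\<close>

lemma rational_if_fixed:
  assumes x: "x \<in> Qbar"
    and fixed: "\<And>\<sigma>::complex \<Rightarrow> complex. field_embedding_on Qbar \<sigma> \<Longrightarrow> \<sigma> x = x"
  shows "x \<in> \<rat>"
proof -
  obtain m where m: "is_minpoly m x" using exists_minpoly x by (auto simp: Qbar_def)
  have uniq: "r = x" if r: "r \<in> conjugates m" for r
  proof -
    obtain \<sigma> :: "complex \<Rightarrow> complex" where \<sigma>: "field_embedding_on Qbar \<sigma>" "\<sigma> x = r"
      using embedding_extension[OF m _ complex_root_closed] r unfolding conjugates_iff by blast
    show ?thesis using fixed[OF \<sigma>(1)] \<sigma>(2) by simp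
  qed
  have "conjugates m = {x}" using minpoly_splits(3)[OF m] by (blast dest: uniq)
  then have eq: "map_poly of_int m = smult (of_int (lead_coeff m)) [:- x, 1:]"
    using minpoly_splits(5)[OF m] by simp
  have "of_int (coeff m 0) = - (of_int (lead_coeff m) * x)"
    using arg_cong[OF eq, of "\<lambda>f. coeff f 0"] by (simp add: coeff_map_poly)
  then have "x = - (of_int (coeff m 0) / of_int (lead_coeff m))"
    using is_minpoly_nonzero[OF m] by (simp add: field_simps)
  then show ?thesis by (metis Rats_divide Rats_minus_iff Rats_of_int)
qed

text \<open>The condition M + N \<le> D lets the power of the leading coefficient absorb the
  denominators: at every prime the polynomial x^M (x^N - 1) is bounded by max(1, |x|)^(M +
  N).\<close>

lemma auxiliary_norm_integer:
  assumes m: "is_minpoly m (\<alpha>::complex)"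
    and D: "M + N \<le> D" and nz: "\<alpha> ^ M * (\<alpha> ^ N - 1) \<noteq> 0"
  defines "R \<equiv> conjugates m"
  obtains n where "n \<noteq> 0" "of_int n = of_int (lead_coeff m) ^ D * (\<Prod>r\<in>R. r ^ M * (r ^ N - 1))"
proof -
  interpret Q: subfld Qbar using is_subfield_Qbar by unfold_locales
  define a where "a = lead_coeff m"
  have a0: "a \<noteq> 0" using is_minpoly_nonzero[OF m] by (simp add: a_def)
  have R: "finite R" "R \<subseteq> Qbar" using minpoly_splits[OF m] by (auto simp: R_def)
  define F where "F = (\<lambda>x::complex. x ^ M * (x ^ N - 1))"
  define \<rho> where "\<rho> = of_int a ^ D * (\<Prod>r\<in>R. F r)"
  have FQ: "F x \<in> Qbar" if "x \<in> Qbar" for x using that by (auto simp: F_def)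
  have \<rho>Q: "\<rho> \<in> Qbar" unfolding \<rho>_def using R FQ by (intro Q.K_closed(4) Q.K_prod) auto
  have "\<rho> \<in> \<rat>"
  proof (rule rational_if_fixed[OF \<rho>Q])
    fix \<sigma> :: "complex \<Rightarrow> complex" assume "field_embedding_on Qbar \<sigma>"
    then interpret S: embedding Qbar \<sigma> by unfold_locales
    have "\<sigma> r \<in> R" if r: "r \<in> R" for r
    proof -
      have "rpoly (map_poly of_int m) (\<sigma> r) = \<sigma> (rpoly (map_poly of_int m) r)"
        using r R by (intro S.\<sigma>_rpoly[symmetric]) auto
      then show ?thesis using r by (simp add: R_def conjugates_iff)
    qed
    moreover have "inj_on \<sigma> R" using S.\<sigma>_inj R by (meson inj_on_subset)
    ultimately have bij: "bij_betw \<sigma> R R" using R(1) by (intro bij_betw_imageI endo_inj_surj) auto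
    have F\<sigma>: "\<sigma> (F x) = F (\<sigma> x)" if "x \<in> Qbar" for x
      unfolding F_def using that by (simp add: S.\<sigma>_mult S.\<sigma>_diff S.\<sigma>_power)
    have "\<sigma> \<rho> = of_int a ^ D * (\<Prod>r\<in>R. F (\<sigma> r))"
      unfolding \<rho>_def using R FQ F\<sigma>
      by (subst S.\<sigma>_mult) (auto simp: S.\<sigma>_power S.\<sigma>_prod Q.K_prod subset_iff intro!: prod.cong)
    also have "(\<Prod>r\<in>R. F (\<sigma> r)) = (\<Prod>r\<in>R. F r)" by (rule prod.reindex_bij_betw[OF bij])
    finally show "\<sigma> \<rho> = \<rho>" by (simp add: \<rho>_def)
  qed
  then obtain q where q: "\<rho> = of_rat q" by (auto elim: Rats_cases)
  have "q \<in> \<int>"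
  proof (rule Ints_if_padic_abs_le_1)
    fix p :: nat assume p: "prime p"
    obtain w where w: "nonarch Qbar w" "\<And>r. w (of_rat r) = padic_abs p r"
      using exists_padic_extension[OF p] by metis
    interpret W: nonarch Qbar w by fact
    have wF: "w (F r) \<le> max 1 (w r) ^ D" if r: "r \<in> R" for r
    proof -
      have rQ: "r \<in> Qbar" using r R by auto
      have "w (r ^ N - 1) \<le> max (w (r ^ N)) (w (- 1))" using W.ultra[of "r ^ N" "- 1"] rQ by simp
      also have "\<dots> \<le> max 1 (w r) ^ N" using rQ by (auto simp: W.v_power intro!: power_mono one_le_power)
      finally have "w (F r) \<le> max 1 (w r) ^ M * max 1 (w r) ^ N"
        using rQ by (auto simp: F_def W.v_mult W.v_power intro!: mult_mono power_mono)
      also have "\<dots> \<le> max 1 (w r) ^ D" using D by (simp flip: power_add add: power_increasing)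
      finally show ?thesis .
    qed
    have "w \<rho> = w (of_int a) ^ D * (\<Prod>r\<in>R. w (F r))"
      unfolding \<rho>_def using R FQ by (subst W.v_mult) (auto simp: W.v_power W.v_prod Q.K_prod subset_iff)
    also have "\<dots> \<le> w (of_int a) ^ D * (\<Prod>r\<in>R. max 1 (w r) ^ D)"
      using wF R FQ by (intro mult_left_mono prod_mono) auto
    also have "\<dots> = (w (of_int a) * (\<Prod>r\<in>R. max 1 (w r))) ^ D" by (simp add: power_mult_distrib prod_power_distrib)
    also have "w (of_int a) * (\<Prod>r\<in>R. max 1 (w r)) = 1"
      unfolding a_def R_def by (rule gauss_lemma_minpoly[OF m w(1) p w(2)])
    finally show "padic_abs p q \<le> 1" using w(2)[of q] q by simp
  qed
  then obtain n where n: "q = of_int n" by (auto elim: Ints_cases)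
  \<comment> \<open>If one conjugate were a zero, \<open>m\<close> would divide the polynomial and
    \<alpha> would be a zero as well.\<close>
  have "F r \<noteq> 0" if r: "r \<in> R" for r
  proof
    let ?g = "monom 1 M * (monom 1 N - 1) :: rat poly"
    assume "F r = 0"
    then have "rpoly ?g r = 0" by (simp add: F_def)
    moreover have "is_minpoly m r" using m r is_minpoly_conjugate by (auto simp: R_def conjugates_iff)
    ultimately have "map_poly of_int m dvd ?g" using rpoly_eq_0_iff_minpoly_dvd by blast
    then have "rpoly ?g \<alpha> = 0" using rpoly_eq_0_iff_minpoly_dvd[OF m] by blast
    then show False using nz by simp
  qed
  then have "\<rho> \<noteq> 0" using a0 R(1) by (simp add: \<rho>_def)
  moreover have \<rho>n: "of_int n = \<rho>" using q n by simp
  ultimately have "n \<noteq> 0" by auto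
  then show ?thesis using \<rho>n unfolding \<rho>_def F_def a_def by (rule that)
qed

section \<open>Height bounds from the auxiliary norm\<close>

lemma prod_const_times_power:
  fixes c :: real
  shows "A ^ D * (\<Prod>r\<in>R. c * f r ^ D) = c ^ card R * (A * (\<Prod>r\<in>R. f r)) ^ D"
  by (simp only: prod.distrib prod_constant power_mult_distrib prod_power_distrib mult_ac)

text \<open>Per conjugate, \<open>C\<close> is the factor incurred at the usual absolute value and
  \<open>e\<close> the saving at p. The net factor 1/2 gives 2^d \<le> (A P)^D, where A P is the
  Mahler measure. The real case has C = 1/2 and e = 1, the p-adic case C = 2 and e = 1/4.\<close>

lemma weil_height_ge_if_norm_bound:
  assumes m: "is_minpoly m (\<alpha>::complex)" and D: "D > 0"
    and n: "of_int n = of_int (lead_coeff m) ^ D * (\<Prod>r\<in>conjugates m. F r)"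
    and F: "\<And>r. r \<in> conjugates m \<Longrightarrow> cmod (F r) \<le> C * max 1 (cmod r) ^ D"
    and e: "1 \<le> \<bar>real_of_int n\<bar> * e ^ degree m" "C * e = 1 / 2" "e > 0"
  shows "ln 2 / real D \<le> weil_height \<alpha>"
proof -
  define d R where "d = degree m" and "R = conjugates m"
  have d: "d > 0" using degree_minpoly_pos[OF m] by (simp add: d_def)
  have R: "finite R" "card R = d" using minpoly_splits[OF m] by (auto simp: R_def d_def)
  define A where "A = \<bar>real_of_int (lead_coeff m)\<bar>"
  define P where "P = (\<Prod>r\<in>R. max 1 (cmod r))"
  have A: "A > 0" using is_minpoly_nonzero[OF m] by (simp add: A_def)
  have P: "P > 0" unfolding P_def by (intro prod_pos) (auto simp: less_max_iff_disj)
  have "\<bar>real_of_int n\<bar> = cmod (of_int n)" by simp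
  also have "\<dots> = A ^ D * (\<Prod>r\<in>R. cmod (F r))"
    unfolding n by (simp add: norm_mult norm_power prod_norm A_def R_def)
  also have "\<dots> \<le> A ^ D * (\<Prod>r\<in>R. C * max 1 (cmod r) ^ D)"
    using F A by (intro mult_left_mono prod_mono) (auto simp: R_def)
  also have "\<dots> = C ^ d * (A * P) ^ D" by (simp only: prod_const_times_power R P_def)
  finally have "\<bar>real_of_int n\<bar> * e ^ d \<le> C ^ d * (A * P) ^ D * e ^ d"
    using e(3) by (intro mult_right_mono) auto
  also have "\<dots> = (C * e) ^ d * (A * P) ^ D" by (simp add: power_mult_distrib mult_ac)
  finally have "1 \<le> (1 / 2) ^ d * (A * P) ^ D" using e(1,2) by (simp add: d_def)
  then have "2 ^ d \<le> (A * P) ^ D" by (simp add: power_one_over field_simps)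
  then have "ln (2 ^ d) \<le> ln ((A * P) ^ D)" using A P by (subst ln_le_cancel_iff) auto
  then have "real d * ln 2 \<le> real D * (ln A + ln P)" using A P by (simp add: ln_realpow ln_mult)
  also have "ln P = (\<Sum>r\<in>R. ln (max 1 (cmod r)))"
    unfolding P_def using R by (intro ln_prod) (auto simp: max_def)
  also have "real D * (ln A + \<dots>) \<le> real D * (real d * weil_height \<alpha>)"
    using weil_height_ge_mahler[OF m] by (intro mult_left_mono) (auto simp: A_def R_def d_def)
  finally have "real d * ln 2 \<le> real d * (real D * weil_height \<alpha>)" by (simp add: mult_ac)
  then have "ln 2 \<le> real D * weil_height \<alpha>" using d by simp
  then show ?thesis using D by (simp add: field_simps)
qed

lemma totally_minpoly:
  assumes "totally L \<alpha>"
  obtains m where "is_minpoly m \<alpha>"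
  using assms exists_minpoly by (auto simp: totally_def Qbar_def)

text \<open>Every root of \<open>m\<close> in \<open>'k\<close> is the image of \<alpha> under an
  embedding, so \<open>totally\<close> applies to it with \<alpha> as its own conjugate.\<close>

lemma root_in_totally:
  fixes L :: "'k::field_char_0 set"
  assumes tot: "totally L \<alpha>" and m: "is_minpoly m \<alpha>" and s: "rpoly (map_poly of_int m) s = 0"
    and closed: "\<And>f::'k poly. degree f > 0 \<Longrightarrow> (\<And>i. algebraic (coeff f i)) \<Longrightarrow> \<exists>y. poly f y = 0"
  shows "s \<in> L"
proof -
  obtain \<sigma> where "field_embedding_on Qbar \<sigma>" "\<sigma> \<alpha> = s" using embedding_extension[OF m s closed] by metis
  moreover have "field_automorphism Qbar id" by (auto simp: field_automorphism_def field_embedding_on_def)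
  then have "galois_conjugate \<alpha> \<alpha>" by (auto simp: galois_conjugate_def intro!: exI[of _ id])
  ultimately show ?thesis using tot by (auto simp: totally_def)
qed

lemma real_auxiliary_bound:
  fixes y :: real
  assumes "y \<ge> 0"
  shows "y * \<bar>y ^ 2 - 1\<bar> \<le> 1 / 2 * max 1 y ^ 4"
proof (cases "y \<le> 1")
  case True
  \<comment> \<open>The bound splits as y (1 - y) \<le> 1/4 times 1 + y \<le> 2.\<close>
  have "y * (1 - y) \<le> 1 / 4" using zero_le_power2[of "y - 1 / 2"] by (simp add: power2_eq_square algebra_simps)
  then have "y * (1 - y) * (1 + y) \<le> 1 / 4 * 2" using True assms by (intro mult_mono) auto
  moreover have "\<bar>y ^ 2 - 1\<bar> = 1 - y ^ 2" using True assms by (simp add: power_le_one)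
  ultimately show ?thesis using True by (simp add: power2_eq_square algebra_simps)
next
  case False
  \<comment> \<open>The difference y^4 - 2 y^3 + 2 y is rewritten so that every summand is visibly
    nonnegative for y > 1.\<close>
  have eq: "y ^ 4 - 2 * (y * (y ^ 2 - 1)) = y * ((y - 1) ^ 3 + (y - 3 / 2) ^ 2 + 3 / 4)"
    by (simp add: power2_eq_square power3_eq_cube power4_eq_xxxx algebra_simps)
  have "0 \<le> y ^ 4 - 2 * (y * (y ^ 2 - 1))" unfolding eq using False by simp
  moreover have "\<bar>y ^ 2 - 1\<bar> = y ^ 2 - 1" using False by (simp add: one_le_power)
  ultimately show ?thesis using False by simp
qed

lemma weil_height_totally_real:
  assumes tot: "totally (\<real> :: complex set) \<alpha>" and nz: "\<alpha> ^ 1 * (\<alpha> ^ 2 - 1) \<noteq> 0"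
  shows "ln 2 / real 4 \<le> weil_height \<alpha>"
proof -
  obtain m where m: "is_minpoly m \<alpha>" using totally_minpoly[OF tot] .
  obtain n where n: "n \<noteq> 0" "of_int n = of_int (lead_coeff m) ^ 4 * (\<Prod>r\<in>conjugates m. r ^ 1 * (r ^ 2 - 1))"
    using auxiliary_norm_integer[OF m _ nz, of 4] by auto
  show ?thesis
  proof (rule weil_height_ge_if_norm_bound[OF m _ n(2), of "1 / 2" 1])
    fix r assume "r \<in> conjugates m"
    then have "r \<in> \<real>"
      using root_in_totally[OF tot m] complex_root_closed by (simp add: conjugates_iff)
    then obtain x where x: "r = of_real x" by (auto elim: Reals_cases)
    have "r ^ 2 - 1 = of_real (x ^ 2 - 1)" by (simp add: x)
    then have "cmod (r ^ 2 - 1) = \<bar>\<bar>x\<bar> ^ 2 - 1\<bar>" by (simp only: norm_of_real power2_abs)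
    then show "cmod (r ^ 1 * (r ^ 2 - 1)) \<le> 1 / 2 * max 1 (cmod r) ^ 4"
      using real_auxiliary_bound[of "\<bar>x\<bar>"] by (simp add: x norm_mult)
  qed (use n(1) in auto)
qed

lemma weil_height_totally_padic:
  fixes L :: "'k::{field_char_0,complete_space} set"
  assumes p: "prime p" and Cp: "is_Cp p TYPE('k)" and L: "finite_extension padic_field L"
  obtains M N where "M > 0" "N > 0"
    "\<And>\<alpha>. totally L \<alpha> \<Longrightarrow> \<alpha> ^ M * (\<alpha> ^ N - 1) \<noteq> 0 \<Longrightarrow> ln 2 / real (2 * M + N) \<le> weil_height \<alpha>"
proof -
  obtain v :: "'k \<Rightarrow> real" where "padic_absval v p" using is_CpE[OF p Cp] .
  then interpret v: padic_absval v p .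
  \<comment> \<open>The choice \<delta> = 1/4 outweighs the factor 2 that is lost at the usual
    absolute value.\<close>
  obtain M N where MN: "M > 0" "N > 0"
    "\<And>x. x \<in> L \<Longrightarrow> v (x ^ M * (x ^ N - 1)) \<le> 1 / 4 * max 1 (v x) ^ (2 * M + N)"
    using v.power_times_power_minus_1_small[OF L, of "1 / 4"] by auto
  define D where "D = 2 * M + N"
  have "ln 2 / real D \<le> weil_height \<alpha>" if tot: "totally L \<alpha>" and nz: "\<alpha> ^ M * (\<alpha> ^ N - 1) \<noteq> 0" for \<alpha>
  proof -
    obtain m where m: "is_minpoly m \<alpha>" using totally_minpoly[OF tot] .
    define R where "R = conjugates m"
    define a where "a = lead_coeff m"
    have R: "finite R" "card R = degree m" "R \<subseteq> Qbar" using minpoly_splits[OF m] by (auto simp: R_def)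
    define F where "F = (\<lambda>x::complex. x ^ M * (x ^ N - 1))"
    obtain n where n: "n \<noteq> 0" "of_int n = of_int a ^ D * (\<Prod>r\<in>R. F r)"
      using auxiliary_norm_integer[OF m _ nz, of D] by (auto simp: R_def D_def F_def a_def)
    note closed = is_Cp_root_closed[OF Cp]
    \<comment> \<open>A root of \<open>m\<close> in \<open>'k\<close> is a target for \<alpha>, and
      this yields an embedding of all of \<open>Qbar\<close> into \<open>'k\<close>.\<close>
    have "\<exists>s::'k. rpoly (map_poly of_int m) s = 0"
      unfolding rpoly_of_int using degree_minpoly_pos[OF m]
      by (intro closed) (auto simp: degree_map_poly coeff_map_poly)
    then obtain \<sigma> :: "complex \<Rightarrow> 'k" where \<sigma>: "field_embedding_on Qbar \<sigma>"
      using embedding_extension[OF m _ closed] by metis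
    interpret S: embedding Qbar \<sigma> using \<sigma> is_subfield_Qbar by unfold_locales
    \<comment> \<open>Pulled back along \<sigma>, \<open>v\<close> becomes a p-adic absolute value
      on \<open>Qbar\<close>, to which Gauss's lemma applies.\<close>
    interpret W: absval Qbar "\<lambda>x. v (\<sigma> x)" using S.absval_pullback[OF v.absval_axioms] by simp
    interpret W: nonarch Qbar "\<lambda>x. v (\<sigma> x)"
      by unfold_locales (auto simp: S.\<sigma>_add v.ultra)
    have small: "v (\<sigma> (F r)) \<le> 1 / 4 * max 1 (v (\<sigma> r)) ^ D" if r: "r \<in> R" for r
    proof -
      have rQ: "r \<in> Qbar" using r R by auto
      have "rpoly (map_poly of_int m) (\<sigma> r) = 0"
        using r S.\<sigma>_rpoly[OF rQ, of "map_poly of_int m"] by (simp add: R_def conjugates_iff)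
      then have "\<sigma> r \<in> L" using root_in_totally[OF tot m _ closed] by blast
      then show ?thesis
        using MN(3)[of "\<sigma> r"] rQ by (simp add: F_def D_def S.\<sigma>_mult S.\<sigma>_diff S.\<sigma>_power)
    qed
    have FQ: "F r \<in> Qbar" if "r \<in> R" for r using that R by (auto simp: F_def)
    have "padic_abs p (of_int n) = v (\<sigma> (of_int n))" by (simp add: v.v_int)
    also have "\<dots> = v (\<sigma> (of_int a)) ^ D * (\<Prod>r\<in>R. v (\<sigma> (F r)))"
      unfolding n(2) using FQ by (subst W.v_mult) (auto simp: W.v_power W.v_prod S.K_prod simp del: S.\<sigma>_of_int)
    also have "\<dots> \<le> v (\<sigma> (of_int a)) ^ D * (\<Prod>r\<in>R. 1 / 4 * max 1 (v (\<sigma> r)) ^ D)"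
      using small by (intro mult_left_mono prod_mono) auto
    also have "\<dots> = (1 / 4) ^ degree m * (v (\<sigma> (of_int a)) * (\<Prod>r\<in>R. max 1 (v (\<sigma> r)))) ^ D"
      by (simp only: prod_const_times_power R)
    also have "v (\<sigma> (of_int a)) * (\<Prod>r\<in>R. max 1 (v (\<sigma> r))) = 1"
      unfolding a_def R_def
      by (rule gauss_lemma_minpoly[OF m W.nonarch_axioms p]) (simp add: v.v_rat)
    finally have pad: "padic_abs p (of_int n) \<le> (1 / 4) ^ degree m" by simp
    show ?thesis
    proof (rule weil_height_ge_if_norm_bound[OF m _ n(2)[unfolded a_def R_def], of 2 "1 / 4"])
      fix r
      let ?c = "max 1 (cmod r)"
      have "cmod (r ^ N - 1) \<le> cmod (r ^ N) + 1" using norm_triangle_ineq4[of "r ^ N" 1] by simp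
      also have "\<dots> \<le> ?c ^ N + ?c ^ N" by (intro add_mono) (auto simp: norm_power intro!: power_mono one_le_power)
      finally have "cmod (F r) \<le> ?c ^ M * (2 * ?c ^ N)"
        unfolding F_def norm_mult norm_power by (intro mult_mono power_mono) auto
      also have "\<dots> = 2 * ?c ^ (M + N)" by (simp add: power_add)
      also have "\<dots> \<le> 2 * ?c ^ D" unfolding D_def by (intro mult_left_mono power_increasing) auto
      finally show "cmod (F r) \<le> 2 * ?c ^ D" .
    next
      \<comment> \<open>The nonzero integer \<open>n\<close> satisfies |n| |n|_p \<ge> 1, so its
        p-adic smallness forces |n| \<ge> 4^d with d the degree of \<open>m\<close>.\<close>
      show "1 \<le> \<bar>real_of_int n\<bar> * (1 / 4) ^ degree m"
        using one_le_abs_times_padic_abs[OF p n(1)] mult_left_mono[OF pad, of "\<bar>real_of_int n\<bar>"] by simp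
    qed (use MN in \<open>auto simp: D_def\<close>)
  qed
  then show ?thesis using that MN(1,2) by (simp add: D_def)
qed

section \<open>The limit infimum\<close>

lemma liminf_over_pos:
  assumes "\<epsilon> > 0" "finite Z" "\<And>x. x \<in> X \<Longrightarrow> x \<notin> Z \<Longrightarrow> \<epsilon> \<le> h x"
  shows "0 < liminf_over X h"
proof -
  have "0 < ereal \<epsilon>" using assms(1) by simp
  also have "ereal \<epsilon> \<le> (INF x\<in>X - (Z \<inter> X). ereal (h x))" using assms(3) by (intro INF_greatest) auto
  also have "\<dots> \<le> liminf_over X h" unfolding liminf_over_def using assms(2) by (intro SUP_upper) auto
  finally show ?thesis .
qed

lemma finite_auxiliary_zeros:
  assumes "M > 0" "N > 0"
  shows "finite {z::complex. z ^ M * (z ^ N - 1) = 0}"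
proof -
  have "{z::complex. z ^ M * (z ^ N - 1) = 0} \<subseteq> {0} \<union> {z. z ^ N = 1}" by auto
  moreover have "finite ({0} \<union> {z::complex. z ^ N = 1})" using finite_roots_unity[of N] assms(2) by simp
  ultimately show ?thesis by (rule finite_subset)
qed

theorem corollary4:
  "(\<forall>(p::nat) (L :: 'k::{field_char_0,complete_space} set).
      prime p \<and> is_Cp p TYPE('k) \<and> finite_galois_extension padic_field L \<longrightarrow>
      0 < liminf_over {\<alpha>. totally L \<alpha>} weil_height) \<and>
   0 < liminf_over {\<alpha>. totally (\<real> :: complex set) \<alpha>} weil_height"
proof (intro conjI allI impI)
  show "0 < liminf_over {\<alpha>. totally (\<real> :: complex set) \<alpha>} weil_height"
  proof (rule liminf_over_pos)
    show "finite {z::complex. z ^ 1 * (z ^ 2 - 1) = 0}" by (rule finite_auxiliary_zeros) auto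
    show "0 < ln 2 / real 4" by simp
  qed (use weil_height_totally_real in auto)
next
  fix p :: nat and L :: "'k set"
  assume *: "prime p \<and> is_Cp p TYPE('k) \<and> finite_galois_extension padic_field L"
  then have "finite_extension padic_field L" by (simp add: finite_galois_extension_def)
  with * obtain M N where MN: "M > 0" "N > 0"
    "\<And>\<alpha>. totally L \<alpha> \<Longrightarrow> \<alpha> ^ M * (\<alpha> ^ N - 1) \<noteq> 0 \<Longrightarrow> ln 2 / real (2 * M + N) \<le> weil_height \<alpha>"
    using weil_height_totally_padic by blast
  show "0 < liminf_over {\<alpha>. totally L \<alpha>} weil_height"
  proof (rule liminf_over_pos)
    show "finite {z::complex. z ^ M * (z ^ N - 1) = 0}" by (rule finite_auxiliary_zeros[OF MN(1,2)])
    show "0 < ln 2 / real (2 * M + N)" using MN by simp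
  qed (use MN(3) in auto)
qed

end
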